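(* Let $n\ge1$, let $\xi_1<\dots<\xi_n<0<\xi_{n+1}<\dots<\xi_{2n}$ be real numbers, $\sigma=\mathrm{diag}(\xi_1,\dots,\xi_{2n})$, $\sigma_1=\mathrm{diag}(\xi_1,\dots,\xi_n)$, $\sigma_2=\mathrm{diag}(\xi_{n+1},\dots,\xi_{2n})$. Let $Q=\begin{bmatrix} q_{11} & q_{12} \\ q_{21} & q_{22} \end{bmatrix}$ be a measurable complex $2n\times2n$ matrix function on $[0,\infty)$ ($n\times n$ blocks) with $\|Q(x)\|\le Ce^{-\varepsilon x}$ for constants $C,\varepsilon>0$, and such that the system $-i\,y'+Q(x)y=\lambda\sigma y$, $x\ge0$, is $\mathcal M$-canonical. Let $\lambda\in\mathbb R$ and let $y(x,\lambda)=\begin{bmatrix} y_1(x,\lambda) \\ y_2(x,\lambda) \end{bmatrix}$ be a bounded solution of this system, with $A,B\in\mathbb C^n$ the vectors for which $y_1(x,\lambda)=e^{i\lambda\sigma_1x}A+o(1)$, $y_2(x,\lambda)=e^{i\lambda\sigma_2x}B+o(1)$ as $x\to+\infty$. Then $$y_1(x,\lambda)=e^{i\lambda\sigma_1x}A+\int_x^{+\infty}A_{11}(x,t)e^{i\lambda\sigma_1t}A\,dt+\int_x^{+\infty}A_{12}(x,t)e^{i\lambda\sigma_2t}B\,dt,$$ $$y_2(x,\lambda)=e^{i\lambda\sigma_2x}B+\int_x^{+\infty}A_{21}(x,t)e^{i\lambda\sigma_1t}A\,dt+\int_x^{+\infty}A_{22}(x,t)e^{i\lambda\sigma_2t}B\,dt,$$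 where the $n\times n$ matrix kernels $A_{ij}(x,t)$, $t\ge x\ge0$, do not depend on $\lambda$, $A_{11}$ is lower triangular, $A_{12}$ lower anti-triangular, $A_{21}$ upper anti-triangular, $A_{22}$ upper triangular, and their entries satisfy, for $t\ge x$ and $k,j\in\{1,\dots,n\}$ in the positions allowed by these patterns, $$[A_{11}(x,t)]_{kj}=\tfrac{i\xi_j}{\xi_j-\xi_k}[q_{11}]_{kj}\!\left(x+\tfrac{\xi_j}{\xi_j-\xi_k}(t-x)\right)+i\int_x^{x+\frac{\xi_j}{\xi_j-\xi_k}(t-x)}[q_{11}A_{11}+q_{12}A_{21}]_{kj}\!\left(s,t+\tfrac{\xi_k}{\xi_j}(s-x)\right)ds,$$ $$[A_{21}(x,t)]_{kj}=\tfrac{i\xi_j}{\xi_j-\xi_{n+k}}[q_{21}]_{kj}\!\left(x+\tfrac{\xi_j}{\xi_j-\xi_{n+k}}(t-x)\right)+i\int_x^{x+\frac{\xi_j}{\xi_j-\xi_{n+k}}(t-x)}[q_{21}A_{11}+q_{22}A_{21}]_{kj}\!\left(s,t+\tfrac{\xi_{n+k}}{\xi_j}(s-x)\right)ds,$$ $$[A_{12}(x,t)]_{kj}=\tfrac{i\xi_{n+j}}{\xi_{n+j}-\xi_k}[q_{12}]_{kj}\!\left(x+\tfrac{\xi_{n+j}}{\xi_{n+j}-\xi_k}(t-x)\right)+i\int_x^{x+\frac{\xi_{n+j}}{\xi_{n+j}-\xi_k}(t-x)}[q_{12}A_{22}+q_{11}A_{12}]_{kj}\!\left(s,t+\tfrac{\xi_k}{\xi_{n+j}}(s-x)\right)ds,$$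 $$[A_{22}(x,t)]_{kj}=\tfrac{i\xi_{n+j}}{\xi_{n+j}-\xi_{n+k}}[q_{22}]_{kj}\!\left(x+\tfrac{\xi_{n+j}}{\xi_{n+j}-\xi_{n+k}}(t-x)\right)+i\int_x^{x+\frac{\xi_{n+j}}{\xi_{n+j}-\xi_{n+k}}(t-x)}[q_{21}A_{12}+q_{22}A_{22}]_{kj}\!\left(s,t+\tfrac{\xi_{n+k}}{\xi_{n+j}}(s-x)\right)ds,$$ where in the equations for $A_{11}$ and $A_{22}$ with $k=j$ the non-integral term is absent and the upper limit of integration is $+\infty$. In addition, for some constant $\tilde C$, $$\|A_{ij}(x,t)\|\le\tilde Ce^{-\varepsilon(x+\theta(t-x))},\qquad t\ge x\ge0,\ i,j=1,2,$$ and $$[q_{11}(x)]_{kj}=-i\tfrac{\xi_j-\xi_k}{\xi_j}[A_{11}(x,x)]_{kj},\qquad [q_{12}(x)]_{kj}=-i\tfrac{\xi_{n+j}-\xi_k}{\xi_{n+j}}[A_{12}(x,x)]_{kj},$$ $$[q_{21}(x)]_{kj}=-i\tfrac{\xi_j-\xi_{n+k}}{\xi_j}[A_{21}(x,x)]_{kj},\qquad [q_{22}(x)]_{kj}=-i\tfrac{\xi_{n+j}-\xi_{n+k}}{\xi_{n+j}}[A_{22}(x,x)]_{kj}.$$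
   Context: An $n\times n$ matrix $(a_{kj})$ is lower (strictly lower) triangular if $a_{kj}=0$ for $j>k$ ($j\ge k$); upper (strictly upper) triangular if $a_{kj}=0$ for $j<k$ ($j\le k$); lower anti-triangular if $a_{kj}=0$ for $k+j\le n$; upper anti-triangular if $a_{kj}=0$ for $k+j\ge n+2$. The system is called $\mathcal M$-canonical if $q_{11}$ is strictly lower triangular, $q_{12}$ is lower anti-triangular, $q_{21}$ is upper anti-triangular and $q_{22}$ is strictly upper triangular (for all $x$). Notation: $[M]_{kj}$ is the $(k,j)$ entry of $M$; $[qA]_{kj}(s,\tau)=[q(s)A(s,\tau)]_{kj}$. The number $\theta=\min\{\theta_1,\theta_2,\theta_3,\theta_4\}$, where, with $k,j\in\{1,\dots,n\}$, $$\theta_1=\min_{k>j}\tfrac{\xi_j}{\xi_j-\xi_k},\quad \theta_2=\min_{k+j>n}\tfrac{\xi_{n+j}}{\xi_{n+j}-\xi_k},\quad \theta_3=\min_{k+j<n+2}\tfrac{\xi_j}{\xi_j-\xi_{n+k}},\quad \theta_4=\min_{k<j}\tfrac{\xi_{n+j}}{\xi_{n+j}-\xi_{n+k}}$$ (a minimum over the empty set is $+\infty$). Solutions of the system are absolutely continuous functions satisfying it almost everywhere. For real $\lambda$ every bounded solution has asymptotics of the stated form with uniquely determined $A,B\in\mathbb C^n$. *)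

theory Defs
  imports "HOL-Analysis.Analysis"
begin

text \<open>
  Since $n$ and $2n$ both occur as dimensions, vectors and matrices are functions on \<open>nat\<close>, with
  indices starting at 1; entries outside \<open>{1..n}\<close> (resp. \<open>{1..2*n}\<close>) are irrelevant.
\<close>

type_synonym cvec = "nat \<Rightarrow> complex"
type_synonym cmat = "nat \<Rightarrow> nat \<Rightarrow> complex"

definition block_mat :: "nat \<Rightarrow> cmat \<Rightarrow> cmat \<Rightarrow> cmat \<Rightarrow> cmat \<Rightarrow> cmat" where
  "block_mat n M11 M12 M21 M22 k j =
     (if k \<le> n then (if j \<le> n then M11 k j else M12 k (j - n))
      else (if j \<le> n then M21 (k - n) j else M22 (k - n) (j - n)))"

definition block_vec :: "nat \<Rightarrow> cvec \<Rightarrow> cvec \<Rightarrow> cvec" where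
  "block_vec n v1 v2 k = (if k \<le> n then v1 k else v2 (k - n))"

definition mat_vec :: "nat \<Rightarrow> cmat \<Rightarrow> cvec \<Rightarrow> cvec" where
  "mat_vec m M v k = (\<Sum>j = 1..m. M k j * v j)"

definition mat_mul :: "nat \<Rightarrow> cmat \<Rightarrow> cmat \<Rightarrow> cmat" where
  "mat_mul m M N k j = (\<Sum>l = 1..m. M k l * N l j)"

text \<open>The Frobenius norm, as for the library's \<open>complex ^ 'm ^ 'm\<close>. It occurs only in bounds with
  an unspecified constant, so any other matrix norm gives the same statements.\<close>

definition mat_norm :: "nat \<Rightarrow> cmat \<Rightarrow> real" where
  "mat_norm m M = L2_set (\<lambda>k. L2_set (\<lambda>j. norm (M k j)) {1..m}) {1..m}"

definition lower_triangular :: "nat \<Rightarrow> cmat \<Rightarrow> bool" where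
  "lower_triangular n M \<longleftrightarrow> (\<forall>k\<in>{1..n}. \<forall>j\<in>{1..n}. j > k \<longrightarrow> M k j = 0)"

definition strictly_lower_triangular :: "nat \<Rightarrow> cmat \<Rightarrow> bool" where
  "strictly_lower_triangular n M \<longleftrightarrow> (\<forall>k\<in>{1..n}. \<forall>j\<in>{1..n}. j \<ge> k \<longrightarrow> M k j = 0)"

definition upper_triangular :: "nat \<Rightarrow> cmat \<Rightarrow> bool" where
  "upper_triangular n M \<longleftrightarrow> (\<forall>k\<in>{1..n}. \<forall>j\<in>{1..n}. j < k \<longrightarrow> M k j = 0)"

definition strictly_upper_triangular :: "nat \<Rightarrow> cmat \<Rightarrow> bool" where
  "strictly_upper_triangular n M \<longleftrightarrow> (\<forall>k\<in>{1..n}. \<forall>j\<in>{1..n}. j \<le> k \<longrightarrow> M k j = 0)"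

definition lower_anti_triangular :: "nat \<Rightarrow> cmat \<Rightarrow> bool" where
  "lower_anti_triangular n M \<longleftrightarrow> (\<forall>k\<in>{1..n}. \<forall>j\<in>{1..n}. k + j \<le> n \<longrightarrow> M k j = 0)"

definition upper_anti_triangular :: "nat \<Rightarrow> cmat \<Rightarrow> bool" where
  "upper_anti_triangular n M \<longleftrightarrow> (\<forall>k\<in>{1..n}. \<forall>j\<in>{1..n}. k + j \<ge> n + 2 \<longrightarrow> M k j = 0)"

definition M_canonical ::
  "nat \<Rightarrow> (real \<Rightarrow> cmat) \<Rightarrow> (real \<Rightarrow> cmat) \<Rightarrow> (real \<Rightarrow> cmat) \<Rightarrow> (real \<Rightarrow> cmat) \<Rightarrow> bool" where
  "M_canonical n q11 q12 q21 q22 \<longleftrightarrow>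
     (\<forall>x\<ge>0. strictly_lower_triangular n (q11 x) \<and> lower_anti_triangular n (q12 x) \<and>
            upper_anti_triangular n (q21 x) \<and> strictly_upper_triangular n (q22 x))"

definition absolutely_continuous_on_interval :: "real \<Rightarrow> real \<Rightarrow> (real \<Rightarrow> complex) \<Rightarrow> bool" where
  "absolutely_continuous_on_interval a b f \<longleftrightarrow>
     (\<forall>e>0. \<exists>d>0. \<forall>(m::nat) u v.
        (\<forall>i<m. a \<le> u i \<and> u i \<le> v i \<and> v i \<le> b) \<and>
        disjoint_family_on (\<lambda>i. {u i<..<v i}) {..<m} \<and>
        (\<Sum>i<m. v i - u i) < d \<longrightarrow>
        (\<Sum>i<m. norm (f (v i) - f (u i))) < e)"

text \<open>Solutions on $[0,\infty)$ of $-i y' + Q(x) y = \lambda\sigma y$ with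
  $\sigma = \mathrm{diag}(\xi_1,\dots,\xi_m)$; absolute continuity on $[0,\infty)$ is understood on
  every compact subinterval.\<close>

definition is_solution ::
  "nat \<Rightarrow> (nat \<Rightarrow> real) \<Rightarrow> (real \<Rightarrow> cmat) \<Rightarrow> real \<Rightarrow> (real \<Rightarrow> cvec) \<Rightarrow> bool" where
  "is_solution m \<xi> Q lam y \<longleftrightarrow>
     (\<forall>k\<in>{1..m}. \<forall>b\<ge>0. absolutely_continuous_on_interval 0 b (\<lambda>x. y x k)) \<and>
     (AE x in lebesgue. x \<ge> 0 \<longrightarrow>
        (\<exists>dy :: cvec. \<forall>k\<in>{1..m}.
           ((\<lambda>x. y x k) has_vector_derivative dy k) (at x within {0..}) \<and>
           - \<i> * dy k + mat_vec m (Q x) (y x) k = complex_of_real (lam * \<xi> k) * y x k))"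

text \<open>The vector $e^{i\lambda\,\mathrm{diag}(\zeta)\,x}\,v$.\<close>

definition exp_diag :: "real \<Rightarrow> (nat \<Rightarrow> real) \<Rightarrow> real \<Rightarrow> cvec \<Rightarrow> cvec" where
  "exp_diag lam \<zeta> x v k = exp (\<i> * complex_of_real (lam * \<zeta> k * x)) * v k"

text \<open>In \<open>ereal\<close> an infimum over the empty set is \<open>\<infinity>\<close>. For \<open>n \<ge> 1\<close> the index sets of \<open>theta2\<close> and
  \<open>theta3\<close> are nonempty, so the minimum \<open>theta\<close> of all four is finite.\<close>

definition theta1 :: "nat \<Rightarrow> (nat \<Rightarrow> real) \<Rightarrow> ereal" where
  "theta1 n \<xi> = (INF (k, j)\<in>{(k, j). k \<in> {1..n} \<and> j \<in> {1..n} \<and> k > j}.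
     ereal (\<xi> j / (\<xi> j - \<xi> k)))"

definition theta2 :: "nat \<Rightarrow> (nat \<Rightarrow> real) \<Rightarrow> ereal" where
  "theta2 n \<xi> = (INF (k, j)\<in>{(k, j). k \<in> {1..n} \<and> j \<in> {1..n} \<and> k + j > n}.
     ereal (\<xi> (n + j) / (\<xi> (n + j) - \<xi> k)))"

definition theta3 :: "nat \<Rightarrow> (nat \<Rightarrow> real) \<Rightarrow> ereal" where
  "theta3 n \<xi> = (INF (k, j)\<in>{(k, j). k \<in> {1..n} \<and> j \<in> {1..n} \<and> k + j < n + 2}.
     ereal (\<xi> j / (\<xi> j - \<xi> (n + k))))"

definition theta4 :: "nat \<Rightarrow> (nat \<Rightarrow> real) \<Rightarrow> ereal" where
  "theta4 n \<xi> = (INF (k, j)\<in>{(k, j). k \<in> {1..n} \<and> j \<in> {1..n} \<and> k < j}.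
     ereal (\<xi> (n + j) / (\<xi> (n + j) - \<xi> (n + k))))"

definition theta :: "nat \<Rightarrow> (nat \<Rightarrow> real) \<Rightarrow> real" where
  "theta n \<xi> = real_of_ereal (Min {theta1 n \<xi>, theta2 n \<xi>, theta3 n \<xi>, theta4 n \<xi>})"

text \<open>
  The integral equation for one entry of a kernel at the point $(x,t)$:
  \[ K(x,t) = \frac{i\,a}{a-b}\, p\Bigl(x + \frac{a}{a-b}(t-x)\Bigr)
       + i\int_x^{x+\frac{a}{a-b}(t-x)} F\Bigl(s,\, t + \frac{b}{a}(s-x)\Bigr)\,ds, \]
  where $a$ and $b$ are the entries of $\sigma$ belonging to the column and to the row of the entry.
  If $a = b$ the term with $p$ is absent and the upper limit is $+\infty$. A Bochner integral of a
  non-integrable function is \<open>0\<close> in HOL, so the convergence of the integrals is stated explicitly.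
\<close>

definition kernel_eq ::
  "real \<Rightarrow> real \<Rightarrow> (real \<Rightarrow> complex) \<Rightarrow> (real \<Rightarrow> real \<Rightarrow> complex) \<Rightarrow> (real \<Rightarrow> real \<Rightarrow> complex) \<Rightarrow>
   real \<Rightarrow> real \<Rightarrow> bool" where
  "kernel_eq a b p F K x t \<longleftrightarrow>
     (if a = b then
        set_integrable lebesgue {x..} (\<lambda>s. F s (t + b / a * (s - x))) \<and>
        K x t = \<i> * (LINT s:{x..}|lebesgue. F s (t + b / a * (s - x)))
      else
        set_integrable lebesgue {x..x + a / (a - b) * (t - x)} (\<lambda>s. F s (t + b / a * (s - x))) \<and>
        K x t = \<i> * complex_of_real (a / (a - b)) * p (x + a / (a - b) * (t - x)) +
          \<i> * (LINT s:{x..x + a / (a - b) * (t - x)}|lebesgue. F s (t + b / a * (s - x))))"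

end

theory Submission
  imports Defs
begin

text \<open>
  The kernels are built column by column. Put $\beta_k=\xi_k/\xi_j$ and rank the indices by
  $r(k)=k$, $r(n+k)=n+1-k$ for $1\le k\le n$. The system is $\mathcal M$-canonical exactly if $Q_{kl}\ne 0$
  forces $r(k)\ge r(l)$ and $k\ne l$, and $r(k)\ge r(j)$, $k\ne j$ imply $\beta_k<1$. So the rows $k$ with
  $r(k)\ge r(j)$ form a closed subsystem in which all characteristic lines
  $\tau=t+\beta_k(s-x)$ of column $j$ run from $(x,t)$ into the diagonal $\tau=s$, or parallel to it if
  $k=j$; extending the kernels by $0$ to $\tau<s$, all four integral equations become integrals
  over $s\ge x$. Picard iteration converges geometrically in the weight
  $e^{-\varepsilon(x+\theta(t-x))}\exp(Le^{-\varepsilon x})$. By Fubini along the characteristics the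
  transforms $\delta_{kj}e^{i\mu x}+\int_x^\infty K_k(x,t)e^{i\mu t}\,dt$ solve the Volterra equation
  that integration of the system from $x$ to $\infty$ gives for $y$, and the bounded solution of
  that equation is unique.

  Fubini needs jointly measurable kernels, whereas $Q$ is only Lebesgue measurable. The iteration is
  therefore carried out with a Borel version \<open>p\<close> of the coefficients \<open>q\<close>, and the result is corrected in the
  non-integral term; the integral terms do not notice the change.
\<close>

section \<open>Absolutely continuous functions\<close>

text \<open>The rank is not injective: \<open>k\<close> and \<open>n + (n + 1 - k)\<close> share it,
  and the anti-diagonals of \<open>q12\<close> and \<open>q21\<close> may couple them both ways. The
  rows of a column can therefore not be solved one after another, which is why they are iterated
  together. The two factors of the weight do separate work. Along a characteristic of row
  \<open>k\<close> the quantity x + \<theta>(t - x) changes at the rate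
  \<open>1 - \<theta> * (1 - \<beta> k)\<close>, which the choice of \<theta> keeps nonnegative; so
  the envelope can be pulled out of the integral and survives as the final bound. What remains is a
  scalar Volterra estimate. The double exponential settles it: it lies between 1 and a constant, and
  integrating it against the decay of Q returns at most half of it. Since Q is merely measurable,
  the kernels need not be differentiable and the solutions satisfy the system only almost
  everywhere. Everything is done with integral equations, and the passage from the system to its
  integral form rests on the fundamental theorem for absolutely continuous functions.\<close>

text \<open>The definition numbers its intervals by \<open>{..<m}\<close>. A bijection frees it for
  any finite index set, in particular for the tagged intervals of a partition.\<close>

lemma absolutely_continuous_on_intervalD:
  assumes "absolutely_continuous_on_interval a b f" "e > 0"
  obtains d where "d > 0"
    "\<And>(P :: 'i set) u v. \<lbrakk>finite P; \<And>i. i \<in> P \<Longrightarrow> a \<le> u i \<and> u i \<le> v i \<and> v i \<le> b;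
        disjoint_family_on (\<lambda>i. {u i<..<v i}) P; (\<Sum>i\<in>P. v i - u i) < d\<rbrakk>
      \<Longrightarrow> (\<Sum>i\<in>P. norm (f (v i) - f (u i))) < e"
proof -
  obtain d where "d > 0" and d: "\<forall>(m::nat) u v. (\<forall>i<m. a \<le> u i \<and> u i \<le> v i \<and> v i \<le> b) \<and>
      disjoint_family_on (\<lambda>i. {u i<..<v i}) {..<m} \<and> (\<Sum>i<m. v i - u i) < d \<longrightarrow>
      (\<Sum>i<m. norm (f (v i) - f (u i))) < e"
    using assms unfolding absolutely_continuous_on_interval_def by blast
  show thesis
  proof (rule that[OF \<open>d > 0\<close>])
    fix P :: "'i set" and u v :: "'i \<Rightarrow> real"
    assume P: "finite P" "\<And>i. i \<in> P \<Longrightarrow> a \<le> u i \<and> u i \<le> v i \<and> v i \<le> b"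
      "disjoint_family_on (\<lambda>i. {u i<..<v i}) P" "(\<Sum>i\<in>P. v i - u i) < d"
    obtain h where h: "bij_betw h {..<card P} P"
      using ex_bij_betw_nat_finite[OF \<open>finite P\<close>] by (auto simp: atLeast0LessThan)
    have "(\<Sum>i<card P. norm (f (v (h i)) - f (u (h i)))) < e"
    proof (rule d[rule_format], intro conjI allI impI)
      have "\<And>i. i < card P \<Longrightarrow> h i \<in> P"
        using bij_betwE[OF h] by auto
      then show "a \<le> u (h i)" "u (h i) \<le> v (h i)" "v (h i) \<le> b" if "i < card P" for i
        using that P(2) by blast+
      show "disjoint_family_on (\<lambda>i. {u (h i)<..<v (h i)}) {..<card P}"
        using P(3) h unfolding disjoint_family_on_def bij_betw_def inj_on_def by blast
      show "(\<Sum>i<card P. v (h i) - u (h i)) < d"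
        using P(4) sum.reindex_bij_betw[OF h, of "\<lambda>i. v i - u i"] by simp
    qed
    then show "(\<Sum>i\<in>P. norm (f (v i) - f (u i))) < e"
      using sum.reindex_bij_betw[OF h, of "\<lambda>i. norm (f (v i) - f (u i))"] by simp
  qed
qed

lemma absolutely_continuous_on_interval_imp_continuous_on:
  assumes ac: "absolutely_continuous_on_interval a b f"
  shows "continuous_on {a..b} f"
  unfolding continuous_on_iff
proof (intro ballI allI impI)
  fix x and e :: real
  assume x: "x \<in> {a..b}" and "e > 0"
  obtain d where "d > 0"
    and d: "\<And>(P :: nat set) u v. \<lbrakk>finite P; \<And>i. i \<in> P \<Longrightarrow> a \<le> u i \<and> u i \<le> v i \<and> v i \<le> b;
        disjoint_family_on (\<lambda>i. {u i<..<v i}) P; (\<Sum>i\<in>P. v i - u i) < d\<rbrakk>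
      \<Longrightarrow> (\<Sum>i\<in>P. norm (f (v i) - f (u i))) < e"
    by (rule absolutely_continuous_on_intervalD[OF ac \<open>e > 0\<close>, where 'i = nat]) blast
  have "norm (f z - f y) < e" if "a \<le> y" "y \<le> z" "z \<le> b" "z - y < d" for y z
    using d[of "{0}" "\<lambda>_. y" "\<lambda>_. z"] that by (simp add: disjoint_family_on_def)
  from this[of x] this[of _ x]
  have "dist (f x') (f x) < e" if "x' \<in> {a..b}" "dist x' x < d" for x'
    using x that by (cases "x \<le> x'") (auto simp: dist_norm norm_minus_commute)
  then show "\<exists>d>0. \<forall>x'\<in>{a..b}. dist x' x < d \<longrightarrow> dist (f x') (f x) < e"
    using \<open>d > 0\<close> by blast
qed

text \<open>Meant for the integrating factor of the differential system. The increment of the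
  product splits as \<open>g v * (f v - f u) + (g v - g u) * f u\<close>; the second part is
  controlled by the total length, since \<open>f\<close> is bounded on a compact interval.\<close>

lemma absolutely_continuous_on_interval_lipschitz_mult:
  assumes ac: "absolutely_continuous_on_interval a b f"
    and lip: "\<And>x y. norm (g x - g y) \<le> L * \<bar>x - y\<bar>" and g: "\<And>x. norm (g x) \<le> 1"
  shows "absolutely_continuous_on_interval a b (\<lambda>x. g x * f x)"
  unfolding absolutely_continuous_on_interval_def
proof (intro allI impI)
  fix e :: real
  assume "e > 0"
  have "L \<ge> 0"
    using order_trans[OF norm_ge_zero lip[of 1 0]] by simp
  have "bounded (f ` {a..b})"
    using absolutely_continuous_on_interval_imp_continuous_on[OF ac] compact_Icc
    by (meson compact_continuous_image compact_imp_bounded)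
  then obtain M where "M > 0" and M: "\<And>x. x \<in> {a..b} \<Longrightarrow> norm (f x) \<le> M"
    unfolding bounded_pos by auto
  obtain d where "d > 0"
    and d: "\<And>(P :: nat set) u v. \<lbrakk>finite P; \<And>i. i \<in> P \<Longrightarrow> a \<le> u i \<and> u i \<le> v i \<and> v i \<le> b;
        disjoint_family_on (\<lambda>i. {u i<..<v i}) P; (\<Sum>i\<in>P. v i - u i) < d\<rbrakk>
      \<Longrightarrow> (\<Sum>i\<in>P. norm (f (v i) - f (u i))) < e / 2"
    by (rule absolutely_continuous_on_intervalD[OF ac half_gt_zero[OF \<open>e > 0\<close>], where 'i = nat]) blast
  \<comment> \<open>The second entry keeps the Lipschitz part below \<open>e / 2\<close>; the added
    1 makes the denominator positive when \<open>L = 0\<close>.\<close>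
  define d' where "d' = min d (e / (2 * (M * L + 1)))"
  have "M * L + 1 > 0"
    using \<open>M > 0\<close> \<open>L \<ge> 0\<close> by (simp add: add_nonneg_pos)
  then have "d' > 0"
    using \<open>d > 0\<close> \<open>e > 0\<close> by (simp add: d'_def)
  show "\<exists>d>0. \<forall>(m::nat) u v. (\<forall>i<m. a \<le> u i \<and> u i \<le> v i \<and> v i \<le> b) \<and>
      disjoint_family_on (\<lambda>i. {u i<..<v i}) {..<m} \<and> (\<Sum>i<m. v i - u i) < d \<longrightarrow>
      (\<Sum>i<m. norm (g (v i) * f (v i) - g (u i) * f (u i))) < e"
  proof (intro exI[of _ d'] conjI allI impI)
    fix m :: nat and u v
    assume A': "(\<forall>i<m. a \<le> u i \<and> u i \<le> v i \<and> v i \<le> b) \<and>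
      disjoint_family_on (\<lambda>i. {u i<..<v i}) {..<m} \<and> (\<Sum>i<m. v i - u i) < d'"
    then have A: "\<forall>i<m. a \<le> u i \<and> u i \<le> v i \<and> v i \<le> b" "disjoint_family_on (\<lambda>i. {u i<..<v i}) {..<m}"
      "(\<Sum>i<m. v i - u i) < d'"
      by blast+
    have "norm (g (v i) * f (v i) - g (u i) * f (u i)) \<le> norm (f (v i) - f (u i)) + M * L * (v i - u i)"
      if "i < m" for i
    proof -
      have "g (v i) * f (v i) - g (u i) * f (u i) = g (v i) * (f (v i) - f (u i)) + (g (v i) - g (u i)) * f (u i)"
        by (simp add: algebra_simps)
      also have "norm \<dots> \<le> norm (g (v i)) * norm (f (v i) - f (u i)) + norm (g (v i) - g (u i)) * norm (f (u i))"
        by (metis norm_mult norm_triangle_ineq)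
      also have "\<dots> \<le> 1 * norm (f (v i) - f (u i)) + L * \<bar>v i - u i\<bar> * M"
        using lip[of "v i" "u i"] g M[of "u i"] A(1) that \<open>L \<ge> 0\<close>
        by (intro add_mono mult_mono) auto
      finally show ?thesis
        using A(1) that by (simp add: mult_ac)
    qed
    then have "(\<Sum>i<m. norm (g (v i) * f (v i) - g (u i) * f (u i)))
        \<le> (\<Sum>i<m. norm (f (v i) - f (u i)) + M * L * (v i - u i))"
      by (intro sum_mono) auto
    also have "\<dots> = (\<Sum>i<m. norm (f (v i) - f (u i))) + M * L * (\<Sum>i<m. v i - u i)"
      by (simp add: sum.distrib sum_distrib_left)
    also have "\<dots> < e / 2 + e / 2"
    proof (rule add_less_le_mono)
      show "(\<Sum>i<m. norm (f (v i) - f (u i))) < e / 2"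
        using A by (intro d) (auto simp: d'_def)
      have "M * L * (\<Sum>i<m. v i - u i) \<le> (M * L + 1) * d'"
        using A \<open>M > 0\<close> \<open>L \<ge> 0\<close> by (intro mult_mono) (auto intro!: sum_nonneg)
      also have "\<dots> \<le> (M * L + 1) * (e / (2 * (M * L + 1)))"
        using \<open>M * L + 1 > 0\<close> by (intro mult_left_mono) (auto simp: d'_def)
      also have "\<dots> = e / 2"
        using \<open>M * L + 1 > 0\<close> by (simp add: field_simps)
      finally show "M * L * (\<Sum>i<m. v i - u i) \<le> e / 2" .
    qed
    finally show "(\<Sum>i<m. norm (g (v i) * f (v i) - g (u i) * f (u i))) < e"
      by simp
  qed fact
qed

text \<open>In the Riemann sums the tags in the exceptional set \<open>N\<close> are controlled by absolute continuity:
  the gauge there is an open set of small measure containing \<open>N\<close>.\<close>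

theorem has_integral_absolutely_continuous_on_interval:
  fixes f g :: "real \<Rightarrow> complex"
  assumes "a \<le> b" and ac: "absolutely_continuous_on_interval a b f"
    and N: "N \<in> null_sets lebesgue"
    and deriv: "\<And>x. x \<in> {a..b} - N \<Longrightarrow> (f has_vector_derivative g x) (at x within {a..b})"
  shows "(g has_integral f b - f a) {a..b}"
proof -
  \<comment> \<open>With the value 0 on \<open>N\<close>, a tag in \<open>N\<close> contributes
    exactly the increment of \<open>f\<close> over its interval to the error, and absolute
    continuity bounds these increments.\<close>
  define g' where "g' x = (if x \<in> N then 0 else g x)" for x
  have "(g' has_integral f b - f a) {a..b}"
    unfolding has_integral_real
  proof (intro allI impI)
    fix e :: real
    assume "e > 0"
    obtain d where "d > 0"
      and d: "\<And>(P :: (real \<times> real set) set) u v. \<lbrakk>finite P; \<And>i. i \<in> P \<Longrightarrow> a \<le> u i \<and> u i \<le> v i \<and> v i \<le> b;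
          disjoint_family_on (\<lambda>i. {u i<..<v i}) P; (\<Sum>i\<in>P. v i - u i) < d\<rbrakk>
        \<Longrightarrow> (\<Sum>i\<in>P. norm (f (v i) - f (u i))) < e / 2"
      by (rule absolutely_continuous_on_intervalD[OF ac half_gt_zero[OF \<open>e > 0\<close>], where 'i = "real \<times> real set"])
        blast
    obtain U where U: "open U" "N \<subseteq> U" "emeasure lebesgue (U - N) < ennreal d"
      by (rule sets_lebesgue_outer_open[OF null_setsD2[OF N] \<open>d > 0\<close>])
    have "emeasure lebesgue U = emeasure lebesgue (U - N)"
      using emeasure_Diff_null_set[OF N, of U] \<open>open U\<close> by simp
    then have emU: "emeasure lebesgue U < ennreal d"
      using U(3) by simp
    then have Um: "U \<in> fmeasurable lebesgue"
      using \<open>open U\<close> less_trans[OF emU ennreal_less_top] by (intro fmeasurableI) auto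
    then have mU: "measure lebesgue U < d"
      using emU \<open>d > 0\<close> by (simp add: emeasure_eq_measure2 ennreal_less_iff)
    \<comment> \<open>The added 1 covers the degenerate interval \<open>a = b\<close>.\<close>
    define e' where "e' = e / (2 * (b - a + 1))"
    have "e' > 0"
      using \<open>e > 0\<close> \<open>a \<le> b\<close> by (simp add: e'_def)
    have "\<exists>r>0. x \<in> {a..b} - N \<longrightarrow>
         (\<forall>y\<in>{a..b}. norm (y-x) < r \<longrightarrow> norm (f y - f x - (y-x) *\<^sub>R g x) \<le> e' * norm (y-x))" for x
    proof (cases "x \<in> {a..b} - N")
      case True
      then show ?thesis
        using deriv[OF True, unfolded has_vector_derivative_def has_derivative_within_alt] \<open>e' > 0\<close>
        by blast
    next
      case False
      then have "x \<in> {a..b} - N \<longrightarrow> P" for P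
        by blast
      then show ?thesis
        using zero_less_one by blast
    qed
    then obtain r where r: "\<And>x. 0 < r x"
                   "\<And>x y. \<lbrakk>x \<in> {a..b} - N; y \<in> {a..b}; norm (y-x) < r x\<rbrakk>
                          \<Longrightarrow> norm (f y - f x - (y-x) *\<^sub>R g x) \<le> e' * norm (y-x)"
      by metis
    define \<gamma> where "\<gamma> x = (if x \<in> N then U else ball x (r x))" for x
    have gauge: "gauge \<gamma>"
      using U r(1) by (auto simp: gauge_def \<gamma>_def)
    have main: "norm ((\<Sum>(x,K)\<in>p. measure lborel K *\<^sub>R g' x) - (f b - f a)) < e"
      if p: "p tagged_division_of {a..b}" and fine: "\<gamma> fine p" for p
    proof -
      have "finite p"
        using p by blast
      have cboxK: "\<exists>u v. K = {u..v} \<and> u \<le> v \<and> a \<le> u \<and> v \<le> b \<and> u \<le> x \<and> x \<le> v" if "(x, K) \<in> p" for x K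
      proof -
        obtain u v where "K = cbox u v" "x \<in> K" "K \<subseteq> {a..b}"
          using p \<open>(x, K) \<in> p\<close> by blast
        then show ?thesis
          by auto
      qed
      have interval: "a \<le> Inf (snd i) \<and> Inf (snd i) \<le> Sup (snd i) \<and> Sup (snd i) \<le> b" if "i \<in> p" for i
        using cboxK[of "fst i" "snd i"] that by force
      define h where "h = (\<lambda>(x, K). measure lborel K *\<^sub>R g' x - (f (Sup K) - f (Inf K)))"
      define P1 where "P1 = {(x, K) \<in> p. x \<in> N}"
      define P2 where "P2 = {(x, K) \<in> p. x \<notin> N}"
      have P12: "p = P1 \<union> P2" "P1 \<inter> P2 = {}" "finite P1" "finite P2"
        using \<open>finite p\<close> by (auto simp: P1_def P2_def intro: finite_subset[of _ p])
      have "norm (sum h P1) \<le> (\<Sum>i\<in>P1. norm (h i))"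
        by (rule norm_sum)
      also have "\<dots> = (\<Sum>i\<in>P1. norm (f (Sup (snd i)) - f (Inf (snd i))))"
        by (intro sum.cong) (auto simp: P1_def h_def g'_def norm_minus_commute)
      also have "\<dots> < e / 2"
      proof (rule d[OF \<open>finite P1\<close>])
        show "a \<le> Inf (snd i) \<and> Inf (snd i) \<le> Sup (snd i) \<and> Sup (snd i) \<le> b" if "i \<in> P1" for i
          using that interval by (auto simp: P1_def)
        have int_K: "{Inf K<..<Sup K} = interior K" if "(x, K) \<in> p" for x K
          using cboxK[OF that] by (auto simp: interior_atLeastAtMost_real)
        show disj: "disjoint_family_on (\<lambda>i. {Inf (snd i)<..<Sup (snd i)}) P1"
          unfolding disjoint_family_on_def
        proof (intro ballI impI)
          fix i j
          assume "i \<in> P1" "j \<in> P1" "i \<noteq> j"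
          moreover obtain x K y K' where "i = (x, K)" "j = (y, K')"
            by (metis prod.collapse)
          ultimately have "(x, K) \<in> p" "(y, K') \<in> p" "(x, K) \<noteq> (y, K')"
            by (auto simp: P1_def)
          then show "{Inf (snd i)<..<Sup (snd i)} \<inter> {Inf (snd j)<..<Sup (snd j)} = {}"
            using tagged_division_ofD(5)[OF p] int_K \<open>i = (x, K)\<close> \<open>j = (y, K')\<close> by simp
        qed
        have "(\<Sum>i\<in>P1. Sup (snd i) - Inf (snd i)) = (\<Sum>i\<in>P1. measure lebesgue {Inf (snd i)<..<Sup (snd i)})"
          using interval P12(1) by (intro sum.cong) auto
        also have "\<dots> = measure lebesgue (\<Union>i\<in>P1. {Inf (snd i)<..<Sup (snd i)})"
        proof (intro measure_finite_Union[symmetric] \<open>finite P1\<close> disj)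
          show "emeasure lebesgue {Inf (snd i)<..<Sup (snd i)} \<noteq> \<infinity>" if "i \<in> P1" for i
            using emeasure_bounded_finite[of "{Inf (snd i)<..<Sup (snd i)}"] by auto
        qed auto
        also have "\<dots> \<le> measure lebesgue U"
        proof (intro measure_mono_fmeasurable Um UN_least)
          fix i
          assume i: "i \<in> P1"
          obtain x K where "i = (x, K)" "x \<in> N" "(x, K) \<in> p"
            using i by (auto simp: P1_def)
          then show "{Inf (snd i)<..<Sup (snd i)} \<subseteq> U"
            using fineD[OF fine \<open>(x, K) \<in> p\<close>] interior_subset[of K] int_K by (auto simp: \<gamma>_def)
        next
          show "(\<Union>i\<in>P1. {Inf (snd i)<..<Sup (snd i)}) \<in> sets lebesgue"
            using \<open>finite P1\<close> by auto
        qed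
        finally show "(\<Sum>i\<in>P1. Sup (snd i) - Inf (snd i)) < d"
          using mU by simp
      qed
      finally have 1: "norm (sum h P1) < e / 2" .
      have "norm (sum h P2) \<le> (\<Sum>i\<in>P2. e' * (Sup (snd i) - Inf (snd i)))"
      proof (rule sum_norm_le)
        fix i
        assume "i \<in> P2"
        then obtain x K where i: "i = (x, K)" "x \<notin> N" "(x, K) \<in> p"
          by (auto simp: P2_def)
        obtain u v where K: "K = {u..v}" "u \<le> v" "a \<le> u" "v \<le> b" and ux: "u \<le> x" "x \<le> v"
          using cboxK[OF i(3)] by auto
        have KU: "K \<subseteq> ball x (r x)"
          using fineD[OF fine i(3)] i(2) by (simp add: \<gamma>_def)
        have uv: "norm (u - x) < r x" "norm (v - x) < r x"
          using subsetD[OF KU, of u] subsetD[OF KU, of v] K(1,2) by (auto simp: dist_norm)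
        \<comment> \<open>The increment is split at the tag \<open>x\<close>. As \<open>x\<close>
          lies between \<open>u\<close> and \<open>v\<close>, the two errors add up to a multiple of
          \<open>v - u\<close> itself.\<close>
        have "norm ((v - u) *\<^sub>R g x - (f v - f u))
            = norm (f u - f x - (u - x) *\<^sub>R g x - (f v - f x - (v - x) *\<^sub>R g x))"
          by (auto simp: algebra_simps)
        also have "\<dots> \<le> norm (f u - f x - (u - x) *\<^sub>R g x) + norm (f v - f x - (v - x) *\<^sub>R g x)"
          by (rule norm_triangle_ineq4)
        also have "\<dots> \<le> e' * norm (u - x) + e' * norm (v - x)"
          using K(2-) ux i uv by (intro add_mono r) auto
        also have "\<dots> = e' * (v - u)"
          using ux by (simp add: algebra_simps)
        finally show "norm (h i) \<le> e' * (Sup (snd i) - Inf (snd i))"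
          using K(1,2) i by (simp add: h_def g'_def)
      qed
      also have "\<dots> \<le> (\<Sum>i\<in>p. e' * (Sup (snd i) - Inf (snd i)))"
      proof (rule sum_mono2[OF \<open>finite p\<close>])
        show "0 \<le> e' * (Sup (snd i) - Inf (snd i))" if "i \<in> p - P2" for i
          using interval[of i] that \<open>e' > 0\<close> by simp
      qed (use P12 in blast)
      also have "\<dots> = e' * (b - a)"
        using additive_tagged_division_1[OF \<open>a \<le> b\<close> p, of "\<lambda>x. x"]
        by (simp add: sum_distrib_left[symmetric] case_prod_unfold)
      also have "\<dots> \<le> e' * (b - a + 1)"
        using \<open>e' > 0\<close> by simp
      also have "\<dots> = e / 2"
        using \<open>a \<le> b\<close> by (simp add: e'_def field_simps)
      finally have 2: "norm (sum h P2) \<le> e / 2" .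
      have "(\<Sum>(x,K)\<in>p. measure lborel K *\<^sub>R g' x) - (f b - f a) = sum h p"
        unfolding additive_tagged_division_1[OF \<open>a \<le> b\<close> p, of f, symmetric]
        by (simp add: h_def case_prod_unfold sum_subtractf)
      also have "\<dots> = sum h P1 + sum h P2"
        using P12 by (simp add: sum.union_disjoint)
      finally show ?thesis
        using 1 2 norm_triangle_ineq[of "sum h P1" "sum h P2"] by simp
    qed
    show "\<exists>\<gamma>. gauge \<gamma> \<and> (\<forall>\<D>. \<D> tagged_division_of {a..b} \<and> \<gamma> fine \<D> \<longrightarrow>
        norm ((\<Sum>(x,K)\<in>\<D>. measure lborel K *\<^sub>R g' x) - (f b - f a)) < e)"
      by (intro exI[of _ \<gamma>] conjI allI impI gauge main; simp)
  qed
  then show ?thesis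
    by (rule has_integral_spike[rotated 2]) (use N in \<open>auto simp: g'_def negligible_iff_null_sets\<close>)
qed

section \<open>The kernels of one column\<close>

lemma has_bochner_integral_FTC_atLeast:
  fixes f F :: "real \<Rightarrow> real"
  assumes [measurable]: "f \<in> borel_measurable borel"
    and F: "\<And>x. a \<le> x \<Longrightarrow> (F has_real_derivative f x) (at x)"
    and nonneg: "\<And>x. a \<le> x \<Longrightarrow> 0 \<le> f x" and lim: "(F \<longlongrightarrow> T) at_top"
  shows "has_bochner_integral lborel (\<lambda>x. indicator {a..} x * f x) (T - F a)"
proof (rule has_bochner_integral_nn_integral)
  have "F a \<le> F x" if "a \<le> x" for x
    using F nonneg that by (intro DERIV_nonneg_imp_nondecreasing[of a x F]) auto
  then have "F a \<le> T"
    by (intro tendsto_lowerbound[OF lim]) (auto simp: eventually_at_top_linorder)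
  then show "0 \<le> T - F a"
    by simp
  have "(\<integral>\<^sup>+x. ennreal (indicator {a..} x * f x) \<partial>lborel) = (\<integral>\<^sup>+x. ennreal (f x) * indicator {a..} x \<partial>lborel)"
    by (intro nn_integral_cong) (auto split: split_indicator)
  also have "\<dots> = ennreal (T - F a)"
    using nn_integral_FTC_atLeast[OF assms(1) F nonneg lim] by simp
  finally show "(\<integral>\<^sup>+x. ennreal (indicator {a..} x * f x) \<partial>lborel) = ennreal (T - F a)" .
qed (auto intro!: nonneg split: split_indicator)

lemma has_bochner_integral_exp_neg:
  fixes a x :: real
  assumes "a > 0"
  shows "has_bochner_integral lborel (\<lambda>s. indicator {x..} s * exp (- a * s)) (exp (- a * x) / a)"
proof -
  have "filterlim (\<lambda>s. a * s) at_top at_top"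
    using assms by (intro filterlim_tendsto_pos_mult_at_top[OF tendsto_const]) (auto intro: filterlim_ident)
  then have "((\<lambda>s. - exp (- a * s) / a) \<longlongrightarrow> - 0 / a) at_top"
    using assms by (intro tendsto_intros filterlim_compose[OF exp_at_bot])
      (auto simp: filterlim_uminus_at_top)
  moreover have "((\<lambda>s. - exp (- a * s) / a) has_real_derivative exp (- a * s)) (at s)" for s
    using assms by (auto intro!: derivative_eq_intros)
  ultimately show ?thesis
    using has_bochner_integral_FTC_atLeast[of "\<lambda>s. exp (- a * s)" x "\<lambda>s. - exp (- a * s) / a" "- 0 / a"]
    by simp
qed

text \<open>The integrand is the derivative of the double exponential up to the factor
  \<open>- (L * \<epsilon>)\<close>, so this weight reproduces itself under a Volterra integral. The
  subtracted 1 is its limit at infinity.\<close>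

lemma has_bochner_integral_exp_exp_neg:
  fixes \<epsilon> L x :: real
  assumes "\<epsilon> > 0" "L > 0"
  shows "has_bochner_integral lborel
    (\<lambda>s. indicator {x..} s * (exp (- \<epsilon> * s) * exp (L * exp (- \<epsilon> * s))))
    ((exp (L * exp (- \<epsilon> * x)) - 1) / (L * \<epsilon>))"
proof -
  have "filterlim (\<lambda>s. \<epsilon> * s) at_top at_top"
    using assms by (intro filterlim_tendsto_pos_mult_at_top[OF tendsto_const]) (auto intro: filterlim_ident)
  then have "((\<lambda>s. - exp (L * exp (- \<epsilon> * s)) / (L * \<epsilon>)) \<longlongrightarrow> - exp (L * 0) / (L * \<epsilon>)) at_top"
    using assms by (intro tendsto_intros filterlim_compose[OF exp_at_bot])
      (auto simp: filterlim_uminus_at_top)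
  moreover have "((\<lambda>s. - exp (L * exp (- \<epsilon> * s)) / (L * \<epsilon>)) has_real_derivative
      exp (- \<epsilon> * s) * exp (L * exp (- \<epsilon> * s))) (at s)" for s
    using assms by (auto intro!: derivative_eq_intros)
  moreover have "- exp (L * 0) / (L * \<epsilon>) - (- exp (L * exp (- \<epsilon> * x)) / (L * \<epsilon>))
      = (exp (L * exp (- \<epsilon> * x)) - 1) / (L * \<epsilon>)"
    by (simp add: diff_divide_distrib)
  ultimately show ?thesis
    using has_bochner_integral_FTC_atLeast[of "\<lambda>s. exp (- \<epsilon> * s) * exp (L * exp (- \<epsilon> * s))" x
        "\<lambda>s. - exp (L * exp (- \<epsilon> * s)) / (L * \<epsilon>)" "- exp (L * 0) / (L * \<epsilon>)"]
    by simp
qed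

text \<open>In the application \<open>\<beta> k\<close> is \<open>\<xi> k / \<xi> j\<close> and
  \<open>I\<close> consists of the rows of rank at least that of \<open>j\<close>. The condition
  \<open>\<theta>_le\<close> is \<theta> \<le> 1 / (1 - \<open>\<beta> k\<close>) cleared of its
  denominator, so that it also makes sense for \<open>k = j\<close>. Injectivity of \<beta>
  separates the characteristic directions of different rows; this is what makes the exchange of
  \<open>q\<close> for \<open>p\<close> harmless along characteristics.\<close>

locale kernel_column =
  fixes I :: "'i set" and j :: 'i and \<beta> :: "'i \<Rightarrow> real" and q p :: "'i \<Rightarrow> 'i \<Rightarrow> real \<Rightarrow> complex"
    and C \<epsilon> \<theta> :: real
  assumes fin: "finite I" and j: "j \<in> I" and \<beta>_j: "\<beta> j = 1"
    and \<beta>_less: "\<And>k. k \<in> I \<Longrightarrow> k \<noteq> j \<Longrightarrow> \<beta> k < 1" and \<beta>_inj: "inj_on \<beta> I"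
    and C: "C > 0" and \<epsilon>: "\<epsilon> > 0" and \<theta>: "\<theta> > 0"
    and \<theta>_le: "\<And>k. k \<in> I \<Longrightarrow> \<theta> * (1 - \<beta> k) \<le> 1"
    and q_meas [measurable]: "\<And>k l. q k l \<in> borel_measurable lebesgue"
    and p_meas [measurable]: "\<And>k l. p k l \<in> borel_measurable borel"
    and q_bound: "\<And>k l x. norm (q k l x) \<le> C * exp (- \<epsilon> * x)"
    and p_bound: "\<And>k l x. norm (p k l x) \<le> C * exp (- \<epsilon> * x)"
    and q_diag: "\<And>k x. q k k x = 0" and p_diag: "\<And>k x. p k k x = 0"
    and q_eq_p: "\<And>k l. AE x in lebesgue. q k l x = p k l x"
begin

text \<open>For \<open>k = j\<close> the division by zero gives \<open>c j = 0\<close>; the corresponding entries vanish anyway.\<close>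

definition c :: "'i \<Rightarrow> real" where "c k = 1 / (1 - \<beta> k)"

text \<open>The argument \<open>x + c k * (t - x)\<close> is the value of \<open>s\<close> at which
  the characteristic \<open>t + \<beta> k * (s - x)\<close> meets the diagonal. The coefficient is a
  parameter because the term is needed for both \<open>p\<close> and \<open>q\<close>.\<close>

definition G :: "('i \<Rightarrow> 'i \<Rightarrow> real \<Rightarrow> complex) \<Rightarrow> 'i \<Rightarrow> real \<Rightarrow> real \<Rightarrow> complex" where
  "G f k x t = \<i> * complex_of_real (c k) * f k j (x + c k * (t - x))"

definition env :: "real \<Rightarrow> real \<Rightarrow> real" where "env x t = exp (- \<epsilon> * (x + \<theta> * (t - x)))"

text \<open>Chosen so that \<open>C * card I / (L * \<epsilon>)\<close> equals 1/2; this quotient is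
  the constant that appears when \<open>C * card I * exp (- \<epsilon> * s) * W s\<close> is
  integrated over \<open>{x..}\<close>.\<close>

definition L :: real where "L = 2 * C * card I / \<epsilon>"

text \<open>With this weight the integral operator \<open>T\<close> contracts by the factor 1/2.\<close>

definition W :: "real \<Rightarrow> real" where "W x = exp (L * exp (- \<epsilon> * x))"

definition J :: "('i \<Rightarrow> real \<times> real \<Rightarrow> complex) \<Rightarrow> 'i \<Rightarrow> real \<Rightarrow> real \<Rightarrow> real \<Rightarrow> complex" where
  "J f k x t s = indicator {x..} s *\<^sub>R (\<Sum>l\<in>I. p k l s * f l (s, t + \<beta> k * (s - x)))"

definition T :: "('i \<Rightarrow> real \<times> real \<Rightarrow> complex) \<Rightarrow> 'i \<Rightarrow> real \<Rightarrow> real \<Rightarrow> complex" where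
  "T f k x t = \<i> * (\<integral>s. J f k x t s \<partial>lborel)"

definition picard :: "('i \<Rightarrow> real \<times> real \<Rightarrow> complex) \<Rightarrow> 'i \<Rightarrow> real \<times> real \<Rightarrow> complex" where
  "picard f k z = (if 0 \<le> fst z \<and> fst z \<le> snd z then G p k (fst z) (snd z) + T f k (fst z) (snd z) else 0)"

definition S :: "nat \<Rightarrow> 'i \<Rightarrow> real \<times> real \<Rightarrow> complex" where
  "S m = (picard ^^ m) (\<lambda>_ _. 0)"

definition H :: "'i \<Rightarrow> real \<times> real \<Rightarrow> complex" where
  "H k z = lim (\<lambda>m. S m k z)"

text \<open>The closed ball of radius \<open>B\<close> in the supremum norm with weight
  \<open>env x t * W x\<close> on the wedge. Measurability and vanishing off the wedge are asked of
  every \<open>k\<close>, so that they can be used without checking membership in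
  \<open>I\<close>.\<close>

definition adm :: "('i \<Rightarrow> real \<times> real \<Rightarrow> complex) \<Rightarrow> real \<Rightarrow> bool" where
  "adm f B \<longleftrightarrow> 0 \<le> B \<and> (\<forall>k. f k \<in> borel_measurable borel) \<and>
    (\<forall>k x t. \<not> (0 \<le> x \<and> x \<le> t) \<longrightarrow> f k (x, t) = 0) \<and>
    (\<forall>k\<in>I. \<forall>x t. 0 \<le> x \<longrightarrow> x \<le> t \<longrightarrow> norm (f k (x, t)) \<le> B * (env x t * W x))"

definition M :: real where "M = C * (\<Sum>k\<in>I. c k)"

section \<open>Weights and estimates along the characteristics\<close>

lemma card_I: "card I > 0"
  using fin j by (auto simp: card_gt_0_iff)

lemma L_pos: "L > 0"
  using C \<epsilon> card_I by (simp add: L_def)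

lemma c_nonneg: "k \<in> I \<Longrightarrow> 0 \<le> c k"
  using \<beta>_less[of k] \<beta>_j by (cases "k = j") (auto simp: c_def)

lemma c_pos: "k \<in> I \<Longrightarrow> k \<noteq> j \<Longrightarrow> 0 < c k"
  using \<beta>_less[of k] by (simp add: c_def)

lemma c_ge: "k \<in> I \<Longrightarrow> k \<noteq> j \<Longrightarrow> \<theta> \<le> c k"
  using \<beta>_less[of k] \<theta>_le[of k] by (simp add: c_def field_simps)

lemma c_j [simp]: "c j = 0"
  by (simp add: c_def \<beta>_j)

lemma M_nonneg: "0 \<le> M"
  using C c_nonneg by (auto simp: M_def intro!: mult_nonneg_nonneg sum_nonneg)

lemma env_pos [simp]: "0 < env x t"
  by (simp add: env_def)

lemma W_ge_1: "1 \<le> W x"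
  using L_pos by (simp add: W_def)

lemma W_pos [simp]: "0 < W x"
  by (simp add: W_def)

lemma W_le: "0 \<le> x \<Longrightarrow> W x \<le> exp L"
  using L_pos \<epsilon> by (simp add: W_def mult_le_cancel_left1)

text \<open>From \<open>x\<close> to \<open>s\<close> the exponent gains
  \<open>(s - x) * (1 - \<theta> * (1 - \<beta> k))\<close>, which is nonnegative by
  \<open>\<theta>_le\<close>. This is what lets the envelope leave the integral over
  \<open>s\<close>.\<close>

lemma env_along_line:
  assumes "k \<in> I" "x \<le> s"
  shows "env s (t + \<beta> k * (s - x)) \<le> env x t"
proof -
  have "0 \<le> (s - x) * (1 - \<theta> * (1 - \<beta> k))"
    using \<theta>_le[of k] assms by (intro mult_nonneg_nonneg) auto
  also have "\<dots> = (s + \<theta> * (t + \<beta> k * (s - x) - s)) - (x + \<theta> * (t - x))"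
    by (simp add: algebra_simps)
  finally show ?thesis
    using \<epsilon> by (simp add: env_def)
qed

lemma has_integral_W:
  "has_bochner_integral lborel (\<lambda>s. indicator {x..} s * (exp (- \<epsilon> * s) * W s)) ((W x - 1) / (L * \<epsilon>))"
  unfolding W_def by (rule has_bochner_integral_exp_exp_neg[OF \<epsilon> L_pos])

lemma adm_measurable: "adm f B \<Longrightarrow> f k \<in> borel_measurable borel"
  by (simp add: adm_def)

lemma adm_zero: "adm f B \<Longrightarrow> \<not> (0 \<le> x \<and> x \<le> t) \<Longrightarrow> f k (x, t) = 0"
  by (simp add: adm_def)

lemma adm_bound: "adm f B \<Longrightarrow> k \<in> I \<Longrightarrow> 0 \<le> x \<Longrightarrow> x \<le> t \<Longrightarrow> norm (f k (x, t)) \<le> B * (env x t * W x)"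
  by (simp add: adm_def)

lemma adm_nonneg: "adm f B \<Longrightarrow> 0 \<le> B"
  by (simp add: adm_def)

lemma adm_diff:
  assumes "adm f A" "adm g B"
  shows "adm (\<lambda>k z. f k z - g k z) (A + B)"
  unfolding adm_def
proof (intro conjI allI ballI impI)
  show "(\<lambda>z. f k z - g k z) \<in> borel_measurable borel" for k
    using assms by (intro borel_measurable_diff adm_measurable)
  show "f k (x, t) - g k (x, t) = 0" if "\<not> (0 \<le> x \<and> x \<le> t)" for k x t
    using adm_zero[OF assms(1) that] adm_zero[OF assms(2) that] by simp
  show "norm (f k (x, t) - g k (x, t)) \<le> (A + B) * (env x t * W x)"
    if "k \<in> I" "0 \<le> x" "x \<le> t" for k x t
    using adm_bound[OF assms(1) that] adm_bound[OF assms(2) that]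
      norm_triangle_ineq4[of "f k (x, t)" "g k (x, t)"] by (simp add: distrib_right)
qed (use assms adm_nonneg in auto)

text \<open>Once the envelope is frozen at \<open>(x, t)\<close>, only
  \<open>exp (- \<epsilon> * s) * W s\<close> still depends on \<open>s\<close>. Where the
  characteristic has passed below the diagonal, \<open>f\<close> vanishes and the bound is
  trivial.\<close>

lemma J_bound:
  assumes "adm f B" "k \<in> I" "0 \<le> x"
  shows "norm (J f k x t s) \<le> C * card I * B * env x t * (indicator {x..} s * (exp (- \<epsilon> * s) * W s))"
proof (cases "x \<le> s")
  case True
  have *: "norm (p k l s * f l (s, t + \<beta> k * (s - x))) \<le> C * exp (- \<epsilon> * s) * (B * (env x t * W s))"
    if "l \<in> I" for l
  proof (cases "s \<le> t + \<beta> k * (s - x)")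
    case s: True
    have "norm (f l (s, t + \<beta> k * (s - x))) \<le> B * (env s (t + \<beta> k * (s - x)) * W s)"
      using assms True s that by (intro adm_bound) auto
    also have "\<dots> \<le> B * (env x t * W s)"
      using env_along_line[OF assms(2) True] adm_nonneg[OF assms(1)]
      by (intro mult_left_mono mult_right_mono) (auto simp: less_imp_le)
    finally show ?thesis
      unfolding norm_mult using C by (intro mult_mono p_bound) auto
  next
    case False
    then show ?thesis
      using adm_zero[OF assms(1), of s "t + \<beta> k * (s - x)"] C adm_nonneg[OF assms(1)]
      by (simp add: less_imp_le)
  qed
  have "norm (\<Sum>l\<in>I. p k l s * f l (s, t + \<beta> k * (s - x))) \<le> (\<Sum>l\<in>I. C * exp (- \<epsilon> * s) * (B * (env x t * W s)))"
    by (rule sum_norm_le) (rule *)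
  then show ?thesis
    using True by (simp add: J_def mult_ac)
qed (simp add: J_def)

lemma J_measurable:
  assumes "\<And>k. f k \<in> borel_measurable borel"
  shows "(\<lambda>(z, s). J f k (fst z) (snd z) s) \<in> borel_measurable (borel \<Otimes>\<^sub>M lborel)"
proof -
  note assms [measurable]
  \<comment> \<open>The half-line \<open>{x..}\<close> moves with \<open>x\<close>, so its indicator
    is written as a condition on both variables, which is jointly measurable.\<close>
  have "(\<lambda>(z, s). of_bool (fst z \<le> s) *\<^sub>R (\<Sum>l\<in>I. p k l s * f l (s, snd z + \<beta> k * (s - fst z))))
      \<in> borel_measurable (borel \<Otimes>\<^sub>M lborel)"
    unfolding borel_prod[symmetric] by measurable
  then show ?thesis
    by (simp add: J_def indicator_def)
qed

lemma J_integrable: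
  assumes "adm f B" "k \<in> I" "0 \<le> x"
  shows "integrable lborel (J f k x t)"
proof (rule Bochner_Integration.integrable_bound)
  show "integrable lborel (\<lambda>s. C * card I * B * env x t * (indicator {x..} s * (exp (- \<epsilon> * s) * W s)))"
    using has_integral_W by (intro integrable_mult_right) (auto simp: has_bochner_integral_iff)
  have "(\<lambda>s. (\<lambda>(z, s). J f k (fst z) (snd z) s) ((x, t), s)) \<in> borel_measurable lborel"
    by (rule measurable_compose[OF _ J_measurable]) (use adm_measurable[OF assms(1)] in auto)
  then show "J f k x t \<in> borel_measurable lborel"
    by simp
  show "AE s in lborel. norm (J f k x t s)
      \<le> norm (C * card I * B * env x t * (indicator {x..} s * (exp (- \<epsilon> * s) * W s)))"
    using J_bound[OF assms] by (intro AE_I2) (metis abs_ge_self order_trans real_norm_def)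
qed

text \<open>The contraction estimate: \<open>L\<close> turns the constant of the weighted integral
  into 1/2, and \<open>W x - 1\<close> is at most \<open>W x\<close>.\<close>

lemma T_bound:
  assumes "adm f B" "k \<in> I" "0 \<le> x"
  shows "norm (T f k x t) \<le> B / 2 * (env x t * W x)"
proof -
  have "norm (T f k x t) \<le> (\<integral>s. C * card I * B * env x t * (indicator {x..} s * (exp (- \<epsilon> * s) * W s)) \<partial>lborel)"
    unfolding T_def norm_mult norm_ii mult_1
    using has_integral_W J_integrable[OF assms] J_bound[OF assms]
    by (intro Bochner_Integration.integral_norm_bound_integral integrable_mult_right) (auto simp: has_bochner_integral_iff)
  also have "\<dots> = C * card I * B * env x t * ((W x - 1) / (L * \<epsilon>))"
    using has_integral_W[of x] by (simp add: has_bochner_integral_iff)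
  also have "\<dots> = B / 2 * (env x t * (W x - 1))"
    using C \<epsilon> card_I by (simp add: L_def field_simps)
  also have "\<dots> \<le> B / 2 * (env x t * W x)"
    using adm_nonneg[OF assms(1)] by (intro mult_left_mono) (auto simp: less_imp_le)
  finally show ?thesis .
qed

lemma T_diff:
  assumes "adm f A" "adm g B" "k \<in> I" "0 \<le> x"
  shows "T f k x t - T g k x t = T (\<lambda>k z. f k z - g k z) k x t"
proof -
  have "J (\<lambda>k z. f k z - g k z) k x t s = J f k x t s - J g k x t s" for s
    by (simp add: J_def sum_subtractf algebra_simps)
  then show ?thesis
    using J_integrable assms by (simp add: T_def right_diff_distrib)
qed

lemma T_measurable:
  assumes "\<And>k. f k \<in> borel_measurable borel"
  shows "(\<lambda>z. T f k (fst z) (snd z)) \<in> borel_measurable borel"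
  unfolding T_def using lborel.borel_measurable_lebesgue_integral[OF J_measurable[OF assms]]
  by simp

text \<open>As \<open>c k\<close> is at least \<theta>, the argument of \<open>f\<close> lies beyond
  x + \<theta>(t - x), so the decay of \<open>f\<close> there is at least that of the
  envelope.\<close>

lemma G_bound:
  assumes f: "\<And>x. norm (f k j x) \<le> C * exp (- \<epsilon> * x)" and "k \<in> I" "x \<le> t"
  shows "norm (G f k x t) \<le> M * env x t"
proof (cases "k = j")
  case True
  then show ?thesis
    using M_nonneg by (simp add: G_def less_imp_le)
next
  case False
  have "norm (G f k x t) = c k * norm (f k j (x + c k * (t - x)))"
    using c_nonneg[OF assms(2)] by (simp add: G_def norm_mult)
  also have "\<dots> \<le> c k * (C * exp (- \<epsilon> * (x + c k * (t - x))))"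
    using c_nonneg[OF assms(2)] f by (intro mult_left_mono) auto
  also have "\<dots> \<le> (\<Sum>k\<in>I. c k) * (C * env x t)"
  proof (intro mult_mono)
    show "c k \<le> (\<Sum>k\<in>I. c k)"
      using c_nonneg fin assms(2) by (intro member_le_sum) auto
    have "\<theta> * (t - x) \<le> c k * (t - x)"
      using c_ge[OF assms(2) False] assms(3) by (intro mult_right_mono) auto
    then show "exp (- \<epsilon> * (x + c k * (t - x))) \<le> env x t"
      using \<epsilon> by (simp add: env_def)
  qed (use C c_nonneg in \<open>auto intro!: sum_nonneg\<close>)
  also have "\<dots> = M * env x t"
    by (simp add: M_def)
  finally show ?thesis .
qed

lemma G_measurable: "(\<lambda>z. G p k (fst z) (snd z)) \<in> borel_measurable borel"
  unfolding G_def borel_prod[symmetric] by measurable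

text \<open>The radius \<open>2 * M\<close> is the fixed point of the map from \<open>B\<close> to
  \<open>M + B / 2\<close>, where \<open>M\<close> comes from the non-integral term and
  \<open>B / 2\<close> from the contraction.\<close>

lemma adm_picard:
  assumes "adm f (2 * M)"
  shows "adm (picard f) (2 * M)"
  unfolding adm_def
proof (intro conjI allI ballI impI)
  note [measurable] = G_measurable T_measurable[OF adm_measurable[OF assms]]
  have [measurable]: "Measurable.pred borel (\<lambda>z :: real \<times> real. 0 \<le> fst z \<and> fst z \<le> snd z)"
    unfolding borel_prod[symmetric] by measurable
  show "picard f k \<in> borel_measurable borel" for k
    unfolding picard_def by measurable
  show "norm (picard f k (x, t)) \<le> 2 * M * (env x t * W x)" if "k \<in> I" "0 \<le> x" "x \<le> t" for k x t
  proof -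
    have "norm (picard f k (x, t)) \<le> M * env x t + M * (env x t * W x)"
      using G_bound[of p k x t] p_bound T_bound[OF assms that(1,2), of t] that
      by (auto simp: picard_def intro!: norm_triangle_le)
    also have "M * env x t \<le> M * (env x t * W x)"
      using W_ge_1[of x] M_nonneg mult_left_mono[of 1 "W x" "env x t"]
      by (intro mult_left_mono) (auto simp: less_imp_le)
    finally show ?thesis
      by (simp add: mult_ac)
  qed
qed (use M_nonneg in \<open>auto simp: picard_def\<close>)

section \<open>Convergence of the Picard iterates\<close>

lemma S_Suc: "S (Suc m) = picard (S m)"
  by (simp add: S_def)

lemma S_0: "S 0 = (\<lambda>_ _. 0)"
  by (simp add: S_def)

lemma adm_S: "adm (S m) (2 * M)"
proof (induction m)
  case 0
  show ?case
    using M_nonneg by (auto simp: S_0 adm_def less_imp_le)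
next
  case (Suc m)
  then show ?case
    unfolding S_Suc by (rule adm_picard)
qed

text \<open>The non-integral term cancels between consecutive iterates. What is left is
  \<open>T\<close> applied to the preceding difference, so every step halves the radius.\<close>

lemma adm_S_diff: "adm (\<lambda>k z. S (Suc m) k z - S m k z) (2 * M * (1 / 2) ^ m)"
proof (induction m)
  case 0
  show ?case
    using adm_S[of 1] by (simp add: S_0)
next
  case (Suc m)
  let ?D = "\<lambda>k z. S (Suc m) k z - S m k z"
  have *: "norm (S (Suc (Suc m)) k (x, t) - S (Suc m) k (x, t)) \<le> 2 * M * (1 / 2) ^ Suc m * (env x t * W x)"
    if "k \<in> I" "0 \<le> x" "x \<le> t" for k x t
  proof -
    have "S (Suc (Suc m)) k (x, t) - S (Suc m) k (x, t) = T (S (Suc m)) k x t - T (S m) k x t"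
      using that by (simp only: S_Suc[of "Suc m"] S_Suc[of m]) (simp add: picard_def)
    also have "\<dots> = T ?D k x t"
      using that by (intro T_diff[OF adm_S adm_S])
    finally show ?thesis
      using T_bound[OF Suc that(1,2), of t] by simp
  qed
  show ?case
    unfolding adm_def
  proof (intro conjI allI ballI impI *)
    show "0 \<le> 2 * M * (1 / 2) ^ Suc m"
      using M_nonneg by simp
  qed (use adm_diff[OF adm_S[of "Suc (Suc m)"] adm_S[of "Suc m"]] in \<open>auto simp: adm_def\<close>)
qed

text \<open>At each point the iterates are the partial sums of a telescoping series with a geometric
  majorant.\<close>

lemma S_tendsto:
  assumes "k \<in> I"
  shows "(\<lambda>m. S m k z) \<longlonglongrightarrow> H k z"
proof -
  obtain x t where z: "z = (x, t)"
    by fastforce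
  have "summable (\<lambda>m. S (Suc m) k z - S m k z)"
  proof (rule summable_comparison_test')
    show "summable (\<lambda>m. 2 * M * (env x t * W x) * (1 / 2) ^ m)"
      by (intro summable_mult summable_geometric) auto
    show "norm (S (Suc m) k z - S m k z) \<le> 2 * M * (env x t * W x) * (1 / 2) ^ m" if "m \<ge> 0" for m
    proof (cases "0 \<le> x \<and> x \<le> t")
      case True
      then show ?thesis
        using adm_bound[OF adm_S_diff, of k x t m] assms by (simp add: z mult_ac)
    next
      case False
      then show ?thesis
        using adm_zero[OF adm_S_diff False, of m k] M_nonneg by (simp add: z less_imp_le)
    qed
  qed
  then have "(\<lambda>n. \<Sum>m<n. S (Suc m) k z - S m k z) \<longlonglongrightarrow> (\<Sum>m. S (Suc m) k z - S m k z)"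
    by (rule summable_LIMSEQ)
  then have "(\<lambda>m. S m k z) \<longlonglongrightarrow> (\<Sum>m. S (Suc m) k z - S m k z)"
    using sum_lessThan_telescope[of "\<lambda>m. S m k z"] by (simp add: S_0)
  then show ?thesis
    unfolding H_def by (metis limI)
qed

lemma adm_H: "adm H (2 * M)"
  unfolding adm_def
proof (intro conjI allI ballI impI)
  note [measurable] = adm_measurable[OF adm_S]
  show "H k \<in> borel_measurable borel" for k
    unfolding H_def by measurable
  show "H k (x, t) = 0" if "\<not> (0 \<le> x \<and> x \<le> t)" for k x t
    using adm_zero[OF adm_S that] by (simp add: H_def)
  show "norm (H k (x, t)) \<le> 2 * M * (env x t * W x)" if "k \<in> I" "0 \<le> x" "x \<le> t" for k x t
    using tendsto_norm[OF S_tendsto[OF that(1)]]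
    by (rule LIMSEQ_le_const2) (use adm_bound[OF adm_S that] in auto)
qed (use M_nonneg in auto)

text \<open>All iterates lie in one ball of radius \<open>2 * M\<close>, which yields a common
  integrable majorant of the integrands; dominated convergence then carries the recursion to the
  limit.\<close>

lemma H_eq:
  assumes "k \<in> I" "0 \<le> x" "x \<le> t"
  shows "H k (x, t) = G p k x t + T H k x t"
proof -
  have "(\<lambda>m. \<integral>s. J (S m) k x t s \<partial>lborel) \<longlonglongrightarrow> (\<integral>s. J H k x t s \<partial>lborel)"
  proof (rule integral_dominated_convergence)
    show "integrable lborel (\<lambda>s. C * card I * (2 * M) * env x t * (indicator {x..} s * (exp (- \<epsilon> * s) * W s)))"
      using has_integral_W by (intro integrable_mult_right) (auto simp: has_bochner_integral_iff)
    show "AE s in lborel. (\<lambda>m. J (S m) k x t s) \<longlonglongrightarrow> J H k x t s"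
      unfolding J_def by (intro AE_I2 tendsto_intros S_tendsto)
    show "AE s in lborel. norm (J (S m) k x t s)
        \<le> C * card I * (2 * M) * env x t * (indicator {x..} s * (exp (- \<epsilon> * s) * W s))" for m
      using J_bound[OF adm_S assms(1,2)] by (intro AE_I2)
  qed (use J_integrable[OF adm_S assms(1,2)] J_integrable[OF adm_H assms(1,2)] in auto)
  then have "(\<lambda>m. G p k x t + T (S m) k x t) \<longlonglongrightarrow> G p k x t + T H k x t"
    unfolding T_def by (intro tendsto_intros)
  moreover have "(\<lambda>m. S (Suc m) k (x, t)) \<longlonglongrightarrow> H k (x, t)"
    using S_tendsto[OF assms(1)] by (rule LIMSEQ_Suc)
  ultimately show ?thesis
    using assms by (simp add: S_Suc picard_def) (metis LIMSEQ_unique)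
qed

end

section \<open>Transforms of the kernels\<close>

text \<open>The exceptional set need not be Borel, so it is first enclosed in a Borel null set, to
  which the affine invariance of \<open>lborel\<close> applies.\<close>

lemma AE_lebesgue_affine:
  fixes P :: "real \<Rightarrow> bool"
  assumes "c \<noteq> 0" "AE x in lebesgue. P x"
  shows "AE x in lebesgue. P (t + c * x)"
proof -
  have "AE x in lborel. P x"
    using assms(2) by (simp add: AE_completion_iff)
  then obtain N where N: "{x \<in> space lborel. \<not> P x} \<subseteq> N" "emeasure lborel N = 0" "N \<in> sets lborel"
    by (rule AE_E)
  then have [measurable]: "N \<in> sets borel"
    by simp
  have "AE x in lborel. x \<notin> N"
    using N by (intro AE_not_in) auto
  then have "AE x in lborel. t + c * x \<notin> N"
    by (intro AE_borel_affine[OF assms(1)]) measurable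
  then have "AE x in lborel. P (t + c * x)"
    by (rule AE_mp) (use N in auto)
  then show ?thesis
    by (rule AE_completion)
qed

text \<open>Supplies the majorant for Fubini, in which the variables separate.\<close>

lemma integrable_lborel_mult_pair:
  fixes g h :: "real \<Rightarrow> real"
  assumes "integrable lborel g" "integrable lborel h"
  shows "integrable (lborel \<Otimes>\<^sub>M lborel) (\<lambda>(t, s). g t * h s)"
proof (rule lborel_pair.Fubini_integrable)
  have [measurable]: "g \<in> borel_measurable borel" "h \<in> borel_measurable borel"
    using assms by auto
  show "(\<lambda>(t, s). g t * h s) \<in> borel_measurable (lborel \<Otimes>\<^sub>M lborel)"
    by measurable
qed (use assms in \<open>auto simp: abs_mult\<close>)

context kernel_column
begin

text \<open>The diagonal identities recover the given \<open>q\<close> at every point, which a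
  kernel containing only the Borel version \<open>p\<close> cannot do; hence the exchange of
  \<open>G p\<close> for \<open>G q\<close>.\<close>

definition K :: "'i \<Rightarrow> real \<Rightarrow> real \<Rightarrow> complex" where
  "K k x t = (if 0 \<le> x \<and> x \<le> t then H k (x, t) + G q k x t - G p k x t else 0)"

lemma H_measurable [measurable]: "H k \<in> borel_measurable borel"
  by (rule adm_measurable[OF adm_H])

lemma K_zero: "\<not> (0 \<le> x \<and> x \<le> t) \<Longrightarrow> K k x t = 0"
  unfolding K_def by (rule if_not_P)

lemma K_j: "K j x t = H j (x, t)"
  using adm_zero[OF adm_H, of x t j] by (auto simp: K_def G_def)

text \<open>A characteristic that starts on the diagonal leaves the wedge at once, because
  \<open>\<beta> k < 1\<close>. Its integrand is supported in the single point \<open>s = x\<close>,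
  and only the non-integral term remains.\<close>

lemma K_diagonal:
  assumes "k \<in> I" "k \<noteq> j" "0 \<le> x"
  shows "K k x x = G q k x x"
proof -
  have "J H k x x s = 0" if "s \<noteq> x" for s
  proof (cases "x \<le> s")
    case True
    then have "x < s"
      using that by simp
    then have "\<beta> k * (s - x) < 1 * (s - x)"
      using \<beta>_less[OF assms(1,2)] by (intro mult_strict_right_mono) auto
    then show ?thesis
      using adm_zero[OF adm_H] by (simp add: J_def)
  qed (simp add: J_def)
  then have "integral\<^sup>L lborel (J H k x x) = integral\<^sup>L lborel (\<lambda>_ :: real. 0)"
    using AE_lborel_singleton[of x] J_integrable[OF adm_H assms(1,3)]
    by (intro integral_cong_AE) (auto elim!: AE_mp)
  then show ?thesis
    using assms H_eq[OF assms(1,3), of x] by (simp add: K_def T_def)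
qed

text \<open>For fixed \<open>x\<close> the argument of \<open>q\<close> and \<open>p\<close> is
  affine in \<open>t\<close> with slope \<open>c k > 0\<close>, so the null set where they differ
  pulls back to a null set.\<close>

lemma K_eq_H:
  assumes "k \<in> I"
  shows "AE t in lebesgue. K k x t = H k (x, t)"
proof (cases "k = j")
  case False
  then have "AE t in lebesgue. q k j ((x - c k * x) + c k * t) = p k j ((x - c k * x) + c k * t)"
    using c_pos[OF assms] q_eq_p by (intro AE_lebesgue_affine) auto
  then show ?thesis
  proof (rule AE_mp, intro AE_I2 impI)
    fix t
    assume "q k j ((x - c k * x) + c k * t) = p k j ((x - c k * x) + c k * t)"
    moreover have "(x - c k * x) + c k * t = x + c k * (t - x)"
      by (simp add: algebra_simps)
    ultimately show "K k x t = H k (x, t)"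
      using adm_zero[OF adm_H, of x t k] by (auto simp: K_def G_def)
  qed
qed (simp add: K_j)

text \<open>The argument of \<open>q l j\<close> on a characteristic line of row \<open>k\<close> has slope \<open>1 - c l / c k\<close>, which
  vanishes only for \<open>l = k\<close>, where \<open>q k l = 0\<close>.\<close>

lemma K_eq_H_on_line:
  assumes "k \<in> I" "l \<in> I"
  shows "AE s in lebesgue. q k l s * K l s (t + \<beta> k * (s - x)) = p k l s * H l (s, t + \<beta> k * (s - x))"
proof -
  consider "l = k" | "l \<noteq> k" "l = j" | "l \<noteq> k" "l \<noteq> j"
    by blast
  then show ?thesis
  proof cases
    case 1
    then show ?thesis
      by (simp add: q_diag p_diag)
  next
    case 2
    then show ?thesis
      using q_eq_p[of k j] by (auto simp: K_j elim!: AE_mp)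
  next
    case 3
    \<comment> \<open>The intercept and slope of the argument as a function of \<open>s\<close>.
      Written with \<open>1 - \<beta> k\<close> in place of the reciprocal of \<open>c k\<close>,
      the slope is also right for \<open>k = j\<close>, where it is 1.\<close>
    define a b where "a = c l * (t - \<beta> k * x)" and "b = 1 - c l * (1 - \<beta> k)"
    have "\<beta> l \<noteq> \<beta> k" "\<beta> l \<noteq> 1"
      using 3 inj_onD[OF \<beta>_inj _ assms(2,1)] inj_onD[OF \<beta>_inj _ assms(2) j] \<beta>_j by auto
    then have "b \<noteq> 0"
      by (simp add: b_def c_def field_simps)
    have arg: "s + c l * (t + \<beta> k * (s - x) - s) = a + b * s" for s
      by (simp add: a_def b_def algebra_simps)
    have "AE s in lebesgue. q l j (a + b * s) = p l j (a + b * s)"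
      using \<open>b \<noteq> 0\<close> q_eq_p by (rule AE_lebesgue_affine)
    with q_eq_p[of k l] show ?thesis
    proof (rule AE_mp[OF AE_conjI], intro AE_I2 impI)
      fix s
      assume *: "q k l s = p k l s \<and> q l j (a + b * s) = p l j (a + b * s)"
      have "K l s (t + \<beta> k * (s - x)) = H l (s, t + \<beta> k * (s - x))"
        using adm_zero[OF adm_H, of s "t + \<beta> k * (s - x)" l] * by (auto simp: K_def G_def arg)
      then show "q k l s * K l s (t + \<beta> k * (s - x)) = p k l s * H l (s, t + \<beta> k * (s - x))"
        using * by simp
    qed
  qed
qed

text \<open>On every single characteristic the integrands with \<open>p\<close>, \<open>H\<close>
  and with \<open>q\<close>, \<open>K\<close> agree for almost every \<open>s\<close>. The integral
  term is therefore unchanged, and the definition of \<open>K\<close> adjusts the other one; the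
  equation holds at each point of the wedge.\<close>

theorem K_equation:
  assumes "k \<in> I" "0 \<le> x" "x \<le> t"
  defines "F \<equiv> \<lambda>s. \<Sum>l\<in>I. q k l s * K l s (t + \<beta> k * (s - x))"
  shows "set_integrable lebesgue {x..} F" "K k x t = G q k x t + \<i> * (LINT s:{x..}|lebesgue. F s)"
proof -
  have "AE s in lebesgue. \<forall>l\<in>I. q k l s * K l s (t + \<beta> k * (s - x)) = p k l s * H l (s, t + \<beta> k * (s - x))"
    using K_eq_H_on_line[OF assms(1)] by (intro AE_finite_allI fin)
  then have AE: "AE s in lebesgue. J H k x t s = indicator {x..} s *\<^sub>R F s"
    by (rule AE_mp) (auto simp: J_def F_def intro!: sum.cong)
  have J: "integrable lborel (J H k x t)"
    using assms by (intro J_integrable[OF adm_H])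
  then have Jl: "integrable lebesgue (J H k x t)"
    by (simp add: integrable_completion)
  have meas: "(\<lambda>s. indicator {x..} s *\<^sub>R F s) \<in> borel_measurable lebesgue"
    by (rule borel_measurable_AE[OF borel_measurable_integrable[OF Jl] AE])
  show "set_integrable lebesgue {x..} F"
    unfolding set_integrable_def by (rule integrable_cong_AE_imp[OF Jl meas]) (use AE in auto)
  have "(LINT s:{x..}|lebesgue. F s) = integral\<^sup>L lebesgue (J H k x t)"
    unfolding set_lebesgue_integral_def
    using Jl meas AE by (intro integral_cong_AE) auto
  also have "\<dots> = integral\<^sup>L lborel (J H k x t)"
    using J by (intro integral_completion) auto
  finally have "\<i> * (LINT s:{x..}|lebesgue. F s) = T H k x t"
    by (simp add: T_def)
  then show "K k x t = G q k x t + \<i> * (LINT s:{x..}|lebesgue. F s)"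
    using assms H_eq by (simp add: K_def)
qed

lemma H_bound:
  assumes "k \<in> I" "0 \<le> x" "x \<le> t"
  shows "norm (H k (x, t)) \<le> 2 * M * exp L * env x t"
proof -
  have "norm (H k (x, t)) \<le> 2 * M * (env x t * W x)"
    using adm_bound[OF adm_H assms] .
  also have "\<dots> \<le> 2 * M * (env x t * exp L)"
    using W_le[OF assms(2)] M_nonneg by (intro mult_left_mono) (auto simp: less_imp_le)
  finally show ?thesis
    by (simp add: mult_ac)
qed

lemma K_bound:
  assumes "k \<in> I" "0 \<le> x" "x \<le> t"
  shows "norm (K k x t) \<le> (2 * M * exp L + 2 * M) * env x t"
proof -
  have "norm (K k x t) \<le> norm (H k (x, t)) + norm (G q k x t) + norm (G p k x t)"
    using assms norm_triangle_ineq4[of "H k (x, t) + G q k x t" "G p k x t"]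
      norm_triangle_ineq[of "H k (x, t)" "G q k x t"] by (simp add: K_def)
  also have "\<dots> \<le> 2 * M * exp L * env x t + M * env x t + M * env x t"
    using assms by (intro add_mono H_bound G_bound q_bound p_bound)
  finally show ?thesis
    by (simp add: algebra_simps)
qed

lemma has_integral_env:
  "has_bochner_integral lborel (\<lambda>t. indicator {x..} t * env x t) (exp (- \<epsilon> * x) / (\<epsilon> * \<theta>))"
proof -
  have "has_bochner_integral lborel (\<lambda>t. (indicator {x..} t * exp (- (\<epsilon> * \<theta>) * t)) * exp (- (\<epsilon> * (1 - \<theta>)) * x))
      (exp (- (\<epsilon> * \<theta>) * x) / (\<epsilon> * \<theta>) * exp (- (\<epsilon> * (1 - \<theta>)) * x))"
    using \<epsilon> \<theta> by (intro has_bochner_integral_mult_left has_bochner_integral_exp_neg) auto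
  moreover have "exp (- (\<epsilon> * \<theta>) * t) * exp (- (\<epsilon> * (1 - \<theta>)) * x) = env x t" for t
    by (simp add: env_def exp_add[symmetric] algebra_simps)
  moreover have "exp (- (\<epsilon> * \<theta>) * x) * exp (- (\<epsilon> * (1 - \<theta>)) * x) = exp (- \<epsilon> * x)"
    by (simp add: exp_add[symmetric] algebra_simps)
  ultimately show ?thesis
    by (simp add: mult.assoc)
qed

section \<open>The transforms and their Volterra equation\<close>

definition v :: "real \<Rightarrow> 'i \<Rightarrow> real \<Rightarrow> complex" where
  "v \<mu> k x = (\<integral>t. cis (\<mu> * t) * H k (x, t) \<partial>lborel)"

text \<open>The candidate for the solution with coefficient vector the \<open>j\<close>-th unit
  vector, with \<open>\<mu> = lam * \<xi> j\<close> in mind; \<open>v\<close> is its kernel part. It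
  is built on \<open>H\<close> because joint Borel measurability makes it Borel in \<open>x\<close>
  and gives access to Fubini.\<close>

definition u :: "real \<Rightarrow> 'i \<Rightarrow> real \<Rightarrow> complex" where
  "u \<mu> k x = (if k = j then cis (\<mu> * x) else 0) + v \<mu> k x"

lemma cis_measurable [measurable]: "cis \<in> borel_measurable borel"
  by (intro borel_measurable_continuous_onI continuous_on_cis continuous_on_id)

lemma H_cis_bound:
  assumes "k \<in> I" "0 \<le> x"
  shows "norm (cis (\<mu> * t) * H k (x, t)) \<le> 2 * M * exp L * (indicator {x..} t * env x t)"
  using H_bound[OF assms, of t] adm_zero[OF adm_H, of x t k] by (auto simp: norm_mult split: split_indicator)

lemma H_cis_integrable:
  assumes "k \<in> I" "0 \<le> x"
  shows "integrable lborel (\<lambda>t. cis (\<mu> * t) * H k (x, t))"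
proof (rule Bochner_Integration.integrable_bound)
  show "integrable lborel (\<lambda>t. 2 * M * exp L * (indicator {x..} t * env x t))"
    using has_integral_env by (intro integrable_mult_right) (auto simp: has_bochner_integral_iff)
  show "AE t in lborel. norm (cis (\<mu> * t) * H k (x, t)) \<le> norm (2 * M * exp L * (indicator {x..} t * env x t))"
    using H_cis_bound[OF assms] by (intro AE_I2) (metis abs_ge_self order_trans real_norm_def)
qed measurable

lemma v_bound:
  assumes "k \<in> I" "0 \<le> x"
  shows "norm (v \<mu> k x) \<le> 2 * M * exp L / (\<epsilon> * \<theta>)"
proof -
  have "norm (v \<mu> k x) \<le> (\<integral>t. 2 * M * exp L * (indicator {x..} t * env x t) \<partial>lborel)"
    unfolding v_def using has_integral_env H_cis_integrable[OF assms] H_cis_bound[OF assms]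
    by (intro Bochner_Integration.integral_norm_bound_integral integrable_mult_right)
      (auto simp: has_bochner_integral_iff)
  also have "\<dots> = 2 * M * exp L * (exp (- \<epsilon> * x) / (\<epsilon> * \<theta>))"
    using has_integral_env[of x] by (simp add: has_bochner_integral_iff)
  also have "\<dots> \<le> 2 * M * exp L * (1 / (\<epsilon> * \<theta>))"
    using M_nonneg \<epsilon> \<theta> assms by (intro mult_left_mono divide_right_mono) auto
  finally show ?thesis
    by simp
qed

lemma v_measurable [measurable]: "v \<mu> k \<in> borel_measurable borel"
proof -
  have "(\<lambda>(x, t). cis (\<mu> * t) * H k (x, t)) \<in> borel_measurable (borel \<Otimes>\<^sub>M lborel)"
    by measurable
  then show ?thesis
    unfolding v_def by (rule lborel.borel_measurable_lebesgue_integral)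
qed

lemma u_measurable [measurable]: "u \<mu> k \<in> borel_measurable borel"
  unfolding u_def by measurable

lemma u_bound:
  assumes "k \<in> I" "0 \<le> x"
  shows "norm (u \<mu> k x) \<le> 1 + 2 * M * exp L / (\<epsilon> * \<theta>)"
  using v_bound[OF assms, of \<mu>] norm_triangle_ineq[of "cis (\<mu> * x)" "v \<mu> k x"]
  by (cases "k = j") (auto simp: u_def)

text \<open>For fixed \<open>x\<close> the kernels \<open>K\<close> and \<open>H\<close> differ only
  for a null set of \<open>t\<close>, which the transform does not see.\<close>

theorem u_eq_K:
  assumes "k \<in> I" "0 \<le> x"
  shows "set_integrable lebesgue {x..} (\<lambda>t. K k x t * cis (\<mu> * t))"
    and "u \<mu> k x = (if k = j then cis (\<mu> * x) else 0) + (LINT t:{x..}|lebesgue. K k x t * cis (\<mu> * t))"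
proof -
  let ?f = "\<lambda>t. cis (\<mu> * t) * H k (x, t)"
  have AE: "AE t in lebesgue. ?f t = indicator {x..} t *\<^sub>R (K k x t * cis (\<mu> * t))"
    using K_eq_H[OF assms(1), of x]
    by (rule AE_mp) (auto simp: K_zero split: split_indicator)
  have f: "integrable lebesgue ?f"
    using H_cis_integrable[OF assms] by (simp add: integrable_completion)
  have meas: "(\<lambda>t. indicator {x..} t *\<^sub>R (K k x t * cis (\<mu> * t))) \<in> borel_measurable lebesgue"
    by (rule borel_measurable_AE[OF borel_measurable_integrable[OF f] AE])
  show "set_integrable lebesgue {x..} (\<lambda>t. K k x t * cis (\<mu> * t))"
    unfolding set_integrable_def by (rule integrable_cong_AE_imp[OF f meas]) (use AE in auto)
  have "(LINT t:{x..}|lebesgue. K k x t * cis (\<mu> * t)) = integral\<^sup>L lebesgue ?f"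
    unfolding set_lebesgue_integral_def using f meas AE by (intro integral_cong_AE) auto
  also have "\<dots> = v \<mu> k x"
    unfolding v_def using H_cis_integrable[OF assms] by (intro integral_completion) auto
  finally show "u \<mu> k x = (if k = j then cis (\<mu> * x) else 0) + (LINT t:{x..}|lebesgue. K k x t * cis (\<mu> * t))"
    by (simp add: u_def)
qed

text \<open>For \<open>\<mu> = lam * \<xi> j\<close> the factor
  \<open>cis (\<mu> * \<beta> k * (x - s))\<close> has the phase
  \<open>lam * \<xi> k * (x - s)\<close>: it is the variation of constants factor of row
  \<open>k\<close>, free of \<open>j\<close>.\<close>

definition V :: "real \<Rightarrow> 'i \<Rightarrow> real \<Rightarrow> ('i \<Rightarrow> real \<Rightarrow> complex) \<Rightarrow> real \<Rightarrow> complex" where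
  "V \<mu> k x f s = indicator {x..} s *\<^sub>R (cis (\<mu> * \<beta> k * (x - s)) * (\<Sum>l\<in>I. p k l s * f l s))"

lemma V_integrable:
  assumes [measurable]: "\<And>l. f l \<in> borel_measurable borel" and f: "\<And>l s. l \<in> I \<Longrightarrow> 0 \<le> s \<Longrightarrow> norm (f l s) \<le> B"
    and "0 \<le> x"
  shows "integrable lborel (V \<mu> k x f)"
proof (rule Bochner_Integration.integrable_bound)
  show "integrable lborel (\<lambda>s. card I * C * B * (indicator {x..} s * exp (- \<epsilon> * s)))"
    using has_bochner_integral_exp_neg[OF \<epsilon>] by (intro integrable_mult_right) (auto simp: has_bochner_integral_iff)
  show "V \<mu> k x f \<in> borel_measurable lborel"
    unfolding V_def by measurable
  show "AE s in lborel. norm (V \<mu> k x f s) \<le> norm (card I * C * B * (indicator {x..} s * exp (- \<epsilon> * s)))"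
  proof (rule AE_I2)
    fix s
    have "norm (\<Sum>l\<in>I. p k l s * f l s) \<le> (\<Sum>l\<in>I. C * exp (- \<epsilon> * s) * B)" if "0 \<le> s"
      using f that C p_bound by (intro sum_norm_le) (auto simp: norm_mult intro!: mult_mono)
    then have "norm (V \<mu> k x f s) \<le> card I * C * B * (indicator {x..} s * exp (- \<epsilon> * s))"
      using \<open>0 \<le> x\<close> by (auto simp: V_def norm_mult mult_ac split: split_indicator)
    also have "\<dots> \<le> norm (card I * C * B * (indicator {x..} s * exp (- \<epsilon> * s)))"
      by simp
    finally show "norm (V \<mu> k x f s) \<le> norm (card I * C * B * (indicator {x..} s * exp (- \<epsilon> * s)))" .
  qed
qed

text \<open>Substituting \<open>s = x + c k * (t - x)\<close> turns the phase \<mu>t into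
  \<open>\<mu> * \<beta> k * (x - s) + \<mu> * s\<close>. So the transform of the non-integral term
  is the Volterra operator applied to the free exponential in component \<open>j\<close>. For
  \<open>k = j\<close> both sides vanish, the right one by \<open>p_diag\<close>.\<close>

lemma integral_G:
  assumes "k \<in> I" "0 \<le> x"
  shows "(\<integral>t. indicator {x..} t *\<^sub>R (cis (\<mu> * t) * G p k x t) \<partial>lborel)
    = \<i> * (\<integral>s. V \<mu> k x (\<lambda>l s. if l = j then cis (\<mu> * s) else 0) s \<partial>lborel)"
proof (cases "k = j")
  case True
  have "V \<mu> k x (\<lambda>l s. if l = j then cis (\<mu> * s) else 0) s = 0" for s
    using True fin j by (simp add: V_def if_distrib sum.delta p_diag cong: if_cong)
  then show ?thesis
    using True by (simp add: G_def)
next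
  case False
  note ck = c_pos[OF assms(1) False]
  have "(1 - \<beta> k) * c k = 1"
    using \<beta>_less[OF assms(1) False] by (simp add: c_def)
  have V: "V \<mu> k x (\<lambda>l s. if l = j then cis (\<mu> * s) else 0) ((x - c k * x) + c k * t)
      = indicator {x..} t *\<^sub>R (cis (\<mu> * t) * p k j (x + c k * (t - x)))" for t
  proof -
    have s: "(x - c k * x) + c k * t = x + c k * (t - x)"
      by (simp add: algebra_simps)
    have "\<mu> * \<beta> k * (x - (x + c k * (t - x))) + \<mu> * (x + c k * (t - x)) = \<mu> * (x + ((1 - \<beta> k) * c k) * (t - x))"
      by (simp add: algebra_simps)
    also have "\<dots> = \<mu> * t"
      unfolding \<open>(1 - \<beta> k) * c k = 1\<close> by simp
    finally have "cis (\<mu> * \<beta> k * (x - (x + c k * (t - x)))) * cis (\<mu> * (x + c k * (t - x))) = cis (\<mu> * t)"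
      by (simp add: cis_mult)
    moreover have "indicator {x..} (x + c k * (t - x)) = (indicator {x..} t :: real)"
      using ck by (auto simp: zero_le_mult_iff split: split_indicator)
    ultimately show ?thesis
      unfolding s V_def using fin j
      by (simp add: if_distrib sum.delta mult_ac cong: if_cong)
  qed
  have "(\<integral>s. V \<mu> k x (\<lambda>l s. if l = j then cis (\<mu> * s) else 0) s \<partial>lborel)
      = \<bar>c k\<bar> *\<^sub>R (\<integral>t. indicator {x..} t *\<^sub>R (cis (\<mu> * t) * p k j (x + c k * (t - x))) \<partial>lborel)"
    using ck by (subst lborel_integral_real_affine[where c = "c k" and t = "x - c k * x"]) (auto simp: V)
  moreover have "indicator {x..} t *\<^sub>R (cis (\<mu> * t) * G p k x t)
      = (\<i> * c k) * (indicator {x..} t *\<^sub>R (cis (\<mu> * t) * p k j (x + c k * (t - x))))" for t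
    by (simp add: G_def split: split_indicator)
  ultimately show ?thesis
    using ck by (simp only: integral_mult_right_zero) (simp add: scaleR_conv_of_real)
qed

text \<open>Since \<open>\<beta> k \<le> 1\<close>, a characteristic that starts below the diagonal
  stays below it. Hence \<open>t\<close> may range over the whole line in the Fubini
  argument.\<close>

lemma J_H_eq_0:
  assumes "k \<in> I" "t < x"
  shows "J H k x t s = 0"
proof (cases "x \<le> s")
  case True
  have "\<beta> k \<le> 1"
    using \<beta>_less[OF assms(1)] \<beta>_j by (cases "k = j") auto
  then have "\<beta> k * (s - x) \<le> 1 * (s - x)"
    using True by (intro mult_right_mono) auto
  then show ?thesis
    using adm_zero[OF adm_H] assms by (simp add: J_def)
qed (simp add: J_def)

text \<open>For fixed \<open>s\<close> the characteristic merely translates \<open>t\<close> by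
  \<open>\<beta> k * (s - x)\<close>, and the transform turns this translation into the phase factor
  of \<open>V\<close>.\<close>

lemma integral_J:
  assumes "k \<in> I" "0 \<le> x"
  shows "(\<integral>t. cis (\<mu> * t) * J H k x t s \<partial>lborel) = V \<mu> k x (v \<mu>) s"
proof (cases "x \<le> s")
  case True
  let ?d = "\<beta> k * (s - x)"
  have int: "integrable lborel (\<lambda>t. cis (\<mu> * t) * H l (s, t + ?d))"
    and eq: "(\<integral>t. cis (\<mu> * t) * H l (s, t + ?d) \<partial>lborel) = cis (\<mu> * \<beta> k * (x - s)) * v \<mu> l s" if "l \<in> I" for l
  proof -
    have "cis (\<mu> * t) = cis (\<mu> * \<beta> k * (x - s)) * cis (\<mu> * (?d + t))" for t
      by (simp add: cis_mult algebra_simps)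
    then have shift: "cis (\<mu> * t) * H l (s, t + ?d)
        = cis (\<mu> * \<beta> k * (x - s)) * (cis (\<mu> * (?d + t)) * H l (s, ?d + t))" for t
      by (metis add.commute mult.assoc)
    have i: "integrable lborel (\<lambda>t. cis (\<mu> * t) * H l (s, t))"
      using that True assms by (intro H_cis_integrable) auto
    have "integrable lborel (\<lambda>t. cis (\<mu> * (?d + 1 * t)) * H l (s, ?d + 1 * t))"
      by (rule lborel_integrable_real_affine[OF i]) simp
    then have "integrable lborel (\<lambda>t. cis (\<mu> * \<beta> k * (x - s)) * (cis (\<mu> * (?d + t)) * H l (s, ?d + t)))"
      by (intro integrable_mult_right) simp
    then show "integrable lborel (\<lambda>t. cis (\<mu> * t) * H l (s, t + ?d))"
      unfolding shift .
    have "v \<mu> l s = (\<integral>t. cis (\<mu> * (?d + t)) * H l (s, ?d + t) \<partial>lborel)"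
      unfolding v_def by (subst lborel_integral_real_affine[where c = 1 and t = ?d]) auto
    then show "(\<integral>t. cis (\<mu> * t) * H l (s, t + ?d) \<partial>lborel) = cis (\<mu> * \<beta> k * (x - s)) * v \<mu> l s"
      unfolding shift by simp
  qed
  have "(\<integral>t. cis (\<mu> * t) * J H k x t s \<partial>lborel)
      = (\<integral>t. (\<Sum>l\<in>I. p k l s * (cis (\<mu> * t) * H l (s, t + ?d))) \<partial>lborel)"
    using True by (simp add: J_def sum_distrib_left mult_ac)
  also have "\<dots> = (\<Sum>l\<in>I. p k l s * (cis (\<mu> * \<beta> k * (x - s)) * v \<mu> l s))"
    using int eq by (subst Bochner_Integration.integral_sum) (auto intro!: sum.cong)
  finally show ?thesis
    using True by (simp add: V_def sum_distrib_left mult_ac)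
qed (simp add: J_def V_def)

text \<open>The majorant of \<open>J_bound\<close> is a product of the envelope, integrable in
  \<open>t\<close> because \<open>\<theta> > 0\<close>, and a function integrable in
  \<open>s\<close>. For \<open>t < x\<close>, where the envelope would grow, the integrand is
  0.\<close>

lemma J_pair_integrable:
  assumes "k \<in> I" "0 \<le> x"
  shows "integrable (lborel \<Otimes>\<^sub>M lborel) (\<lambda>(t, s). cis (\<mu> * t) * J H k x t s)"
proof (rule Bochner_Integration.integrable_bound)
  define g h where "g t = C * card I * (2 * M) * (indicator {x..} t * env x t)"
    and "h s = indicator {x..} s * (exp (- \<epsilon> * s) * W s)" for s t :: real
  show "integrable (lborel \<Otimes>\<^sub>M lborel) (\<lambda>(t, s). g t * h s)"
    unfolding g_def h_def using has_integral_env has_integral_W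
    by (intro integrable_lborel_mult_pair integrable_mult_right) (auto simp: has_bochner_integral_iff)
  show "AE z in lborel \<Otimes>\<^sub>M lborel. norm ((\<lambda>(t, s). cis (\<mu> * t) * J H k x t s) z) \<le> norm ((\<lambda>(t, s). g t * h s) z)"
  proof (rule AE_I2, clarify)
    fix t s
    have "norm (cis (\<mu> * t) * J H k x t s) \<le> g t * h s"
    proof (cases "t < x")
      case True
      then show ?thesis
        using J_H_eq_0[OF assms(1) True] by (simp add: g_def)
    next
      case False
      then show ?thesis
        using J_bound[OF adm_H assms, of t s] by (simp add: g_def h_def norm_mult mult_ac)
    qed
    then show "norm (cis (\<mu> * t) * J H k x t s) \<le> norm (g t * h s)"
      by (metis abs_ge_self order_trans real_norm_def)
  qed
  have "(\<lambda>(t, s). (\<lambda>(z, s). J H k (fst z) (snd z) s) ((x, t), s)) \<in> borel_measurable (lborel \<Otimes>\<^sub>M lborel)"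
    unfolding case_prod_beta
    by (rule measurable_compose[OF _ J_measurable[OF H_measurable, unfolded case_prod_beta]]) simp
  then have [measurable]: "(\<lambda>(t, s). J H k x t s) \<in> borel_measurable (lborel \<Otimes>\<^sub>M lborel)"
    by simp
  show "(\<lambda>(t, s). cis (\<mu> * t) * J H k x t s) \<in> borel_measurable (lborel \<Otimes>\<^sub>M lborel)"
    by measurable
qed

text \<open>The equation of \<open>H\<close> is multiplied by \<open>cis (\<mu> * t)\<close> and
  integrated over \<open>t\<close>. The non-integral term gives the Volterra operator on the free
  part of \<open>u\<close>, the integral term gives it on \<open>v\<close> after Fubini, and by
  linearity the two combine to \<open>u\<close>.\<close>

theorem u_eq:
  assumes "k \<in> I" "0 \<le> x"
  shows "integrable lborel (V \<mu> k x (u \<mu>))"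
    and "u \<mu> k x = (if k = j then cis (\<mu> * x) else 0) + \<i> * (\<integral>s. V \<mu> k x (u \<mu>) s \<partial>lborel)"
proof -
  let ?e = "\<lambda>l s. if l = j then cis (\<mu> * s) else 0"
  show "integrable lborel (V \<mu> k x (u \<mu>))"
    by (rule V_integrable[OF u_measurable u_bound assms(2)])
  have e: "integrable lborel (V \<mu> k x ?e)"
    by (rule V_integrable[OF _ _ assms(2), where B = 1]) (auto split: if_splits)
  have v: "integrable lborel (V \<mu> k x (v \<mu>))"
    by (rule V_integrable[OF v_measurable v_bound assms(2)])
  have J: "integrable lborel (\<lambda>t. \<integral>s. cis (\<mu> * t) * J H k x t s \<partial>lborel)"
    by (rule lborel_pair.integrable_fst[OF J_pair_integrable[OF assms]])
  \<comment> \<open>For \<open>t < x\<close> both sides are 0, so the identity holds on the whole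
    line and can be integrated without a cut-off.\<close>
  have split: "cis (\<mu> * t) * H k (x, t) - \<i> * (\<integral>s. cis (\<mu> * t) * J H k x t s \<partial>lborel)
      = indicator {x..} t *\<^sub>R (cis (\<mu> * t) * G p k x t)" for t
  proof (cases "x \<le> t")
    case True
    then show ?thesis
      using assms H_eq by (simp add: T_def algebra_simps)
  next
    case False
    then show ?thesis
      using assms adm_zero[OF adm_H] J_H_eq_0 by simp
  qed
  have sum_V: "V \<mu> k x ?e s + V \<mu> k x (v \<mu>) s = V \<mu> k x (u \<mu>) s" for s
    unfolding V_def u_def by (simp only: distrib_left sum.distrib scaleR_add_right)
  have "v \<mu> k x - \<i> * (\<integral>t. (\<integral>s. cis (\<mu> * t) * J H k x t s \<partial>lborel) \<partial>lborel)
      = (\<integral>t. cis (\<mu> * t) * H k (x, t) - \<i> * (\<integral>s. cis (\<mu> * t) * J H k x t s \<partial>lborel) \<partial>lborel)"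
    unfolding v_def using J H_cis_integrable[OF assms, of \<mu>] by (simp add: Bochner_Integration.integral_diff)
  also have "\<dots> = \<i> * (\<integral>s. V \<mu> k x ?e s \<partial>lborel)"
    unfolding split by (rule integral_G[OF assms])
  also have "(\<integral>t. (\<integral>s. cis (\<mu> * t) * J H k x t s \<partial>lborel) \<partial>lborel) = (\<integral>s. V \<mu> k x (v \<mu>) s \<partial>lborel)"
    unfolding integral_J[OF assms, symmetric]
    by (rule lborel_pair.Fubini_integral[symmetric]) (use J_pair_integrable[OF assms] in simp)
  finally have "v \<mu> k x = \<i> * (\<integral>s. V \<mu> k x ?e s + V \<mu> k x (v \<mu>) s \<partial>lborel)"
    using e v by (simp add: algebra_simps)
  then show "u \<mu> k x = (if k = j then cis (\<mu> * x) else 0) + \<i> * (\<integral>s. V \<mu> k x (u \<mu>) s \<partial>lborel)"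
    by (subst u_def) (simp add: sum_V)
qed

text \<open>Returns to the given coefficients, so that the equation can be compared with the one
  satisfied by a bounded solution.\<close>

theorem u_eq_q:
  fixes \<mu> :: real
  assumes "k \<in> I" "0 \<le> x"
  defines "F \<equiv> \<lambda>s. cis (\<mu> * \<beta> k * (x - s)) * (\<Sum>l\<in>I. q k l s * u \<mu> l s)"
  shows "set_integrable lebesgue {x..} F"
    and "u \<mu> k x = (if k = j then cis (\<mu> * x) else 0) + \<i> * (LINT s:{x..}|lebesgue. F s)"
proof -
  let ?V = "V \<mu> k x (u \<mu>)"
  have "AE s in lebesgue. \<forall>l\<in>I. q k l s = p k l s"
    using q_eq_p by (intro AE_finite_allI fin)
  then have AE: "AE s in lebesgue. ?V s = indicator {x..} s *\<^sub>R F s"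
    by (rule AE_mp) (auto simp: V_def F_def)
  have V: "integrable lebesgue ?V"
    using u_eq(1)[OF assms(1,2)] by (simp add: integrable_completion)
  have meas: "(\<lambda>s. indicator {x..} s *\<^sub>R F s) \<in> borel_measurable lebesgue"
    by (rule borel_measurable_AE[OF borel_measurable_integrable[OF V] AE])
  show "set_integrable lebesgue {x..} F"
    unfolding set_integrable_def by (rule integrable_cong_AE_imp[OF V meas]) (use AE in auto)
  have "(LINT s:{x..}|lebesgue. F s) = integral\<^sup>L lebesgue ?V"
    unfolding set_lebesgue_integral_def using V meas AE by (intro integral_cong_AE) auto
  also have "\<dots> = integral\<^sup>L lborel ?V"
    using u_eq(1)[OF assms(1,2)] by (intro integral_completion) auto
  finally show "u \<mu> k x = (if k = j then cis (\<mu> * x) else 0) + \<i> * (LINT s:{x..}|lebesgue. F s)"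
    using u_eq(2)[OF assms(1,2), of \<mu>] by simp
qed

end

section \<open>Bounded solutions and Volterra equations\<close>

text \<open>The weight \<open>exp (L * exp (- \<epsilon> * x))\<close> turns the Volterra operator into a contraction.\<close>

lemma volterra_unique:
  fixes w :: "'i \<Rightarrow> real \<Rightarrow> complex"
  assumes I: "finite I" and "C > 0" "\<epsilon> > 0"
    and bound: "\<And>k x. k \<in> I \<Longrightarrow> 0 \<le> x \<Longrightarrow> norm (w k x) \<le> B"
    and w: "\<And>k x. k \<in> I \<Longrightarrow> 0 \<le> x \<Longrightarrow> w k x = (\<integral>s. indicator {x..} s *\<^sub>R f k x s \<partial>lebesgue)"
    and f: "\<And>k x s. k \<in> I \<Longrightarrow> 0 \<le> s \<Longrightarrow> norm (f k x s) \<le> C * exp (- \<epsilon> * s) * (\<Sum>l\<in>I. norm (w l s))"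
    and k: "k \<in> I" and x: "0 \<le> x"
  shows "w k x = 0"
proof -
  define L where "L = 2 * C * card I / \<epsilon>"
  define W where "W x = exp (L * exp (- \<epsilon> * x))" for x
  have card: "card I > 0"
    using I k by (auto simp: card_gt_0_iff)
  have "L > 0"
    using assms card by (simp add: L_def)
  have "0 \<le> B"
    using bound[OF k x] norm_ge_zero order_trans by blast
  have W_int: "has_bochner_integral lebesgue (\<lambda>s. indicator {x..} s * (exp (- \<epsilon> * s) * W s)) ((W x - 1) / (L * \<epsilon>))" for x
  proof -
    have "has_bochner_integral lborel (\<lambda>s. indicator {x..} s * (exp (- \<epsilon> * s) * W s)) ((W x - 1) / (L * \<epsilon>))"
      unfolding W_def by (rule has_bochner_integral_exp_exp_neg) fact+
    moreover have "(\<lambda>s. indicator {x..} s * (exp (- \<epsilon> * s) * W s)) \<in> borel_measurable borel"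
      unfolding W_def by measurable
    ultimately show ?thesis
      by (simp add: has_bochner_integral_iff integrable_completion integral_completion)
  qed
  have *: "norm (w k x) \<le> B * (1 / 2) ^ m * W x" if "k \<in> I" "0 \<le> x" for k x m
    using that
  proof (induction m arbitrary: k x)
    case 0
    have "B * 1 \<le> B * W x"
      using \<open>0 \<le> B\<close> \<open>L > 0\<close> by (intro mult_left_mono) (auto simp: W_def)
    then show ?case
      using bound[OF 0] by simp
  next
    case (Suc m)
    let ?g = "\<lambda>s. C * card I * B * (1 / 2) ^ m * (indicator {x..} s * (exp (- \<epsilon> * s) * W s))"
    have le: "norm (indicator {x..} s *\<^sub>R f k x s) \<le> ?g s" for s
    proof (cases "x \<le> s")
      case True
      have "norm (f k x s) \<le> C * exp (- \<epsilon> * s) * (\<Sum>l\<in>I. norm (w l s))"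
        using f True Suc.prems by simp
      also have "\<dots> \<le> C * exp (- \<epsilon> * s) * (\<Sum>l\<in>I. B * (1 / 2) ^ m * W s)"
        using True Suc \<open>C > 0\<close> by (intro mult_left_mono sum_mono) auto
      finally show ?thesis
        using True by (simp add: mult_ac)
    qed simp
    have "norm (w k x) \<le> (\<integral>s. norm (indicator {x..} s *\<^sub>R f k x s) \<partial>lebesgue)"
      unfolding w[OF Suc.prems] by (rule integral_norm_bound)
    \<comment> \<open>It is the majorant whose integrability is checked; a non-integrable left-hand
      integrand would have integral 0.\<close>
    also have "\<dots> \<le> (\<integral>s. ?g s \<partial>lebesgue)"
    proof (rule integral_mono')
      show "integrable lebesgue ?g"
        using W_int by (intro integrable_mult_right) (auto simp: has_bochner_integral_iff)
      show "0 \<le> ?g s" for s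
        using order_trans[OF norm_ge_zero le] .
    qed (rule le)
    also have "\<dots> = C * card I * B * (1 / 2) ^ m * ((W x - 1) / (L * \<epsilon>))"
      using W_int[of x] by (simp add: has_bochner_integral_iff)
    also have "\<dots> = B * (1 / 2) ^ Suc m * (W x - 1)"
      using \<open>C > 0\<close> \<open>\<epsilon> > 0\<close> card by (simp add: L_def field_simps)
    also have "\<dots> \<le> B * (1 / 2) ^ Suc m * W x"
      using \<open>0 \<le> B\<close> by (intro mult_left_mono) auto
    finally show ?case .
  qed
  have "(\<lambda>m. B * (1 / 2) ^ m * W x) \<longlonglongrightarrow> B * 0 * W x"
    by (intro tendsto_intros LIMSEQ_power_zero) auto
  then have "norm (w k x) \<le> B * 0 * W x"
    by (rule LIMSEQ_le_const) (use *[OF k x] in auto)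
  then show ?thesis
    by simp
qed

section \<open>From the differential system to its integral form\<close>

lemma cis_lipschitz: "norm (cis x - cis y) \<le> 1 * \<bar>x - y\<bar>"
proof -
  have "norm (cis x - cis y) \<le> 1 * norm (x - y)"
  proof (rule differentiable_bound[where S = UNIV])
    show "(cis has_derivative (\<lambda>h. h *\<^sub>R (\<i> * cis z))) (at z within UNIV)" for z
      unfolding cis_conv_exp has_vector_derivative_def[symmetric]
      by (auto intro!: derivative_eq_intros has_vector_derivative_real_field)
    show "onorm (\<lambda>h. h *\<^sub>R (\<i> * cis z)) \<le> 1" for z
      by (rule onorm_le) (simp add: norm_mult)
  qed auto
  then show ?thesis
    by simp
qed

lemma absolutely_continuous_on_interval_subset:
  assumes "absolutely_continuous_on_interval a b f" "a \<le> c" "d \<le> b"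
  shows "absolutely_continuous_on_interval c d f"
  unfolding absolutely_continuous_on_interval_def
proof (intro allI impI)
  fix e :: real
  assume "e > 0"
  obtain r where "r > 0"
    and r: "\<And>(P :: nat set) u v. \<lbrakk>finite P; \<And>i. i \<in> P \<Longrightarrow> a \<le> u i \<and> u i \<le> v i \<and> v i \<le> b;
        disjoint_family_on (\<lambda>i. {u i<..<v i}) P; (\<Sum>i\<in>P. v i - u i) < r\<rbrakk>
      \<Longrightarrow> (\<Sum>i\<in>P. norm (f (v i) - f (u i))) < e"
    by (rule absolutely_continuous_on_intervalD[OF assms(1) \<open>e > 0\<close>, where 'i = nat]) blast
  show "\<exists>r>0. \<forall>(m::nat) u v. (\<forall>i<m. c \<le> u i \<and> u i \<le> v i \<and> v i \<le> d) \<and>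
      disjoint_family_on (\<lambda>i. {u i<..<v i}) {..<m} \<and> (\<Sum>i<m. v i - u i) < r \<longrightarrow>
      (\<Sum>i<m. norm (f (v i) - f (u i))) < e"
  proof (intro exI[of _ r] conjI allI impI \<open>r > 0\<close>)
    fix m :: nat and u v
    assume A: "(\<forall>i<m. c \<le> u i \<and> u i \<le> v i \<and> v i \<le> d) \<and>
      disjoint_family_on (\<lambda>i. {u i<..<v i}) {..<m} \<and> (\<Sum>i<m. v i - u i) < r"
    show "(\<Sum>i<m. norm (f (v i) - f (u i))) < e"
    proof (rule r)
      show "a \<le> u i \<and> u i \<le> v i \<and> v i \<le> b" if "i \<in> {..<m}" for i
        using A that assms(2,3) by fastforce
    qed (use A in auto)
  qed
qed

text \<open>Continuity is local: near \<open>x\<close> the interval \<open>{0..x + 1}\<close> and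
  the half-line define the same limits.\<close>

lemma absolutely_continuous_imp_continuous_on_atLeast:
  assumes "\<And>b. b \<ge> 0 \<Longrightarrow> absolutely_continuous_on_interval 0 b f"
  shows "continuous_on {0..} f"
  unfolding continuous_on_eq_continuous_within
proof
  fix x :: real
  assume "x \<in> {0..}"
  then have "continuous_on {0..x + 1} f"
    using assms by (intro absolutely_continuous_on_interval_imp_continuous_on) auto
  then have "continuous (at x within {0..x + 1}) f"
    using \<open>x \<in> {0..}\<close> by (simp add: continuous_on_eq_continuous_within)
  moreover have "at x within {0..x + 1} = at x within {0..}"
    by (rule at_within_nhd[where S = "{..<x + 1}"]) auto
  ultimately show "continuous (at x within {0..}) f"
    by simp
qed

text \<open>Variation of constants from infinity. The product of the integrating factor and
  \<open>y\<close> is absolutely continuous with derivative \<open>h\<close> almost everywhere; it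
  is integrated over \<open>{x..b}\<close>, and the prescribed asymptotics evaluate the boundary
  term as \<open>b\<close> tends to infinity.\<close>

lemma solution_volterra:
  fixes Q :: "real \<Rightarrow> cmat" and y :: "real \<Rightarrow> cvec" and a :: cvec and lam \<epsilon> C :: real
  assumes sol: "is_solution m \<xi> Q lam y" and "C > 0" "\<epsilon> > 0"
    and Q_meas: "\<And>k l. k \<in> {1..m} \<Longrightarrow> l \<in> {1..m} \<Longrightarrow> (\<lambda>x. Q x k l) \<in> borel_measurable (lebesgue_on {0..})"
    and Q_bound: "\<And>k l x. k \<in> {1..m} \<Longrightarrow> l \<in> {1..m} \<Longrightarrow> 0 \<le> x \<Longrightarrow> norm (Q x k l) \<le> C * exp (- \<epsilon> * x)"
    and y_bound: "\<And>k x. k \<in> {1..m} \<Longrightarrow> 0 \<le> x \<Longrightarrow> norm (y x k) \<le> B"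
    and lim: "\<And>k. k \<in> {1..m} \<Longrightarrow> ((\<lambda>x. y x k - cis (lam * \<xi> k * x) * a k) \<longlongrightarrow> 0) at_top"
    and k: "k \<in> {1..m}" and x: "0 \<le> x"
  defines "F \<equiv> \<lambda>s. cis (lam * \<xi> k * (x - s)) * mat_vec m (Q s) (y s) k"
  shows "set_integrable lebesgue {x..} F"
    and "y x k = cis (lam * \<xi> k * x) * a k + \<i> * (LINT s:{x..}|lebesgue. F s)"
proof -
  have ac: "absolutely_continuous_on_interval 0 b (\<lambda>x. y x l)" if "l \<in> {1..m}" "0 \<le> b" for l b
    using sol that by (simp add: is_solution_def)
  have y_meas: "(\<lambda>x. y x l) \<in> borel_measurable (lebesgue_on {0..})" if "l \<in> {1..m}" for l
    using absolutely_continuous_imp_continuous_on_atLeast[OF ac[OF that]]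
    by (intro continuous_imp_measurable_on_sets_lebesgue) auto
  define Qy where "Qy s = mat_vec m (Q s) (y s) k" for s
  have Qy_meas: "Qy \<in> borel_measurable (lebesgue_on {0..})"
    unfolding Qy_def mat_vec_def using Q_meas y_meas k by (intro borel_measurable_sum borel_measurable_times) auto
  have "0 \<le> B"
    using y_bound[OF k x] norm_ge_zero order_trans by blast
  have Qy_bound: "norm (Qy s) \<le> m * C * B * exp (- \<epsilon> * s)" if "0 \<le> s" for s
  proof -
    have "norm (Qy s) \<le> (\<Sum>l = 1..m. C * exp (- \<epsilon> * s) * B)"
      unfolding Qy_def mat_vec_def norm_mult using that k \<open>C > 0\<close>
      by (intro sum_norm_le) (auto simp: norm_mult intro!: mult_mono Q_bound[simplified] y_bound)
    then show ?thesis
      by (simp add: mult_ac)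
  qed
  \<comment> \<open>Used twice, for the phase factor of \<open>F\<close> and for the integrating
    factor of \<open>h\<close>; both are bounded by 1.\<close>
  have int: "set_integrable lebesgue {x..} (\<lambda>s. g s * Qy s)"
    if "g \<in> borel_measurable borel" "\<And>s. norm (g s) \<le> 1" for g :: "real \<Rightarrow> complex"
    unfolding set_integrable_def
  proof (rule Bochner_Integration.integrable_bound)
    have "integrable lborel (\<lambda>s. m * C * B * (indicator {x..} s * exp (- \<epsilon> * s)))"
      using has_bochner_integral_exp_neg[OF \<open>\<epsilon> > 0\<close>]
      by (intro integrable_mult_right) (auto simp: has_bochner_integral_iff)
    then show "integrable lebesgue (\<lambda>s. m * C * B * (indicator {x..} s * exp (- \<epsilon> * s)))"
      by (simp add: integrable_completion)
    have "g \<in> borel_measurable lborel"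
      using that(1) by simp
    then have "g \<in> borel_measurable (lebesgue_on {0..})"
      by (intro measurable_restrict_space1 measurable_completion)
    then have "(\<lambda>s. g s * Qy s) \<in> borel_measurable (lebesgue_on {0..})"
      using Qy_meas by (intro borel_measurable_times)
    then have "(\<lambda>s. g s * Qy s) \<in> borel_measurable (lebesgue_on {x..})"
      by (rule measurable_restrict_mono) (use x in auto)
    then show "(\<lambda>s. indicator {x..} s *\<^sub>R (g s * Qy s)) \<in> borel_measurable lebesgue"
      by (subst (asm) borel_measurable_restrict_space_iff) auto
    show "AE s in lebesgue. norm (indicator {x..} s *\<^sub>R (g s * Qy s))
        \<le> norm (m * C * B * (indicator {x..} s * exp (- \<epsilon> * s)))"
    proof (intro AE_I2)
      fix s
      have "norm (g s * Qy s) \<le> 1 * (m * C * B * exp (- \<epsilon> * s))" if "x \<le> s"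
        unfolding norm_mult using that x \<open>\<And>s. norm (g s) \<le> 1\<close> by (intro mult_mono Qy_bound) auto
      then have "norm (indicator {x..} s *\<^sub>R (g s * Qy s)) \<le> m * C * B * (indicator {x..} s * exp (- \<epsilon> * s))"
        by (auto split: split_indicator)
      then show "norm (indicator {x..} s *\<^sub>R (g s * Qy s)) \<le> norm (m * C * B * (indicator {x..} s * exp (- \<epsilon> * s)))"
        by (metis abs_ge_self order_trans real_norm_def)
    qed
  qed
  show F_int: "set_integrable lebesgue {x..} F"
    unfolding F_def Qy_def[symmetric] by (rule int) (auto intro!: borel_measurable_continuous_onI continuous_intros)
  define e where "e s = cis (- (lam * \<xi> k) * s)" for s
  define h where "h s = (- \<i> * e s) * Qy s" for s
  have h_int: "set_integrable lebesgue {x..} h"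
    unfolding h_def
    by (rule int) (auto simp: e_def norm_mult intro!: borel_measurable_continuous_onI continuous_intros)
  define P where "P s \<longleftrightarrow> (\<exists>dy :: cvec. \<forall>k\<in>{1..m}.
           ((\<lambda>x. y x k) has_vector_derivative dy k) (at s within {0..}) \<and>
           - \<i> * dy k + mat_vec m (Q s) (y s) k = complex_of_real (lam * \<xi> k) * y s k)" for s
  have "AE s in lebesgue. 0 \<le> s \<longrightarrow> P s"
    using sol unfolding is_solution_def P_def by blast
  then obtain N where N: "N \<in> null_sets lebesgue" and "{s \<in> space lebesgue. \<not> (0 \<le> s \<longrightarrow> P s)} \<subseteq> N"
    unfolding eventually_ae_filter by blast
  then have dy: "P s" if "s \<notin> N" "0 \<le> s" for s
    using that by auto
  have FTC: "(h has_integral e b * y b k - e x * y x k) {x..b}" if "x \<le> b" for b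
  proof (rule has_integral_absolutely_continuous_on_interval[OF that _ N])
    have "absolutely_continuous_on_interval 0 b (\<lambda>s. e s * y s k)"
    proof (rule absolutely_continuous_on_interval_lipschitz_mult)
      show "absolutely_continuous_on_interval 0 b (\<lambda>s. y s k)"
        using that x k by (intro ac) auto
      show "norm (e s - e t) \<le> \<bar>lam * \<xi> k\<bar> * \<bar>s - t\<bar>" for s t
        using cis_lipschitz[of "- (lam * \<xi> k) * s" "- (lam * \<xi> k) * t"]
        by (simp add: e_def abs_mult[symmetric] right_diff_distrib abs_minus_commute)
    qed (simp add: e_def)
    then show "absolutely_continuous_on_interval x b (\<lambda>s. e s * y s k)"
      by (rule absolutely_continuous_on_interval_subset) (use x in auto)
    fix s
    assume s: "s \<in> {x..b} - N"
    then obtain d :: cvec where "((\<lambda>x. y x k) has_vector_derivative d k) (at s within {0..})"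
      and d: "- \<i> * d k + Qy s = complex_of_real (lam * \<xi> k) * y s k"
      using dy[of s] x k unfolding P_def Qy_def by force
    then have 1: "((\<lambda>x. y x k) has_vector_derivative d k) (at s within {x..b})"
      using x by (auto intro: has_vector_derivative_within_subset)
    have 2: "(e has_vector_derivative - (\<i> * (lam * \<xi> k)) * e s) (at s within {x..b})"
      unfolding e_def cis_conv_exp
      by (auto intro!: derivative_eq_intros has_vector_derivative_real_field)
    have "d k = \<i> * (- \<i> * d k)"
      by simp
    also have "\<dots> = \<i> * (complex_of_real (lam * \<xi> k) * y s k - Qy s)"
      unfolding d[symmetric] by simp
    finally have dk: "d k = \<i> * (complex_of_real (lam * \<xi> k) * y s k - Qy s)" .
    have "e s * d k + (- (\<i> * (lam * \<xi> k)) * e s) * y s k = h s"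
      unfolding dk by (simp add: h_def algebra_simps)
    then show "((\<lambda>s. e s * y s k) has_vector_derivative h s) (at s within {x..b})"
      using has_vector_derivative_mult[OF 2 1] by simp
  qed
  have LINT: "(LINT s:{x..b}|lebesgue. h s) = e b * y b k - e x * y x k" if "x \<le> b" for b
  proof (rule has_integral_unique[OF _ FTC[OF that]])
    show "(h has_integral (LINT s:{x..b}|lebesgue. h s)) {x..b}"
      by (intro has_integral_set_lebesgue set_integrable_subset[OF h_int]) auto
  qed
  have lim1: "((\<lambda>b. LINT s:{x..b}|lebesgue. h s) \<longlongrightarrow> (LINT s:{x..}|lebesgue. h s)) at_top"
    by (rule tendsto_set_lebesgue_integral_at_top) (use h_int in auto)
  \<comment> \<open>The boundary term \<open>e b * y b k\<close> is written as \<open>a k\<close>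
    plus a unimodular multiple of the asymptotic error, which tends to 0.\<close>
  have lim2: "((\<lambda>b. e b * (y b k - cis (lam * \<xi> k * b) * a k) + a k - e x * y x k) \<longlongrightarrow> 0 + a k - e x * y x k) at_top"
  proof (intro tendsto_intros)
    show "((\<lambda>b. e b * (y b k - cis (lam * \<xi> k * b) * a k)) \<longlongrightarrow> 0) at_top"
      using lim[OF k] by (rule Lim_transform_bound[rotated]) (simp add: e_def norm_mult)
  qed
  have ev: "eventually (\<lambda>b. e b * (y b k - cis (lam * \<xi> k * b) * a k) + a k - e x * y x k
      = (LINT s:{x..b}|lebesgue. h s)) at_top"
    using eventually_ge_at_top[of x]
  proof eventually_elim
    case (elim b)
    have "e b * cis (lam * \<xi> k * b) = 1"
      by (simp add: e_def cis_mult)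
    then show ?case
      using LINT[OF elim] by (simp add: right_diff_distrib mult.assoc[symmetric])
  qed
  have "(LINT s:{x..}|lebesgue. h s) = 0 + a k - e x * y x k"
    by (rule tendsto_unique[OF trivial_limit_at_top_linorder lim1 Lim_transform_eventually[OF lim2 ev]])
  then have "cis (lam * \<xi> k * x) * (e x * y x k) = cis (lam * \<xi> k * x) * (a k - (LINT s:{x..}|lebesgue. h s))"
    by simp
  then have "y x k = cis (lam * \<xi> k * x) * a k - cis (lam * \<xi> k * x) * (LINT s:{x..}|lebesgue. h s)"
    by (simp add: e_def cis_mult mult.assoc[symmetric] right_diff_distrib)
  \<comment> \<open>The phases satisfy \<open>e s = e x * cis (lam * \<xi> k * (x - s))\<close>, so
    \<open>h\<close> and \<open>F\<close> differ by a factor independent of \<open>s\<close>, and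
    multiplication by the inverse of \<open>e x\<close> gives the claim.\<close>
  moreover have "h s = (- \<i> * e x) * F s" for s
    by (simp add: h_def F_def Qy_def e_def cis_mult algebra_simps)
  moreover from this have "(LINT s:{x..}|lebesgue. h s) = (- \<i> * e x) * (LINT s:{x..}|lebesgue. F s)"
    using F_int by (simp only: set_integral_mult_right)
  ultimately show "y x k = cis (lam * \<xi> k * x) * a k + \<i> * (LINT s:{x..}|lebesgue. F s)"
    by (simp add: e_def cis_mult mult.assoc[symmetric])
qed

section \<open>Triangular systems\<close>

lemma completion_ex_borel_measurable_complex:
  fixes g :: "'a \<Rightarrow> complex"
  assumes "g \<in> borel_measurable (completion M)"
  obtains g' where "g' \<in> borel_measurable M" "AE x in M. g x = g' x"
proof -
  obtain a where a: "a \<in> borel_measurable M" "AE x in M. Re (g x) = a x"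
    using completion_ex_borel_measurable_real[of "\<lambda>x. Re (g x)" M] assms by auto
  obtain b where b: "b \<in> borel_measurable M" "AE x in M. Im (g x) = b x"
    using completion_ex_borel_measurable_real[of "\<lambda>x. Im (g x)" M] assms by auto
  show thesis
  proof (rule that)
    show "(\<lambda>x. complex_of_real (a x) + \<i> * complex_of_real (b x)) \<in> borel_measurable M"
      using a b by measurable
    show "AE x in M. g x = complex_of_real (a x) + \<i> * complex_of_real (b x)"
      using a(2) b(2) by eventually_elim (metis complex_eq)
  qed
qed

text \<open>Restores the finite upper limits of the kernel equations from the integrals over
  \<open>{x..}\<close> that the column construction produces.\<close>

lemma set_integral_Icc_of_zero:
  fixes f :: "real \<Rightarrow> complex"
  assumes "set_integrable M {x..} f" "\<And>s. s > d \<Longrightarrow> f s = 0"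
  shows "set_integrable M {x..d} f" "(LINT s:{x..d}|M. f s) = (LINT s:{x..}|M. f s)"
proof -
  have "indicator {x..d} s *\<^sub>R f s = indicator {x..} s *\<^sub>R f s" for s
    using assms(2) by (cases "s \<le> d") (auto split: split_indicator)
  then show "set_integrable M {x..d} f" "(LINT s:{x..d}|M. f s) = (LINT s:{x..}|M. f s)"
    using assms(1) by (simp_all only: set_integrable_def set_lebesgue_integral_def)
qed

text \<open>The block structure enters only through the rank \<open>r\<close>, so all four blocks
  are handled at once. The representation holds because both the solution and the combination of the
  columns with coefficients \<open>a j\<close> satisfy the same Volterra equation with the same free
  term.\<close>

theorem triangular_kernels_exist:
  fixes m :: nat and \<xi> :: "nat \<Rightarrow> real" and Q :: "real \<Rightarrow> cmat" and r :: "nat \<Rightarrow> nat" and C \<epsilon> \<theta> :: real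
  assumes C: "C > 0" and \<epsilon>: "\<epsilon> > 0" and \<theta>: "\<theta> > 0"
    and \<xi>_inj: "inj_on \<xi> {1..m}" and \<xi>_nz: "\<And>k. k \<in> {1..m} \<Longrightarrow> \<xi> k \<noteq> 0"
    and Q_meas: "\<And>k l. k \<in> {1..m} \<Longrightarrow> l \<in> {1..m} \<Longrightarrow> (\<lambda>x. Q x k l) \<in> borel_measurable (lebesgue_on {0..})"
    and Q_bound: "\<And>k l x. k \<in> {1..m} \<Longrightarrow> l \<in> {1..m} \<Longrightarrow> 0 \<le> x \<Longrightarrow> norm (Q x k l) \<le> C * exp (- \<epsilon> * x)"
    and Q_zero: "\<And>k l x. k \<in> {1..m} \<Longrightarrow> l \<in> {1..m} \<Longrightarrow> 0 \<le> x \<Longrightarrow> r k < r l \<or> k = l \<Longrightarrow> Q x k l = 0"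
    and ratio: "\<And>k j. k \<in> {1..m} \<Longrightarrow> j \<in> {1..m} \<Longrightarrow> r j \<le> r k \<Longrightarrow> k \<noteq> j \<Longrightarrow> \<xi> k / \<xi> j < 1"
    and \<theta>_le: "\<And>k j. k \<in> {1..m} \<Longrightarrow> j \<in> {1..m} \<Longrightarrow> r j \<le> r k \<Longrightarrow> k \<noteq> j \<Longrightarrow> \<theta> \<le> \<xi> j / (\<xi> j - \<xi> k)"
  obtains A Ct where
    "\<And>lam x k j. k \<in> {1..m} \<Longrightarrow> j \<in> {1..m} \<Longrightarrow> 0 \<le> x \<Longrightarrow>
      set_integrable lebesgue {x..} (\<lambda>t. A x t k j * cis (lam * \<xi> j * t))"
    "\<And>lam y a x k. is_solution m \<xi> Q lam y \<Longrightarrow>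
      (\<And>k. k \<in> {1..m} \<Longrightarrow> bounded ((\<lambda>x. y x k) ` {0..})) \<Longrightarrow>
      (\<And>k. k \<in> {1..m} \<Longrightarrow> ((\<lambda>x. y x k - cis (lam * \<xi> k * x) * a k) \<longlongrightarrow> 0) at_top) \<Longrightarrow>
      k \<in> {1..m} \<Longrightarrow> 0 \<le> x \<Longrightarrow>
      y x k = cis (lam * \<xi> k * x) * a k
        + (\<Sum>j = 1..m. a j * (LINT t:{x..}|lebesgue. A x t k j * cis (lam * \<xi> j * t)))"
    "\<And>x t k j. k \<in> {1..m} \<Longrightarrow> j \<in> {1..m} \<Longrightarrow> r k < r j \<Longrightarrow> A x t k j = 0"
    "\<And>x t k j. k \<in> {1..m} \<Longrightarrow> j \<in> {1..m} \<Longrightarrow> r j \<le> r k \<Longrightarrow> 0 \<le> x \<Longrightarrow> x \<le> t \<Longrightarrow>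
      kernel_eq (\<xi> j) (\<xi> k) (\<lambda>s. Q s k j) (\<lambda>s \<tau>. \<Sum>l = 1..m. Q s k l * A s \<tau> l j) (\<lambda>x t. A x t k j) x t"
    "\<And>x t k j. k \<in> {1..m} \<Longrightarrow> j \<in> {1..m} \<Longrightarrow> 0 \<le> x \<Longrightarrow> x \<le> t \<Longrightarrow>
      norm (A x t k j) \<le> Ct * exp (- \<epsilon> * (x + \<theta> * (t - x)))"
    "\<And>x k j. k \<in> {1..m} \<Longrightarrow> j \<in> {1..m} \<Longrightarrow> 0 \<le> x \<Longrightarrow>
      Q x k j = - \<i> * complex_of_real ((\<xi> j - \<xi> k) / \<xi> j) * A x x k j"
proof -
  \<comment> \<open>Extension by 0 to negative arguments and to indices out of range makes the
    bounds of \<open>kernel_column\<close> hold without side conditions.\<close>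
  define q where "q k l x = (if k \<in> {1..m} \<and> l \<in> {1..m} \<and> 0 \<le> x then Q x k l else 0)" for k l x
  have q_meas: "q k l \<in> borel_measurable lebesgue" for k l
  proof (cases "k \<in> {1..m} \<and> l \<in> {1..m}")
    case True
    have "(\<lambda>x. indicator {0..} x *\<^sub>R Q x k l) \<in> borel_measurable lebesgue"
      using Q_meas[of k l] True by (simp add: borel_measurable_restrict_space_iff)
    also have "(\<lambda>x. indicator {0..} x *\<^sub>R Q x k l) = q k l"
      using True by (auto simp: q_def)
    finally show ?thesis .
  next
    case False
    then have "q k l = (\<lambda>_. 0)"
      by (auto simp: q_def)
    then show ?thesis
      by simp
  qed
  have q_bound: "norm (q k l x) \<le> C * exp (- \<epsilon> * x)" for k l x
    using Q_bound[of k l x] C by (auto simp: q_def less_imp_le)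
  have "\<exists>g \<in> borel_measurable borel. AE x in lebesgue. q k l x = g x" for k l
    by (rule completion_ex_borel_measurable_complex[OF q_meas[of k l]]) (use AE_completion in auto)
  then obtain g where g: "\<And>k l. g k l \<in> borel_measurable borel" "\<And>k l. AE x in lebesgue. q k l x = g k l x"
    by metis
  note g(1) [measurable]
  \<comment> \<open>The truncation forces the bound and the zero diagonal at every point. As
    \<open>q\<close> has both properties, it changes the Borel version \<open>g\<close> only where
    \<open>g\<close> differs from \<open>q\<close>.\<close>
  define p where "p k l x = (if k \<noteq> l \<and> norm (g k l x) \<le> C * exp (- \<epsilon> * x) then g k l x else 0)" for k l x
  have q_diag: "q k k x = 0" for k x
    using Q_zero[of k k x] by (simp add: q_def)
  have q_eq_p: "AE x in lebesgue. q k l x = p k l x" for k l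
    using g(2)[of k l]
  proof eventually_elim
    case (elim x)
    then show ?case
      using q_bound[of k l x] q_diag by (auto simp: p_def)
  qed
  define I where "I j = {k \<in> {1..m}. r j \<le> r k}" for j
  define \<beta> where "\<beta> j k = \<xi> k / \<xi> j" for j k
  have col: "kernel_column (I j) j (\<beta> j) q p C \<epsilon> \<theta>" if "j \<in> {1..m}" for j
  proof
    show "finite (I j)" "j \<in> I j"
      using that by (auto simp: I_def)
    show "\<beta> j j = 1"
      using \<xi>_nz[OF that] by (simp add: \<beta>_def)
    show less: "\<beta> j k < 1" if "k \<in> I j" "k \<noteq> j" for k
      using ratio[of k j] that \<open>j \<in> {1..m}\<close> by (simp add: \<beta>_def I_def)
    show "inj_on (\<beta> j) (I j)"
    proof (rule inj_onI)
      fix k l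
      assume "k \<in> I j" "l \<in> I j" "\<beta> j k = \<beta> j l"
      then show "k = l"
        using \<xi>_nz[OF that] inj_onD[OF \<xi>_inj, of k l] by (simp add: \<beta>_def I_def)
    qed
    show "\<theta> * (1 - \<beta> j k) \<le> 1" if "k \<in> I j" for k
    proof (cases "k = j")
      case True
      then show ?thesis
        using \<open>\<beta> j j = 1\<close> by simp
    next
      case False
      have "\<theta> \<le> \<xi> j / (\<xi> j - \<xi> k)"
        using \<theta>_le[of k j] that \<open>j \<in> {1..m}\<close> False by (simp add: I_def)
      also have "\<xi> j / (\<xi> j - \<xi> k) = 1 / (1 - \<beta> j k)"
        using \<xi>_nz[OF \<open>j \<in> {1..m}\<close>] by (simp add: \<beta>_def divide_simps)
      finally show ?thesis
        using less[OF that False] by (simp add: field_simps)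
    qed
    show "p k l \<in> borel_measurable borel" for k l
      unfolding p_def by measurable
    show "norm (p k l x) \<le> C * exp (- \<epsilon> * x)" for k l x
      using C by (auto simp: p_def less_imp_le)
    show "p k k x = 0" for k x
      by (simp add: p_def)
  qed (use C \<epsilon> \<theta> q_meas q_bound q_diag q_eq_p in auto)

  define A where "A x t k j = (if k \<in> I j then kernel_column.K (I j) j (\<beta> j) q p k x t else 0)" for x t k j
  define U where "U lam j k x = (if k \<in> I j then kernel_column.u (I j) j (\<beta> j) p (lam * \<xi> j) k x else 0)" for lam j k x

  have sum_I: "(\<Sum>l\<in>I j. q k l s * f l) = (\<Sum>l = 1..m. Q s k l * (if l \<in> I j then f l else 0))"
    if "k \<in> {1..m}" "0 \<le> s" for j k s and f :: "nat \<Rightarrow> complex"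
    by (rule sum.mono_neutral_cong_left) (use that in \<open>auto simp: I_def q_def\<close>)

  define B where "B j = 2 * kernel_column.M (I j) (\<beta> j) C * exp (kernel_column.L (I j) C \<epsilon>)
      + 2 * kernel_column.M (I j) (\<beta> j) C" for j

  show thesis
  \<comment> \<open>Each column has its own constant; the sum of absolute values dominates all of
    them without any information on signs.\<close>
  proof (rule that[of A "\<Sum>j = 1..m. \<bar>B j\<bar>"])
    show A_int: "set_integrable lebesgue {x..} (\<lambda>t. A x t k j * cis (lam * \<xi> j * t))"
      if "k \<in> {1..m}" "j \<in> {1..m}" "0 \<le> x" for lam x k j
      using kernel_column.u_eq_K(1)[OF col[OF that(2)] _ that(3)]
      by (cases "k \<in> I j") (auto simp: A_def set_integrable_def)
    have U_A: "U lam j k x = (if k = j then cis (lam * \<xi> j * x) else 0)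
        + (LINT t:{x..}|lebesgue. A x t k j * cis (lam * \<xi> j * t))"
      if "k \<in> {1..m}" "j \<in> {1..m}" "0 \<le> x" for lam x k j
      using kernel_column.u_eq_K(2)[OF col[OF that(2)] _ that(3)] that
      by (cases "k \<in> I j") (auto simp: A_def U_def set_lebesgue_integral_def I_def)
    have U_eq: "set_integrable lebesgue {x..} (\<lambda>s. cis (lam * \<xi> k * (x - s)) * (\<Sum>l = 1..m. Q s k l * U lam j l s))"
      "U lam j k x = (if k = j then cis (lam * \<xi> j * x) else 0)
        + \<i> * (LINT s:{x..}|lebesgue. cis (lam * \<xi> k * (x - s)) * (\<Sum>l = 1..m. Q s k l * U lam j l s))"
      if "k \<in> {1..m}" "j \<in> {1..m}" "0 \<le> x" for lam x k j
    proof -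
      let ?F = "\<lambda>s. cis (lam * \<xi> k * (x - s)) * (\<Sum>l = 1..m. Q s k l * U lam j l s)"
      have "set_integrable lebesgue {x..} ?F \<and> U lam j k x = (if k = j then cis (lam * \<xi> j * x) else 0)
        + \<i> * (LINT s:{x..}|lebesgue. ?F s)"
      proof (cases "k \<in> I j")
        case True
        let ?F' = "\<lambda>s. cis (lam * \<xi> j * \<beta> j k * (x - s)) *
          (\<Sum>l\<in>I j. q k l s * kernel_column.u (I j) j (\<beta> j) p (lam * \<xi> j) l s)"
        have "?F' s = ?F s" if "s \<in> {x..}" for s
          using sum_I[OF \<open>k \<in> {1..m}\<close>, of s] that \<open>0 \<le> x\<close> \<xi>_nz[OF \<open>j \<in> {1..m}\<close>] by (simp add: U_def \<beta>_def)
        then have *: "indicator {x..} s *\<^sub>R ?F' s = indicator {x..} s *\<^sub>R ?F s" for s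
          by (auto split: split_indicator)
        show ?thesis
          using kernel_column.u_eq_q[OF col[OF that(2)] True that(3), of "lam * \<xi> j"] True
          by (simp only: set_integrable_def set_lebesgue_integral_def *) (simp add: U_def)
      next
        case False
        \<comment> \<open>A row of rank below \<open>r j\<close> is compatible with the value 0: for
          \<open>l\<close> in \<open>I j\<close> the coefficient vanishes by the rank condition, and
          for the other \<open>l\<close> the function \<open>U\<close> does.\<close>
        have "Q s k l * U lam j l s = 0" if "x \<le> s" "l \<in> {1..m}" for s l
          using False that \<open>0 \<le> x\<close> \<open>k \<in> {1..m}\<close> Q_zero[of k l s] by (cases "l \<in> I j") (auto simp: I_def U_def)
        then have "(\<Sum>l = 1..m. Q s k l * U lam j l s) = 0" if "x \<le> s" for s
          using that by (intro sum.neutral) blast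
        then have *: "indicator {x..} s *\<^sub>R ?F s = 0" for s
          by (cases "x \<le> s") simp_all
        show ?thesis
          using False that by (simp only: set_integrable_def set_lebesgue_integral_def *) (auto simp: U_def I_def)
      qed
      then show "set_integrable lebesgue {x..} ?F"
        "U lam j k x = (if k = j then cis (lam * \<xi> j * x) else 0) + \<i> * (LINT s:{x..}|lebesgue. ?F s)"
        by blast+
    qed
    show "y x k = cis (lam * \<xi> k * x) * a k
        + (\<Sum>j = 1..m. a j * (LINT t:{x..}|lebesgue. A x t k j * cis (lam * \<xi> j * t)))"
      if sol: "is_solution m \<xi> Q lam y"
        and bdd: "\<And>k. k \<in> {1..m} \<Longrightarrow> bounded ((\<lambda>x. y x k) ` {0..})"
        and lim: "\<And>k. k \<in> {1..m} \<Longrightarrow> ((\<lambda>x. y x k - cis (lam * \<xi> k * x) * a k) \<longlongrightarrow> 0) at_top"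
        and k: "k \<in> {1..m}" and x: "0 \<le> x" for lam y a x k
    proof -
      have "bounded (\<Union>k\<in>{1..m}. (\<lambda>x. y x k) ` {0..})"
        using bdd by (intro bounded_UN) auto
      then obtain By where By: "\<And>k x. k \<in> {1..m} \<Longrightarrow> 0 \<le> x \<Longrightarrow> norm (y x k) \<le> By"
        unfolding bounded_iff by fastforce
      have "\<exists>B. \<forall>k x. k \<in> {1..m} \<longrightarrow> 0 \<le> x \<longrightarrow> norm (U lam j k x) \<le> B" if "j \<in> {1..m}" for j
      proof -
        let ?B = "1 + 2 * kernel_column.M (I j) (\<beta> j) C * exp (kernel_column.L (I j) C \<epsilon>) / (\<epsilon> * \<theta>)"
        have "norm (U lam j k x) \<le> max 0 ?B" if "0 \<le> x" for k x
          using kernel_column.u_bound[OF col[OF \<open>j \<in> {1..m}\<close>] _ that, of k "lam * \<xi> j"]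
          by (cases "k \<in> I j") (auto simp: U_def)
        then show ?thesis
          by blast
      qed
      then obtain BU where BU: "\<And>j k x. j \<in> {1..m} \<Longrightarrow> k \<in> {1..m} \<Longrightarrow> 0 \<le> x \<Longrightarrow> norm (U lam j k x) \<le> BU j"
        by metis
      \<comment> \<open>The free terms of both equations cancel in this difference, which leaves a
        bounded solution of the homogeneous Volterra equation.\<close>
      define w where "w k x = y x k - (\<Sum>j = 1..m. a j * U lam j k x)" for k x
      have w_eq: "w k x = (LINT s:{x..}|lebesgue. \<i> * (cis (lam * \<xi> k * (x - s)) * (\<Sum>l = 1..m. Q s k l * w l s)))"
        if "k \<in> {1..m}" "0 \<le> x" for k x
      proof -
        let ?e = "\<lambda>s. cis (lam * \<xi> k * (x - s))"
        let ?FU = "\<lambda>j s. ?e s * (\<Sum>l = 1..m. Q s k l * U lam j l s)"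
        have FU: "set_integrable lebesgue {x..} (?FU j)" if "j \<in> {1..m}" for j
          by (rule U_eq(1)) fact+
        have y_eq': "set_integrable lebesgue {x..} (\<lambda>s. ?e s * mat_vec m (Q s) (y s) k)"
          "y x k = cis (lam * \<xi> k * x) * a k + \<i> * (LINT s:{x..}|lebesgue. ?e s * mat_vec m (Q s) (y s) k)"
          using solution_volterra[OF sol C \<epsilon> _ _ _ _ that, of By a] Q_meas Q_bound By lim by blast+
        have integrand: "?e s * mat_vec m (Q s) (y s) k - (\<Sum>j = 1..m. a j * ?FU j s) = ?e s * (\<Sum>l = 1..m. Q s k l * w l s)" for s
        proof -
          have "(\<Sum>j = 1..m. a j * ?FU j s) = ?e s * (\<Sum>j = 1..m. \<Sum>l = 1..m. Q s k l * (a j * U lam j l s))"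
            by (simp add: sum_distrib_left mult_ac)
          also have "(\<Sum>j = 1..m. \<Sum>l = 1..m. Q s k l * (a j * U lam j l s))
              = (\<Sum>l = 1..m. Q s k l * (\<Sum>j = 1..m. a j * U lam j l s))"
            by (subst sum.swap) (simp add: sum_distrib_left)
          finally show ?thesis
            by (simp add: mat_vec_def w_def right_diff_distrib sum_subtractf)
        qed
        have aFU: "integrable lebesgue (\<lambda>s. indicator {x..} s *\<^sub>R (a j * ?FU j s))" if "j \<in> {1..m}" for j
          using FU[OF that] by (intro set_integrable_mult_right[unfolded set_integrable_def]) (simp add: set_integrable_def)
        then have sum_int: "set_integrable lebesgue {x..} (\<lambda>s. \<Sum>j = 1..m. a j * ?FU j s)"
          unfolding set_integrable_def scaleR_sum_right by (intro Bochner_Integration.integrable_sum)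
        have "(\<Sum>j = 1..m. a j * U lam j k x)
            = (\<Sum>j = 1..m. a j * (if k = j then cis (lam * \<xi> j * x) else 0)) + (\<Sum>j = 1..m. a j * (\<i> * (LINT s:{x..}|lebesgue. ?FU j s)))"
          using U_eq(2)[OF that(1) _ that(2), of _ lam] by (simp add: sum.distrib[symmetric] distrib_left)
        also have "(\<Sum>j = 1..m. a j * (if k = j then cis (lam * \<xi> j * x) else 0)) = cis (lam * \<xi> k * x) * a k"
          using that(1) by (simp add: if_distrib sum.delta' mult.commute cong: if_cong)
        also have "(\<Sum>j = 1..m. a j * (\<i> * (LINT s:{x..}|lebesgue. ?FU j s)))
            = \<i> * (\<Sum>j = 1..m. LINT s:{x..}|lebesgue. a j * ?FU j s)"
          unfolding sum_distrib_left[of \<i>] set_integral_mult_right by (intro sum.cong refl mult.left_commute)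
        also have "(\<Sum>j = 1..m. LINT s:{x..}|lebesgue. a j * ?FU j s) = (LINT s:{x..}|lebesgue. \<Sum>j = 1..m. a j * ?FU j s)"
          using aFU unfolding set_lebesgue_integral_def scaleR_sum_right
          by (intro Bochner_Integration.integral_sum[symmetric])
        finally have "w k x = \<i> * ((LINT s:{x..}|lebesgue. ?e s * mat_vec m (Q s) (y s) k)
            - (LINT s:{x..}|lebesgue. \<Sum>j = 1..m. a j * ?FU j s))"
          unfolding w_def y_eq'(2) by (simp add: right_diff_distrib)
        also have "\<dots> = (LINT s:{x..}|lebesgue. \<i> * (?e s * mat_vec m (Q s) (y s) k - (\<Sum>j = 1..m. a j * ?FU j s)))"
          using y_eq'(1) sum_int by (simp add: set_integral_diff)
        finally show ?thesis
          unfolding integrand .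
      qed
      have "w k x = 0"
      proof (rule volterra_unique[where I = "{1..m}" and C = C and \<epsilon> = \<epsilon>
            and f = "\<lambda>k x s. \<i> * (cis (lam * \<xi> k * (x - s)) * (\<Sum>l = 1..m. Q s k l * w l s))"
            and B = "By + (\<Sum>j = 1..m. norm (a j) * BU j)"])
        show "norm (w k x) \<le> By + (\<Sum>j = 1..m. norm (a j) * BU j)" if "k \<in> {1..m}" "0 \<le> x" for k x
        proof -
          have "norm (\<Sum>j = 1..m. a j * U lam j k x) \<le> (\<Sum>j = 1..m. norm (a j) * BU j)"
            using that BU by (intro sum_norm_le) (auto simp: norm_mult intro!: mult_left_mono)
          then show ?thesis
            unfolding w_def using By[OF that] norm_triangle_ineq4[of "y x k" "\<Sum>j = 1..m. a j * U lam j k x"]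
            by linarith
        qed
        show "w k x = (\<integral>s. indicator {x..} s *\<^sub>R (\<i> * (cis (lam * \<xi> k * (x - s)) * (\<Sum>l = 1..m. Q s k l * w l s))) \<partial>lebesgue)"
          if "k \<in> {1..m}" "0 \<le> x" for k x
          using w_eq[OF that] unfolding set_lebesgue_integral_def .
        show "norm (\<i> * (cis (lam * \<xi> k * (x - s)) * (\<Sum>l = 1..m. Q s k l * w l s)))
            \<le> C * exp (- \<epsilon> * s) * (\<Sum>l = 1..m. norm (w l s))" if "k \<in> {1..m}" "0 \<le> s" for k x s
          unfolding norm_mult sum_distrib_left using that Q_bound
          by (auto simp: norm_mult intro!: sum_norm_le mult_right_mono)
      qed (use C \<epsilon> k x in auto)
      then have "y x k = (\<Sum>j = 1..m. a j * U lam j k x)"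
        by (simp add: w_def)
      also have "\<dots> = (\<Sum>j = 1..m. a j * (if k = j then cis (lam * \<xi> j * x) else 0))
          + (\<Sum>j = 1..m. a j * (LINT t:{x..}|lebesgue. A x t k j * cis (lam * \<xi> j * t)))"
        using U_A[OF k _ x, of _ lam] by (simp add: sum.distrib[symmetric] distrib_left)
      also have "(\<Sum>j = 1..m. a j * (if k = j then cis (lam * \<xi> j * x) else 0)) = cis (lam * \<xi> k * x) * a k"
        using k by (simp add: if_distrib sum.delta' mult.commute cong: if_cong)
      finally show ?thesis .
    qed
    show "A x t k j = 0" if "k \<in> {1..m}" "j \<in> {1..m}" "r k < r j" for x t k j
      using that by (simp add: A_def I_def)
    show "kernel_eq (\<xi> j) (\<xi> k) (\<lambda>s. Q s k j) (\<lambda>s \<tau>. \<Sum>l = 1..m. Q s k l * A s \<tau> l j) (\<lambda>x t. A x t k j) x t"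
      if "k \<in> {1..m}" "j \<in> {1..m}" "r j \<le> r k" "0 \<le> x" "x \<le> t" for x t k j
    proof -
      have kI: "k \<in> I j"
        using that by (simp add: I_def)
      let ?F = "\<lambda>s. \<Sum>l = 1..m. Q s k l * A s (t + \<xi> k / \<xi> j * (s - x)) l j"
      let ?F' = "\<lambda>s. \<Sum>l\<in>I j. q k l s * kernel_column.K (I j) j (\<beta> j) q p l s (t + \<beta> j k * (s - x))"
      have "?F' s = ?F s" if "s \<in> {x..}" for s
        using sum_I[OF \<open>k \<in> {1..m}\<close>, of s] that \<open>0 \<le> x\<close> by (simp add: A_def \<beta>_def)
      then have *: "indicator {x..} s *\<^sub>R ?F' s = indicator {x..} s *\<^sub>R ?F s" for s
        by (auto split: split_indicator)
      have F: "set_integrable lebesgue {x..} ?F"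
        and K: "A x t k j = kernel_column.G j (\<beta> j) q k x t + \<i> * (LINT s:{x..}|lebesgue. ?F s)"
        using kernel_column.K_equation[OF col[OF that(2)] kI that(4,5)] kI
        by (simp_all only: set_integrable_def set_lebesgue_integral_def *) (simp_all add: A_def)
      show ?thesis
      proof (cases "k = j")
        case True
        then have "kernel_column.G j (\<beta> j) q k x t = 0"
          by (simp add: kernel_column.G_def[OF col[OF that(2)]] q_diag)
        then show ?thesis
          using True F K by (simp add: kernel_eq_def)
      next
        case False
        have "\<xi> k \<noteq> \<xi> j"
          using inj_onD[OF \<xi>_inj, of k j] that False by blast
        have "\<xi> j \<noteq> 0"
          using \<xi>_nz that by blast
        define c where "c = \<xi> j / (\<xi> j - \<xi> k)"
        have pos: "1 - \<xi> k / \<xi> j > 0"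
          using ratio[OF that(1,2,3) False] by simp
        have c: "c = 1 / (1 - \<xi> k / \<xi> j)"
          using \<open>\<xi> j \<noteq> 0\<close> by (simp add: c_def divide_simps)
        have c_inverse: "(1 - \<xi> k / \<xi> j) * c = 1"
          unfolding c using right_inverse[OF less_imp_neq[OF pos, symmetric]] by (simp only: inverse_eq_divide)
        have "c > 0"
          unfolding c using pos by simp
        have "0 \<le> x + c * (t - x)"
          using \<open>c > 0\<close> that by simp
        then have G: "kernel_column.G j (\<beta> j) q k x t = \<i> * complex_of_real c * Q (x + c * (t - x)) k j"
          using that by (simp add: kernel_column.G_def[OF col[OF that(2)]] kernel_column.c_def[OF col[OF that(2)]] \<beta>_def c q_def)
        \<comment> \<open>Beyond this point the characteristic has passed below the diagonal, where
          every row of the column vanishes.\<close>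
        have zero: "?F s = 0" if "s > x + c * (t - x)" for s
        proof -
          have "(1 - \<xi> k / \<xi> j) * (s - x) > (1 - \<xi> k / \<xi> j) * (c * (t - x))"
            using that pos by (intro mult_strict_left_mono) auto
          also have "(1 - \<xi> k / \<xi> j) * (c * (t - x)) = t - x"
            unfolding mult.assoc[symmetric] c_inverse by simp
          finally have "\<not> (0 \<le> s \<and> s \<le> t + \<xi> k / \<xi> j * (s - x))"
            by (simp add: algebra_simps)
          from kernel_column.K_zero[OF col[OF \<open>j \<in> {1..m}\<close>] this] show ?thesis
            by (simp only: A_def if_cancel mult_zero_right sum.neutral_const)
        qed
        show ?thesis
          using set_integral_Icc_of_zero[OF F zero] K \<open>\<xi> k \<noteq> \<xi> j\<close> by (simp add: kernel_eq_def G c_def)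
      qed
    qed
    show "norm (A x t k j) \<le> (\<Sum>j = 1..m. \<bar>B j\<bar>) * exp (- \<epsilon> * (x + \<theta> * (t - x)))"
      if "k \<in> {1..m}" "j \<in> {1..m}" "0 \<le> x" "x \<le> t" for x t k j
    proof -
      have "norm (A x t k j) \<le> \<bar>B j\<bar> * exp (- \<epsilon> * (x + \<theta> * (t - x)))"
      proof (cases "k \<in> I j")
        case True
        have "norm (A x t k j) \<le> B j * exp (- \<epsilon> * (x + \<theta> * (t - x)))"
          using kernel_column.K_bound[OF col[OF that(2)] True that(3,4)] True
          unfolding B_def A_def kernel_column.env_def[OF col[OF that(2)]] by simp
        also have "\<dots> \<le> \<bar>B j\<bar> * exp (- \<epsilon> * (x + \<theta> * (t - x)))"
          by (intro mult_right_mono) auto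
        finally show ?thesis .
      qed (simp add: A_def)
      also have "\<bar>B j\<bar> \<le> (\<Sum>j = 1..m. \<bar>B j\<bar>)"
        using that by (intro member_le_sum) auto
      finally show ?thesis
        by (simp add: mult_right_mono)
    qed
    show "Q x k j = - \<i> * complex_of_real ((\<xi> j - \<xi> k) / \<xi> j) * A x x k j"
      if "k \<in> {1..m}" "j \<in> {1..m}" "0 \<le> x" for x k j
    proof -
      have "r k < r j \<or> k \<in> I j"
        using that by (auto simp: I_def)
      \<comment> \<open>In the first two cases both sides are 0: \<open>Q\<close> by the rank
        condition, and on the right the factor \<open>\<xi> j - \<xi> k\<close> or the kernel. Only
        the third involves the non-integral term.\<close>
      then consider "k = j" | "r k < r j" | "k \<noteq> j" "k \<in> I j"
        by blast
      then show ?thesis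
      proof cases
        case 3
        have "\<xi> k \<noteq> \<xi> j"
          using inj_onD[OF \<xi>_inj, of k j] that 3 by blast
        have "\<xi> j \<noteq> 0"
          using \<xi>_nz that by blast
        have "A x x k j = \<i> * complex_of_real (\<xi> j / (\<xi> j - \<xi> k)) * Q x k j"
          using kernel_column.K_diagonal[OF col[OF that(2)] 3(2,1) that(3)] 3 that \<open>\<xi> j \<noteq> 0\<close>
          by (simp add: A_def kernel_column.G_def[OF col[OF that(2)]] kernel_column.c_def[OF col[OF that(2)]]
              \<beta>_def q_def divide_simps)
        then show ?thesis
          using \<open>\<xi> k \<noteq> \<xi> j\<close> \<open>\<xi> j \<noteq> 0\<close> by (simp flip: of_real_mult)
      qed (use that Q_zero[of k j x] in \<open>auto simp: A_def I_def\<close>)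
    qed
  qed
qed

section \<open>The block form\<close>

lemma INF_ereal_finite_pos:
  assumes "finite S" "\<And>s. s \<in> S \<Longrightarrow> 0 < f s"
  shows "0 < (INF s\<in>S. ereal (f s))"
proof (cases "S = {}")
  case False
  then have "(INF s\<in>S. ereal (f s)) = Min ((\<lambda>s. ereal (f s)) ` S)"
    using assms by (simp add: Min_Inf)
  then show ?thesis
    using assms False by simp
qed (simp add: top_ereal_def)

text \<open>In each of the four families the numerator and the denominator have the same sign, and
  the families are finite, so each infimum is positive, possibly infinite.\<close>

lemma theta_pos_le:
  assumes n: "n \<ge> 1" and mono: "strict_mono_on {1..2 * n} \<xi>" and neg: "\<xi> n < 0" and pos: "0 < \<xi> (n + 1)"
  shows "0 < theta n \<xi>"
    and "\<And>k j. k \<in> {1..n} \<Longrightarrow> j \<in> {1..n} \<Longrightarrow> k > j \<Longrightarrow> theta n \<xi> \<le> \<xi> j / (\<xi> j - \<xi> k)"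
    and "\<And>k j. k \<in> {1..n} \<Longrightarrow> j \<in> {1..n} \<Longrightarrow> k + j > n \<Longrightarrow> theta n \<xi> \<le> \<xi> (n + j) / (\<xi> (n + j) - \<xi> k)"
    and "\<And>k j. k \<in> {1..n} \<Longrightarrow> j \<in> {1..n} \<Longrightarrow> k + j < n + 2 \<Longrightarrow> theta n \<xi> \<le> \<xi> j / (\<xi> j - \<xi> (n + k))"
    and "\<And>k j. k \<in> {1..n} \<Longrightarrow> j \<in> {1..n} \<Longrightarrow> k < j \<Longrightarrow> theta n \<xi> \<le> \<xi> (n + j) / (\<xi> (n + j) - \<xi> (n + k))"
proof -
  have less: "\<xi> k < \<xi> l" if "1 \<le> k" "k < l" "l \<le> 2 * n" for k l
    using strict_mono_onD[OF mono, of k l] that by simp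
  have neg': "\<xi> k < 0" if "k \<in> {1..n}" for k
    using less[of k n] neg that by (cases "k = n") auto
  have pos': "0 < \<xi> (n + k)" if "k \<in> {1..n}" for k
    using less[of "n + 1" "n + k"] pos that by (cases "k = 1") auto
  let ?S = "\<lambda>P. {(k, j). k \<in> {1..n} \<and> j \<in> {1..n} \<and> P k j}"
  have fin: "finite (?S P)" for P
    by (rule finite_subset[of _ "{1..n} \<times> {1..n}"]) auto
  have pos_INF: "0 < (INF (k, j)\<in>?S P. ereal (f k j))"
    if "\<And>k j. k \<in> {1..n} \<Longrightarrow> j \<in> {1..n} \<Longrightarrow> P k j \<Longrightarrow> 0 < f k j" for P and f :: "nat \<Rightarrow> nat \<Rightarrow> real"
  proof -
    have "0 < (INF s\<in>?S P. ereal (f (fst s) (snd s)))"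
      by (rule INF_ereal_finite_pos[OF fin]) (use that in auto)
    then show ?thesis
      by (simp add: case_prod_unfold)
  qed
  have le_INF: "(INF (k, j)\<in>?S P. ereal (f k j)) \<le> ereal (f k j)"
    if "k \<in> {1..n}" "j \<in> {1..n}" "P k j" for P k j and f :: "nat \<Rightarrow> nat \<Rightarrow> real"
    using that by (intro INF_lower2[of "(k, j)"]) auto
  have 1: "0 < theta1 n \<xi>"
    unfolding theta1_def
  proof (rule pos_INF)
    fix k j
    assume "k \<in> {1..n}" "j \<in> {1..n}" "k > j"
    then show "0 < \<xi> j / (\<xi> j - \<xi> k)"
      using neg'[of j] less[of j k] by (intro divide_neg_neg) auto
  qed
  have 2: "0 < theta2 n \<xi>"
    unfolding theta2_def
  proof (rule pos_INF)
    fix k j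
    assume "k \<in> {1..n}" "j \<in> {1..n}" "k + j > n"
    then show "0 < \<xi> (n + j) / (\<xi> (n + j) - \<xi> k)"
      using neg'[of k] pos'[of j] by (intro divide_pos_pos) auto
  qed
  have 3: "0 < theta3 n \<xi>"
    unfolding theta3_def
  proof (rule pos_INF)
    fix k j
    assume "k \<in> {1..n}" "j \<in> {1..n}" "k + j < n + 2"
    then show "0 < \<xi> j / (\<xi> j - \<xi> (n + k))"
      using neg'[of j] pos'[of k] by (intro divide_neg_neg) auto
  qed
  have 4: "0 < theta4 n \<xi>"
    unfolding theta4_def
  proof (rule pos_INF)
    fix k j
    assume "k \<in> {1..n}" "j \<in> {1..n}" "k < j"
    then show "0 < \<xi> (n + j) / (\<xi> (n + j) - \<xi> (n + k))"
      using pos'[of j] less[of "n + k" "n + j"] by (intro divide_pos_pos) auto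
  qed
  let ?e = "Min {theta1 n \<xi>, theta2 n \<xi>, theta3 n \<xi>, theta4 n \<xi>}"
  have e_le: "?e \<le> theta1 n \<xi>" "?e \<le> theta2 n \<xi>" "?e \<le> theta3 n \<xi>" "?e \<le> theta4 n \<xi>"
    by (intro Min_le; simp)+
  have "0 < ?e"
    using 1 2 3 4 by simp
  \<comment> \<open>The pair \<open>k = n\<close>, \<open>j = 1\<close> is always admissible.
    Finiteness is essential here, since \<open>real_of_ereal\<close> would send an infinite minimum
    to 0.\<close>
  have "theta2 n \<xi> \<le> ereal (\<xi> (n + 1) / (\<xi> (n + 1) - \<xi> n))"
    unfolding theta2_def by (rule le_INF) (use n in auto)
  from order_trans[OF e_le(2) this] have "?e < \<infinity>"
    by (rule order.strict_trans1) simp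
  have "\<bar>x\<bar> \<noteq> \<infinity>" if "0 < x" "x < \<infinity>" for x :: ereal
    using that by (cases x) auto
  from this[OF \<open>0 < ?e\<close> \<open>?e < \<infinity>\<close>] have e: "ereal (theta n \<xi>) = ?e"
    unfolding theta_def by (rule ereal_real')
  show "0 < theta n \<xi>"
    using \<open>0 < ?e\<close> unfolding e[symmetric] by simp
  note e_le = e_le[folded e]
  show "theta n \<xi> \<le> \<xi> j / (\<xi> j - \<xi> k)" if "k \<in> {1..n}" "j \<in> {1..n}" "k > j" for k j
  proof -
    have "ereal (theta n \<xi>) \<le> ereal (\<xi> j / (\<xi> j - \<xi> k))"
      by (rule order_trans[OF e_le(1)[unfolded theta1_def] le_INF]) (use that in auto)
    then show ?thesis
      by simp
  qed
  show "theta n \<xi> \<le> \<xi> (n + j) / (\<xi> (n + j) - \<xi> k)" if "k \<in> {1..n}" "j \<in> {1..n}" "k + j > n" for k j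
  proof -
    have "ereal (theta n \<xi>) \<le> ereal (\<xi> (n + j) / (\<xi> (n + j) - \<xi> k))"
      by (rule order_trans[OF e_le(2)[unfolded theta2_def] le_INF]) (use that in auto)
    then show ?thesis
      by simp
  qed
  show "theta n \<xi> \<le> \<xi> j / (\<xi> j - \<xi> (n + k))" if "k \<in> {1..n}" "j \<in> {1..n}" "k + j < n + 2" for k j
  proof -
    have "ereal (theta n \<xi>) \<le> ereal (\<xi> j / (\<xi> j - \<xi> (n + k)))"
      by (rule order_trans[OF e_le(3)[unfolded theta3_def] le_INF]) (use that in auto)
    then show ?thesis
      by simp
  qed
  show "theta n \<xi> \<le> \<xi> (n + j) / (\<xi> (n + j) - \<xi> (n + k))" if "k \<in> {1..n}" "j \<in> {1..n}" "k < j" for k j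
  proof -
    have "ereal (theta n \<xi>) \<le> ereal (\<xi> (n + j) / (\<xi> (n + j) - \<xi> (n + k)))"
      by (rule order_trans[OF e_le(4)[unfolded theta4_def] le_INF]) (use that in auto)
    then show ?thesis
      by simp
  qed
qed

section \<open>Entries, norms and block sums\<close>

lemma norm_entry_le_mat_norm:
  assumes "k \<in> {1..m}" "j \<in> {1..m}"
  shows "norm (M k j) \<le> mat_norm m M"
proof -
  have "norm (M k j) \<le> L2_set (\<lambda>j. norm (M k j)) {1..m}"
    using assms by (intro member_le_L2_set) auto
  also have "\<dots> \<le> mat_norm m M"
    unfolding mat_norm_def
    using assms member_le_L2_set[of "{1..m}" k "\<lambda>k. L2_set (\<lambda>j. norm (M k j)) {1..m}"] by simp
  finally show ?thesis .
qed

text \<open>A Euclidean norm is at most the sum of the absolute values; this is applied once to each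
  row and once to the column of row norms.\<close>

lemma mat_norm_le:
  assumes "\<And>k j. k \<in> {1..m} \<Longrightarrow> j \<in> {1..m} \<Longrightarrow> norm (M k j) \<le> b"
  shows "mat_norm m M \<le> real m * real m * b"
proof -
  have row: "L2_set (\<lambda>j. norm (M k j)) {1..m} \<le> real m * b" if "k \<in> {1..m}" for k
  proof -
    have "L2_set (\<lambda>j. norm (M k j)) {1..m} \<le> (\<Sum>j = 1..m. norm (M k j))"
      by (rule L2_set_le_sum) simp
    also have "\<dots> \<le> (\<Sum>j = 1..m. b)"
      using assms that by (intro sum_mono) auto
    finally show ?thesis
      by simp
  qed
  have "mat_norm m M \<le> (\<Sum>k = 1..m. L2_set (\<lambda>j. norm (M k j)) {1..m})"
    unfolding mat_norm_def by (rule L2_set_le_sum) simp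
  also have "\<dots> \<le> (\<Sum>k = 1..m. real m * b)"
    by (rule sum_mono) (rule row)
  finally show ?thesis
    by simp
qed

lemma exp_diag_cis: "exp_diag lam \<zeta> x v k = cis (lam * \<zeta> k * x) * v k"
  by (simp add: exp_diag_def cis_conv_exp)

text \<open>Passes from the columnwise representation to matrix-vector form; integrability of each
  entry is what allows the sum to leave the integral.\<close>

lemma set_integral_mat_vec_exp_diag:
  assumes "\<forall>j\<in>{1..n}. set_integrable M S (\<lambda>t. K t k j * cis (lam * \<zeta> j * t))"
  shows "set_integrable M S (\<lambda>t. mat_vec n (K t) (exp_diag lam \<zeta> t b) k)"
    and "(LINT t:S|M. mat_vec n (K t) (exp_diag lam \<zeta> t b) k)
      = (\<Sum>j = 1..n. b j * (LINT t:S|M. K t k j * cis (lam * \<zeta> j * t)))"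
proof -
  have int: "integrable M (\<lambda>t. indicator S t *\<^sub>R (b j * (K t k j * cis (lam * \<zeta> j * t))))" if "j \<in> {1..n}" for j
    using bspec[OF assms that] by (intro set_integrable_mult_right[unfolded set_integrable_def]) (simp add: set_integrable_def)
  have eq: "mat_vec n (K t) (exp_diag lam \<zeta> t b) k = (\<Sum>j = 1..n. b j * (K t k j * cis (lam * \<zeta> j * t)))" for t
    by (simp add: mat_vec_def exp_diag_cis mult_ac)
  show "set_integrable M S (\<lambda>t. mat_vec n (K t) (exp_diag lam \<zeta> t b) k)"
    unfolding eq set_integrable_def scaleR_sum_right by (intro Bochner_Integration.integrable_sum int)
  have "(LINT t:S|M. mat_vec n (K t) (exp_diag lam \<zeta> t b) k)
      = (\<Sum>j = 1..n. LINT t:S|M. b j * (K t k j * cis (lam * \<zeta> j * t)))"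
    unfolding eq set_lebesgue_integral_def scaleR_sum_right by (intro Bochner_Integration.integral_sum int)
  then show "(LINT t:S|M. mat_vec n (K t) (exp_diag lam \<zeta> t b) k)
      = (\<Sum>j = 1..n. b j * (LINT t:S|M. K t k j * cis (lam * \<zeta> j * t)))"
    by (simp only: set_integral_mult_right)
qed

lemma sum_double_split: "(\<Sum>l = 1..2 * n. f l) = (\<Sum>l = 1..n. f l) + (\<Sum>l = 1..n. f (n + l))"
  for f :: "nat \<Rightarrow> 'a :: comm_monoid_add"
proof -
  have "{1..2 * n} = {1..n} \<union> (\<lambda>l. n + l) ` {1..n}"
    by (auto simp: image_iff intro!: bexI[of _ "_ - n"])
  moreover have "{1..n} \<inter> (\<lambda>l. n + l) ` {1..n} = {}"
    by auto
  ultimately have "(\<Sum>l = 1..2 * n. f l) = (\<Sum>l = 1..n. f l) + sum f ((\<lambda>l. n + l) ` {1..n})"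
    by (simp add: sum.union_disjoint)
  also have "sum f ((\<lambda>l. n + l) ` {1..n}) = (\<Sum>l = 1..n. f (n + l))"
    by (subst sum.reindex) auto
  finally show ?thesis .
qed

text \<open>The kernels are quantified before \<open>lam\<close> and the solution, which expresses
  that they do not depend on \<lambda>. It can be obtained because the integral equations that
  determine the columns contain no \<lambda>.\<close>

theorem lemma2:
  fixes n :: nat and \<xi> :: "nat \<Rightarrow> real"
    and q11 q12 q21 q22 :: "real \<Rightarrow> cmat" and Q :: "real \<Rightarrow> cmat"
    and C \<epsilon> :: real
  assumes n: "n \<ge> 1"
    and \<xi>_mono: "strict_mono_on {1..2 * n} \<xi>"
    and \<xi>_neg: "\<xi> n < 0"
    and \<xi>_pos: "0 < \<xi> (n + 1)"
    and Q: "\<And>x. Q x = block_mat n (q11 x) (q12 x) (q21 x) (q22 x)"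
    and Q_meas: "\<And>k j. k \<in> {1..2 * n} \<Longrightarrow> j \<in> {1..2 * n} \<Longrightarrow>
                   (\<lambda>x. Q x k j) \<in> borel_measurable (lebesgue_on {0..})"
    and C: "C > 0" and \<epsilon>: "\<epsilon> > 0"
    and Q_bound: "\<And>x. x \<ge> 0 \<Longrightarrow> mat_norm (2 * n) (Q x) \<le> C * exp (- \<epsilon> * x)"
    and canonical: "M_canonical n q11 q12 q21 q22"
  shows
    "\<exists>A11 A12 A21 A22 :: real \<Rightarrow> real \<Rightarrow> cmat.
       (\<forall>lam :: real. \<forall>y1 y2 :: real \<Rightarrow> cvec. \<forall>A B :: cvec.
          is_solution (2 * n) \<xi> Q lam (\<lambda>x. block_vec n (y1 x) (y2 x)) \<and>
          (\<forall>k\<in>{1..n}. bounded ((\<lambda>x. y1 x k) ` {0..}) \<and> bounded ((\<lambda>x. y2 x k) ` {0..})) \<and>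
          (\<forall>k\<in>{1..n}. ((\<lambda>x. y1 x k - exp_diag lam \<xi> x A k) \<longlongrightarrow> 0) at_top) \<and>
          (\<forall>k\<in>{1..n}. ((\<lambda>x. y2 x k - exp_diag lam (\<lambda>j. \<xi> (n + j)) x B k) \<longlongrightarrow> 0) at_top)
          \<longrightarrow>
          (\<forall>x\<ge>0. \<forall>k\<in>{1..n}.
             set_integrable lebesgue {x..}
               (\<lambda>t. mat_vec n (A11 x t) (exp_diag lam \<xi> t A) k) \<and>
             set_integrable lebesgue {x..}
               (\<lambda>t. mat_vec n (A12 x t) (exp_diag lam (\<lambda>j. \<xi> (n + j)) t B) k) \<and>
             set_integrable lebesgue {x..}
               (\<lambda>t. mat_vec n (A21 x t) (exp_diag lam \<xi> t A) k) \<and>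
             set_integrable lebesgue {x..}
               (\<lambda>t. mat_vec n (A22 x t) (exp_diag lam (\<lambda>j. \<xi> (n + j)) t B) k) \<and>
             y1 x k = exp_diag lam \<xi> x A k
               + (LINT t:{x..}|lebesgue. mat_vec n (A11 x t) (exp_diag lam \<xi> t A) k)
               + (LINT t:{x..}|lebesgue.
                    mat_vec n (A12 x t) (exp_diag lam (\<lambda>j. \<xi> (n + j)) t B) k) \<and>
             y2 x k = exp_diag lam (\<lambda>j. \<xi> (n + j)) x B k
               + (LINT t:{x..}|lebesgue. mat_vec n (A21 x t) (exp_diag lam \<xi> t A) k)
               + (LINT t:{x..}|lebesgue.
                    mat_vec n (A22 x t) (exp_diag lam (\<lambda>j. \<xi> (n + j)) t B) k))) \<and>
       (\<forall>x t. 0 \<le> x \<and> x \<le> t \<longrightarrow>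
          lower_triangular n (A11 x t) \<and> lower_anti_triangular n (A12 x t) \<and>
          upper_anti_triangular n (A21 x t) \<and> upper_triangular n (A22 x t)) \<and>
       (\<forall>x t. 0 \<le> x \<and> x \<le> t \<longrightarrow> (\<forall>k\<in>{1..n}. \<forall>j\<in>{1..n}.
          (k \<ge> j \<longrightarrow> kernel_eq (\<xi> j) (\<xi> k) (\<lambda>s. q11 s k j)
             (\<lambda>s \<tau>. mat_mul n (q11 s) (A11 s \<tau>) k j + mat_mul n (q12 s) (A21 s \<tau>) k j)
             (\<lambda>x t. A11 x t k j) x t) \<and>
          (k + j < n + 2 \<longrightarrow> kernel_eq (\<xi> j) (\<xi> (n + k)) (\<lambda>s. q21 s k j)
             (\<lambda>s \<tau>. mat_mul n (q21 s) (A11 s \<tau>) k j + mat_mul n (q22 s) (A21 s \<tau>) k j)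
             (\<lambda>x t. A21 x t k j) x t) \<and>
          (k + j > n \<longrightarrow> kernel_eq (\<xi> (n + j)) (\<xi> k) (\<lambda>s. q12 s k j)
             (\<lambda>s \<tau>. mat_mul n (q12 s) (A22 s \<tau>) k j + mat_mul n (q11 s) (A12 s \<tau>) k j)
             (\<lambda>x t. A12 x t k j) x t) \<and>
          (k \<le> j \<longrightarrow> kernel_eq (\<xi> (n + j)) (\<xi> (n + k)) (\<lambda>s. q22 s k j)
             (\<lambda>s \<tau>. mat_mul n (q21 s) (A12 s \<tau>) k j + mat_mul n (q22 s) (A22 s \<tau>) k j)
             (\<lambda>x t. A22 x t k j) x t))) \<and>
       (\<exists>Ct. \<forall>x t. 0 \<le> x \<and> x \<le> t \<longrightarrow> (\<forall>K\<in>{A11, A12, A21, A22}.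
          mat_norm n (K x t) \<le> Ct * exp (- \<epsilon> * (x + theta n \<xi> * (t - x))))) \<and>
       (\<forall>x\<ge>0. \<forall>k\<in>{1..n}. \<forall>j\<in>{1..n}.
          q11 x k j = - \<i> * complex_of_real ((\<xi> j - \<xi> k) / \<xi> j) * A11 x x k j \<and>
          q12 x k j = - \<i> * complex_of_real ((\<xi> (n + j) - \<xi> k) / \<xi> (n + j)) * A12 x x k j \<and>
          q21 x k j = - \<i> * complex_of_real ((\<xi> j - \<xi> (n + k)) / \<xi> j) * A21 x x k j \<and>
          q22 x k j =
            - \<i> * complex_of_real ((\<xi> (n + j) - \<xi> (n + k)) / \<xi> (n + j)) * A22 x x k j)"
proof -
  \<comment> \<open>On \<open>n + k\<close> this is \<open>n + 1 - k\<close>. For the four blocks,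
    in the order 11, 12, 21, 22, the condition that the column has rank at most that of the row then
    reads \<open>k \<ge> j\<close>, \<open>k + j > n\<close>, \<open>k + j < n + 2\<close>,
    \<open>k \<le> j\<close>: exactly the patterns of the kernels.\<close>
  define r where "r k = (if k \<le> n then k else 2 * n + 1 - k)" for k
  have less: "\<xi> k < \<xi> l" if "1 \<le> k" "k < l" "l \<le> 2 * n" for k l
    using strict_mono_onD[OF \<xi>_mono, of k l] that by simp
  have neg: "\<xi> k < 0" if "k \<in> {1..n}" for k
    using less[of k n] \<xi>_neg that by (cases "k = n") auto
  have pos: "0 < \<xi> (n + k)" if "k \<in> {1..n}" for k
    using less[of "n + 1" "n + k"] \<xi>_pos that by (cases "k = 1") auto
  have split: "k \<in> {1..n} \<or> (\<exists>k'\<in>{1..n}. k = n + k')" if "k \<in> {1..2 * n}" for k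
    using that by (cases "k \<le> n") (auto intro!: bexI[of _ "k - n"])
  have Q_block: "Q x k l = q11 x k l" "Q x k (n + l) = q12 x k l"
    "Q x (n + k) l = q21 x k l" "Q x (n + k) (n + l) = q22 x k l"
    if "k \<in> {1..n}" "l \<in> {1..n}" for x k l
    using that by (auto simp: Q block_mat_def)
  have r: "r k = k" "r (n + k) = n + 1 - k" if "k \<in> {1..n}" for k
    using that by (auto simp: r_def)
  note theta = theta_pos_le[OF n \<xi>_mono \<xi>_neg \<xi>_pos]
  have Q_entry: "norm (Q x k l) \<le> C * exp (- \<epsilon> * x)" if "k \<in> {1..2 * n}" "l \<in> {1..2 * n}" "0 \<le> x" for k l x
    using norm_entry_le_mat_norm[OF that(1,2), of "Q x"] Q_bound[OF that(3)] by simp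
  have Q_zero: "Q x k l = 0" if kl: "k \<in> {1..2 * n}" "l \<in> {1..2 * n}" and x: "0 \<le> x" and rkl: "r k < r l \<or> k = l" for k l x
  proof -
    have can: "strictly_lower_triangular n (q11 x)" "lower_anti_triangular n (q12 x)"
      "upper_anti_triangular n (q21 x)" "strictly_upper_triangular n (q22 x)"
      using canonical x by (auto simp: M_canonical_def)
    from split[OF kl(1)] split[OF kl(2)] show ?thesis
    proof (elim disjE bexE)
      assume "k \<in> {1..n}" "l \<in> {1..n}"
      then show ?thesis
        using can(1) rkl by (auto simp: Q_block r strictly_lower_triangular_def)
    next
      fix l'
      assume "k \<in> {1..n}" "l' \<in> {1..n}" "l = n + l'"
      moreover from this have "k + l' \<le> n"
        using rkl by (auto simp: r)
      ultimately show ?thesis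
        using can(2) by (auto simp: Q_block lower_anti_triangular_def)
    next
      fix k'
      assume "k' \<in> {1..n}" "k = n + k'" "l \<in> {1..n}"
      moreover from this have "k' + l \<ge> n + 2"
        using rkl by (auto simp: r)
      ultimately show ?thesis
        using can(3) by (auto simp: Q_block upper_anti_triangular_def)
    next
      fix k' l'
      assume "k' \<in> {1..n}" "k = n + k'" "l' \<in> {1..n}" "l = n + l'"
      moreover from this have "l' \<le> k'"
        using rkl by (auto simp: r)
      ultimately show ?thesis
        using can(4) by (auto simp: Q_block strictly_upper_triangular_def)
    qed
  qed
  \<comment> \<open>In the mixed blocks the ratio is negative. In the diagonal blocks the order
    decides: the rank increases towards 0 on both sides, so the row of higher rank has the
    eigenvalue of smaller modulus.\<close>
  have pairs: "\<xi> k / \<xi> j < 1 \<and> theta n \<xi> \<le> \<xi> j / (\<xi> j - \<xi> k)"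
    if kj: "k \<in> {1..2 * n}" "j \<in> {1..2 * n}" and rkj: "r j \<le> r k" "k \<noteq> j" for k j
    using split[OF kj(1)] split[OF kj(2)]
  proof (elim disjE bexE)
    assume *: "k \<in> {1..n}" "j \<in> {1..n}"
    then have "j < k"
      using rkj by (simp add: r)
    then show ?thesis
      using * theta(2)[of k j] less[of j k] neg[of j] by (simp add: divide_less_eq)
  next
    fix j'
    assume *: "k \<in> {1..n}" "j' \<in> {1..n}" and j: "j = n + j'"
    have "n + 1 - j' \<le> k"
      using rkj * by (simp add: r j)
    then have "k + j' > n"
      using * by auto
    moreover have "\<xi> k / \<xi> (n + j') < 0"
      using * neg pos by (simp add: divide_neg_pos)
    ultimately show ?thesis
      using * theta(3)[of k j'] by (simp add: j)
  next
    fix k'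
    assume *: "k' \<in> {1..n}" "j \<in> {1..n}" and k: "k = n + k'"
    have "j \<le> n + 1 - k'"
      using rkj * by (simp add: r k)
    then have "k' + j < n + 2"
      using * by auto
    moreover have "\<xi> (n + k') / \<xi> j < 0"
      using * neg pos by (simp add: divide_pos_neg)
    ultimately show ?thesis
      using * theta(4)[of k' j] by (simp add: k)
  next
    fix k' j'
    assume *: "k' \<in> {1..n}" "j' \<in> {1..n}" and kj': "k = n + k'" "j = n + j'"
    have "n + 1 - j' \<le> n + 1 - k'" "k' \<noteq> j'"
      using rkj * by (simp_all add: r kj')
    then have "k' < j'"
      using * by auto
    then show ?thesis
      using * theta(5)[of k' j'] less[of "n + k'" "n + j'"] pos[of j'] by (simp add: kj' divide_less_eq)
  qed
  have nz: "\<xi> k \<noteq> 0" if "k \<in> {1..2 * n}" for k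
    using split[OF that] neg pos by fastforce
  obtain K Ct where
    K_int: "\<And>lam x k j. k \<in> {1..2 * n} \<Longrightarrow> j \<in> {1..2 * n} \<Longrightarrow> 0 \<le> x \<Longrightarrow>
      set_integrable lebesgue {x..} (\<lambda>t. K x t k j * cis (lam * \<xi> j * t))"
    and K_rep: "\<And>lam y a x k. is_solution (2 * n) \<xi> Q lam y \<Longrightarrow>
      (\<And>k. k \<in> {1..2 * n} \<Longrightarrow> bounded ((\<lambda>x. y x k) ` {0..})) \<Longrightarrow>
      (\<And>k. k \<in> {1..2 * n} \<Longrightarrow> ((\<lambda>x. y x k - cis (lam * \<xi> k * x) * a k) \<longlongrightarrow> 0) at_top) \<Longrightarrow>
      k \<in> {1..2 * n} \<Longrightarrow> 0 \<le> x \<Longrightarrow>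
      y x k = cis (lam * \<xi> k * x) * a k
        + (\<Sum>j = 1..2 * n. a j * (LINT t:{x..}|lebesgue. K x t k j * cis (lam * \<xi> j * t)))"
    and K_zero: "\<And>x t k j. k \<in> {1..2 * n} \<Longrightarrow> j \<in> {1..2 * n} \<Longrightarrow> r k < r j \<Longrightarrow> K x t k j = 0"
    and K_eq: "\<And>x t k j. k \<in> {1..2 * n} \<Longrightarrow> j \<in> {1..2 * n} \<Longrightarrow> r j \<le> r k \<Longrightarrow> 0 \<le> x \<Longrightarrow> x \<le> t \<Longrightarrow>
      kernel_eq (\<xi> j) (\<xi> k) (\<lambda>s. Q s k j) (\<lambda>s \<tau>. \<Sum>l = 1..2 * n. Q s k l * K s \<tau> l j) (\<lambda>x t. K x t k j) x t"
    and K_bound: "\<And>x t k j. k \<in> {1..2 * n} \<Longrightarrow> j \<in> {1..2 * n} \<Longrightarrow> 0 \<le> x \<Longrightarrow> x \<le> t \<Longrightarrow>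
      norm (K x t k j) \<le> Ct * exp (- \<epsilon> * (x + theta n \<xi> * (t - x)))"
    and K_diag: "\<And>x k j. k \<in> {1..2 * n} \<Longrightarrow> j \<in> {1..2 * n} \<Longrightarrow> 0 \<le> x \<Longrightarrow>
      Q x k j = - \<i> * complex_of_real ((\<xi> j - \<xi> k) / \<xi> j) * K x x k j"
  proof -
    show thesis
      by (rule triangular_kernels_exist[of C \<epsilon> "theta n \<xi>" \<xi> "2 * n" Q r])
        (rule C \<epsilon> theta(1) strict_mono_on_imp_inj_on[OF \<xi>_mono] |
          (rule nz Q_meas Q_entry Q_zero conjunct1[OF pairs] conjunct2[OF pairs]; assumption) | fact that)+
  qed
  define A11 A12 A21 A22 :: "real \<Rightarrow> real \<Rightarrow> cmat" where
    "A11 x t k j = K x t k j" and "A12 x t k j = K x t k (n + j)" and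
    "A21 x t k j = K x t (n + k) j" and "A22 x t k j = K x t (n + k) (n + j)" for x t k j
  note A_defs = A11_def A12_def A21_def A22_def
  have idx: "k \<in> {1..2 * n}" "n + k \<in> {1..2 * n}" if "k \<in> {1..n}" for k
    using that by auto
  show ?thesis
  proof (rule exI[of _ A11], rule exI[of _ A12], rule exI[of _ A21], rule exI[of _ A22], intro conjI)
    show "\<forall>lam :: real. \<forall>y1 y2 :: real \<Rightarrow> cvec. \<forall>A B :: cvec.
          is_solution (2 * n) \<xi> Q lam (\<lambda>x. block_vec n (y1 x) (y2 x)) \<and>
          (\<forall>k\<in>{1..n}. bounded ((\<lambda>x. y1 x k) ` {0..}) \<and> bounded ((\<lambda>x. y2 x k) ` {0..})) \<and>
          (\<forall>k\<in>{1..n}. ((\<lambda>x. y1 x k - exp_diag lam \<xi> x A k) \<longlongrightarrow> 0) at_top) \<and>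
          (\<forall>k\<in>{1..n}. ((\<lambda>x. y2 x k - exp_diag lam (\<lambda>j. \<xi> (n + j)) x B k) \<longlongrightarrow> 0) at_top)
          \<longrightarrow>
          (\<forall>x\<ge>0. \<forall>k\<in>{1..n}.
             set_integrable lebesgue {x..}
               (\<lambda>t. mat_vec n (A11 x t) (exp_diag lam \<xi> t A) k) \<and>
             set_integrable lebesgue {x..}
               (\<lambda>t. mat_vec n (A12 x t) (exp_diag lam (\<lambda>j. \<xi> (n + j)) t B) k) \<and>
             set_integrable lebesgue {x..}
               (\<lambda>t. mat_vec n (A21 x t) (exp_diag lam \<xi> t A) k) \<and>
             set_integrable lebesgue {x..}
               (\<lambda>t. mat_vec n (A22 x t) (exp_diag lam (\<lambda>j. \<xi> (n + j)) t B) k) \<and>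
             y1 x k = exp_diag lam \<xi> x A k
               + (LINT t:{x..}|lebesgue. mat_vec n (A11 x t) (exp_diag lam \<xi> t A) k)
               + (LINT t:{x..}|lebesgue.
                    mat_vec n (A12 x t) (exp_diag lam (\<lambda>j. \<xi> (n + j)) t B) k) \<and>
             y2 x k = exp_diag lam (\<lambda>j. \<xi> (n + j)) x B k
               + (LINT t:{x..}|lebesgue. mat_vec n (A21 x t) (exp_diag lam \<xi> t A) k)
               + (LINT t:{x..}|lebesgue.
                    mat_vec n (A22 x t) (exp_diag lam (\<lambda>j. \<xi> (n + j)) t B) k))"
    proof (intro allI impI ballI, elim conjE)
      fix lam :: real and y1 y2 :: "real \<Rightarrow> cvec" and A B :: cvec and x :: real and k
      assume sol: "is_solution (2 * n) \<xi> Q lam (\<lambda>x. block_vec n (y1 x) (y2 x))"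
        and bdd: "\<forall>k\<in>{1..n}. bounded ((\<lambda>x. y1 x k) ` {0..}) \<and> bounded ((\<lambda>x. y2 x k) ` {0..})"
        and lim1: "\<forall>k\<in>{1..n}. ((\<lambda>x. y1 x k - exp_diag lam \<xi> x A k) \<longlongrightarrow> 0) at_top"
        and lim2: "\<forall>k\<in>{1..n}. ((\<lambda>x. y2 x k - exp_diag lam (\<lambda>j. \<xi> (n + j)) x B k) \<longlongrightarrow> 0) at_top"
        and x: "0 \<le> x" and k: "k \<in> {1..n}"
      let ?y = "\<lambda>x. block_vec n (y1 x) (y2 x)" and ?a = "block_vec n A B"
      have bv: "block_vec n v w k = v k" "block_vec n v w (n + k) = w k" if "k \<in> {1..n}" for v w :: cvec and k
        using that by (auto simp: block_vec_def)
      have rep: "?y x k = cis (lam * \<xi> k * x) * ?a k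
          + (\<Sum>j = 1..2 * n. ?a j * (LINT t:{x..}|lebesgue. K x t k j * cis (lam * \<xi> j * t)))"
        if "k \<in> {1..2 * n}" for k
      proof (rule K_rep[OF sol _ _ that x])
        fix k
        assume "k \<in> {1..2 * n}"
        from split[OF this] show "bounded ((\<lambda>x. ?y x k) ` {0..})"
          using bdd by (auto simp: bv)
        from split[OF \<open>k \<in> {1..2 * n}\<close>] show "((\<lambda>x. ?y x k - cis (lam * \<xi> k * x) * ?a k) \<longlongrightarrow> 0) at_top"
          using lim1 lim2 by (auto simp: bv exp_diag_cis)
      qed
      have A: "\<forall>j\<in>{1..n}. set_integrable lebesgue {x..} (\<lambda>t. A11 x t k j * cis (lam * \<xi> j * t))"
        "\<forall>j\<in>{1..n}. set_integrable lebesgue {x..} (\<lambda>t. A12 x t k j * cis (lam * \<xi> (n + j) * t))"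
        "\<forall>j\<in>{1..n}. set_integrable lebesgue {x..} (\<lambda>t. A21 x t k j * cis (lam * \<xi> j * t))"
        "\<forall>j\<in>{1..n}. set_integrable lebesgue {x..} (\<lambda>t. A22 x t k j * cis (lam * \<xi> (n + j) * t))"
        unfolding A_defs
        by (intro ballI K_int idx k x; assumption)+
      note S11 = set_integral_mat_vec_exp_diag[where K = "A11 x" and \<zeta> = \<xi> and b = A, OF A(1)]
      note S12 = set_integral_mat_vec_exp_diag[where K = "A12 x" and \<zeta> = "\<lambda>j. \<xi> (n + j)" and b = B, OF A(2)]
      note S21 = set_integral_mat_vec_exp_diag[where K = "A21 x" and \<zeta> = \<xi> and b = A, OF A(3)]
      note S22 = set_integral_mat_vec_exp_diag[where K = "A22 x" and \<zeta> = "\<lambda>j. \<xi> (n + j)" and b = B, OF A(4)]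
      have sum: "(\<Sum>j = 1..2 * n. ?a j * f j) = (\<Sum>j = 1..n. A j * f j) + (\<Sum>j = 1..n. B j * f (n + j))" for f
        unfolding sum_double_split by (intro arg_cong2[where f = "(+)"] sum.cong refl) (simp_all only: bv)
      have y1: "y1 x k = exp_diag lam \<xi> x A k
          + (LINT t:{x..}|lebesgue. mat_vec n (A11 x t) (exp_diag lam \<xi> t A) k)
          + (LINT t:{x..}|lebesgue. mat_vec n (A12 x t) (exp_diag lam (\<lambda>j. \<xi> (n + j)) t B) k)"
        using rep[OF idx(1)[OF k]]
        unfolding S11(2) S12(2) unfolding sum bv[OF k] exp_diag_cis A_defs by (simp only: add.assoc)
      have y2: "y2 x k = exp_diag lam (\<lambda>j. \<xi> (n + j)) x B k
          + (LINT t:{x..}|lebesgue. mat_vec n (A21 x t) (exp_diag lam \<xi> t A) k)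
          + (LINT t:{x..}|lebesgue. mat_vec n (A22 x t) (exp_diag lam (\<lambda>j. \<xi> (n + j)) t B) k)"
        using rep[OF idx(2)[OF k]]
        unfolding S21(2) S22(2) unfolding sum bv[OF k] exp_diag_cis A_defs by (simp only: add.assoc)
      show "set_integrable lebesgue {x..} (\<lambda>t. mat_vec n (A11 x t) (exp_diag lam \<xi> t A) k) \<and>
          set_integrable lebesgue {x..} (\<lambda>t. mat_vec n (A12 x t) (exp_diag lam (\<lambda>j. \<xi> (n + j)) t B) k) \<and>
          set_integrable lebesgue {x..} (\<lambda>t. mat_vec n (A21 x t) (exp_diag lam \<xi> t A) k) \<and>
          set_integrable lebesgue {x..} (\<lambda>t. mat_vec n (A22 x t) (exp_diag lam (\<lambda>j. \<xi> (n + j)) t B) k) \<and>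
          y1 x k = exp_diag lam \<xi> x A k
            + (LINT t:{x..}|lebesgue. mat_vec n (A11 x t) (exp_diag lam \<xi> t A) k)
            + (LINT t:{x..}|lebesgue. mat_vec n (A12 x t) (exp_diag lam (\<lambda>j. \<xi> (n + j)) t B) k) \<and>
          y2 x k = exp_diag lam (\<lambda>j. \<xi> (n + j)) x B k
            + (LINT t:{x..}|lebesgue. mat_vec n (A21 x t) (exp_diag lam \<xi> t A) k)
            + (LINT t:{x..}|lebesgue. mat_vec n (A22 x t) (exp_diag lam (\<lambda>j. \<xi> (n + j)) t B) k)"
        by (intro conjI S11(1) S12(1) S21(1) S22(1) y1 y2)
    qed
    show "\<forall>x t. 0 \<le> x \<and> x \<le> t \<longrightarrow>
          lower_triangular n (A11 x t) \<and> lower_anti_triangular n (A12 x t) \<and>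
          upper_anti_triangular n (A21 x t) \<and> upper_triangular n (A22 x t)"
      unfolding lower_triangular_def lower_anti_triangular_def upper_anti_triangular_def upper_triangular_def A_defs
      by (intro allI impI conjI ballI K_zero idx; simp add: r)
    show "\<forall>x t. 0 \<le> x \<and> x \<le> t \<longrightarrow> (\<forall>k\<in>{1..n}. \<forall>j\<in>{1..n}.
          (k \<ge> j \<longrightarrow> kernel_eq (\<xi> j) (\<xi> k) (\<lambda>s. q11 s k j)
             (\<lambda>s \<tau>. mat_mul n (q11 s) (A11 s \<tau>) k j + mat_mul n (q12 s) (A21 s \<tau>) k j)
             (\<lambda>x t. A11 x t k j) x t) \<and>
          (k + j < n + 2 \<longrightarrow> kernel_eq (\<xi> j) (\<xi> (n + k)) (\<lambda>s. q21 s k j)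
             (\<lambda>s \<tau>. mat_mul n (q21 s) (A11 s \<tau>) k j + mat_mul n (q22 s) (A21 s \<tau>) k j)
             (\<lambda>x t. A21 x t k j) x t) \<and>
          (k + j > n \<longrightarrow> kernel_eq (\<xi> (n + j)) (\<xi> k) (\<lambda>s. q12 s k j)
             (\<lambda>s \<tau>. mat_mul n (q12 s) (A22 s \<tau>) k j + mat_mul n (q11 s) (A12 s \<tau>) k j)
             (\<lambda>x t. A12 x t k j) x t) \<and>
          (k \<le> j \<longrightarrow> kernel_eq (\<xi> (n + j)) (\<xi> (n + k)) (\<lambda>s. q22 s k j)
             (\<lambda>s \<tau>. mat_mul n (q21 s) (A12 s \<tau>) k j + mat_mul n (q22 s) (A22 s \<tau>) k j)
             (\<lambda>x t. A22 x t k j) x t))"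
    proof (intro allI impI ballI, elim conjE)
      fix x t :: real and k j
      assume xt: "0 \<le> x" "x \<le> t" and k: "k \<in> {1..n}" and j: "j \<in> {1..n}"
      have top: "(\<Sum>l = 1..2 * n. Q s k l * f l) = (\<Sum>l = 1..n. q11 s k l * f l) + (\<Sum>l = 1..n. q12 s k l * f (n + l))"
        and bot: "(\<Sum>l = 1..2 * n. Q s (n + k) l * f l) = (\<Sum>l = 1..n. q21 s k l * f l) + (\<Sum>l = 1..n. q22 s k l * f (n + l))"
        for s f
        unfolding sum_double_split
        by (intro arg_cong2[where f = "(+)"] sum.cong refl; simp only: Q_block k)+
      have e11: "kernel_eq (\<xi> j) (\<xi> k) (\<lambda>s. q11 s k j)
             (\<lambda>s \<tau>. mat_mul n (q11 s) (A11 s \<tau>) k j + mat_mul n (q12 s) (A21 s \<tau>) k j)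
             (\<lambda>x t. A11 x t k j) x t" if "k \<ge> j"
        using K_eq[OF idx(1)[OF k] idx(1)[OF j] _ xt] that k j
        unfolding A_defs mat_mul_def top by (simp add: r Q_block del: One_nat_def)
      have e21: "kernel_eq (\<xi> j) (\<xi> (n + k)) (\<lambda>s. q21 s k j)
             (\<lambda>s \<tau>. mat_mul n (q21 s) (A11 s \<tau>) k j + mat_mul n (q22 s) (A21 s \<tau>) k j)
             (\<lambda>x t. A21 x t k j) x t" if "k + j < n + 2"
        using K_eq[OF idx(2)[OF k] idx(1)[OF j] _ xt] that k j
        unfolding A_defs mat_mul_def bot by (simp add: r Q_block del: One_nat_def)
      have e12: "kernel_eq (\<xi> (n + j)) (\<xi> k) (\<lambda>s. q12 s k j)
             (\<lambda>s \<tau>. mat_mul n (q12 s) (A22 s \<tau>) k j + mat_mul n (q11 s) (A12 s \<tau>) k j)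
             (\<lambda>x t. A12 x t k j) x t" if "k + j > n"
        using K_eq[OF idx(1)[OF k] idx(2)[OF j] _ xt] that k j
        \<comment> \<open>The equation for \<open>A12\<close> lists the \<open>q12\<close> summand
          first, whereas splitting the sum over \<open>2 * n\<close> puts \<open>q11\<close>
          first.\<close>
        unfolding add.commute[of "mat_mul n (q12 s) (A22 s \<tau>) k j" for s \<tau>]
        unfolding A_defs mat_mul_def top by (simp add: r Q_block del: One_nat_def)
      have e22: "kernel_eq (\<xi> (n + j)) (\<xi> (n + k)) (\<lambda>s. q22 s k j)
             (\<lambda>s \<tau>. mat_mul n (q21 s) (A12 s \<tau>) k j + mat_mul n (q22 s) (A22 s \<tau>) k j)
             (\<lambda>x t. A22 x t k j) x t" if "k \<le> j"
        using K_eq[OF idx(2)[OF k] idx(2)[OF j] _ xt] that k j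
        unfolding A_defs mat_mul_def bot by (simp add: r Q_block del: One_nat_def)
      show "(k \<ge> j \<longrightarrow> kernel_eq (\<xi> j) (\<xi> k) (\<lambda>s. q11 s k j)
             (\<lambda>s \<tau>. mat_mul n (q11 s) (A11 s \<tau>) k j + mat_mul n (q12 s) (A21 s \<tau>) k j)
             (\<lambda>x t. A11 x t k j) x t) \<and>
          (k + j < n + 2 \<longrightarrow> kernel_eq (\<xi> j) (\<xi> (n + k)) (\<lambda>s. q21 s k j)
             (\<lambda>s \<tau>. mat_mul n (q21 s) (A11 s \<tau>) k j + mat_mul n (q22 s) (A21 s \<tau>) k j)
             (\<lambda>x t. A21 x t k j) x t) \<and>
          (k + j > n \<longrightarrow> kernel_eq (\<xi> (n + j)) (\<xi> k) (\<lambda>s. q12 s k j)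
             (\<lambda>s \<tau>. mat_mul n (q12 s) (A22 s \<tau>) k j + mat_mul n (q11 s) (A12 s \<tau>) k j)
             (\<lambda>x t. A12 x t k j) x t) \<and>
          (k \<le> j \<longrightarrow> kernel_eq (\<xi> (n + j)) (\<xi> (n + k)) (\<lambda>s. q22 s k j)
             (\<lambda>s \<tau>. mat_mul n (q21 s) (A12 s \<tau>) k j + mat_mul n (q22 s) (A22 s \<tau>) k j)
             (\<lambda>x t. A22 x t k j) x t)"
        by (intro conjI impI e11 e21 e12 e22)
    qed
    show "\<exists>Ct. \<forall>x t. 0 \<le> x \<and> x \<le> t \<longrightarrow> (\<forall>K\<in>{A11, A12, A21, A22}.
          mat_norm n (K x t) \<le> Ct * exp (- \<epsilon> * (x + theta n \<xi> * (t - x))))"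
    proof (intro exI[of _ "real n * real n * Ct"] allI impI ballI, elim conjE)
      fix x t :: real and A
      assume xt: "0 \<le> x" "x \<le> t" and A: "A \<in> {A11, A12, A21, A22}"
      have "norm (A x t k j) \<le> Ct * exp (- \<epsilon> * (x + theta n \<xi> * (t - x)))" if "k \<in> {1..n}" "j \<in> {1..n}" for k j
        using A K_bound[OF _ _ xt] idx[OF that(1)] idx[OF that(2)] by (elim insertE) (simp_all add: A_defs)
      then have "mat_norm n (A x t) \<le> real n * real n * (Ct * exp (- \<epsilon> * (x + theta n \<xi> * (t - x))))"
        by (rule mat_norm_le)
      then show "mat_norm n (A x t) \<le> real n * real n * Ct * exp (- \<epsilon> * (x + theta n \<xi> * (t - x)))"
        by (simp only: mult.assoc)
    qed
    show "\<forall>x\<ge>0. \<forall>k\<in>{1..n}. \<forall>j\<in>{1..n}.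
          q11 x k j = - \<i> * complex_of_real ((\<xi> j - \<xi> k) / \<xi> j) * A11 x x k j \<and>
          q12 x k j = - \<i> * complex_of_real ((\<xi> (n + j) - \<xi> k) / \<xi> (n + j)) * A12 x x k j \<and>
          q21 x k j = - \<i> * complex_of_real ((\<xi> j - \<xi> (n + k)) / \<xi> j) * A21 x x k j \<and>
          q22 x k j = - \<i> * complex_of_real ((\<xi> (n + j) - \<xi> (n + k)) / \<xi> (n + j)) * A22 x x k j"
    proof (intro allI impI ballI)
      fix x :: real and k j
      assume x: "0 \<le> x" and k: "k \<in> {1..n}" and j: "j \<in> {1..n}"
      show "q11 x k j = - \<i> * complex_of_real ((\<xi> j - \<xi> k) / \<xi> j) * A11 x x k j \<and>
          q12 x k j = - \<i> * complex_of_real ((\<xi> (n + j) - \<xi> k) / \<xi> (n + j)) * A12 x x k j \<and>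
          q21 x k j = - \<i> * complex_of_real ((\<xi> j - \<xi> (n + k)) / \<xi> j) * A21 x x k j \<and>
          q22 x k j = - \<i> * complex_of_real ((\<xi> (n + j) - \<xi> (n + k)) / \<xi> (n + j)) * A22 x x k j"
        unfolding A_defs Q_block[OF k j, symmetric] by (intro conjI K_diag idx k j x)
    qed
  qed
qed

end
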